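(* Let $(X,d)$, $G$, $o$ be as in the context, and let $(\omega_n)_{n\ge 0}$ and $(\check\omega_n)_{n\ge0}$ be the forward and backward random walks generated by a non-elementary probability measure $\mu$ on $G$. (1) If $\mu$ has finite $p$-th moment for some $p>0$, then there exists $K>0$ such that for every $x\in X$, \[ \mathbb E\Big[\sup_{n\ge 0} (\omega_n o, x)_o^{\,p}\Big]<K,\qquad \mathbb E\Big[\sup_{n,n'\ge 0} (\check\omega_{n'} o,\omega_n o)_o^{\,2p}\Big]<K. \] (2) If $\mu$ has finite exponential moment, then there exist $\kappa,K>0$ such that for every $x\in X$, \[ \mathbb E\Big[\sup_{n\ge 0} e^{\kappa (x,\omega_n o)_o}\Big]<K,\qquad \mathbb E\Big[\sup_{n,n'\ge 0} e^{\kappa(\check\omega_{n'} o,\omega_n o)_o}\Big]<K. \]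
   Context: $(X,d)$ is a geodesic metric space (not necessarily proper or separable), $G$ is a countable group of isometries of $X$ containing two independent contracting isometries, and $o\in X$ is a fixed basepoint. For $A\subseteq X$ and $x\in X$, $\pi_A(x)=\{a\in A: d(x,a)=d(x,A)\}$. A set $A$ is $K$-contracting if $\pi_A(z)\ne\emptyset$ for all $z\in X$ and for all $x,y\in X$ with $d(x,y)\le d(x,A)-K$ one has $\operatorname{diam}(\pi_A(x)\cup\pi_A(y))\le K$. A $K$-quasigeodesic is a map $\gamma$ from an interval of $\mathbb R$ or a set of consecutive integers to $X$ with $|s-t|/K-K\le d(\gamma(s),\gamma(t))\le K|s-t|+K$; a $K$-contracting axis is a $K$-quasigeodesic whose image is $K$-contracting. An isometry $g$ is contracting if for some $K$ the orbit $n\in\mathbb Z\mapsto g^n o$ is a $K$-contracting axis. Bi-infinite sequences $(x_i)_{i\in\mathbb Z},(y_i)_{i\in\mathbb Z}$ are independent if for every $M>0$ the set $\{(n,m):d(x_n,y_m)<M\}$ is bounded; isometries $g,h$ are independent if their orbits $(g^n o)_n,(h^n o)_n$ are independent. A probability measure $\mu$ on $G$ is non-elementary if the semigroup generated by its support contains two independent contracting isometries. Let $(g_i)_{i\in\mathbb Z}$ be i.i.d. with law $\mu$; the forward walk is $\omega_0=\mathrm{id}$, $\omega_n=g_1\cdots g_n$, and the backward walk is $\check\omega_n=\check g_1\cdots\check g_n$ with $\check g_n=g_{-n+1}^{-1}$ (an independent random walk whose steps have law $g\mapsto\mu(g^{-1})$). $\mu$ has finite $p$-th moment if $\int d(o,go)^p\,d\mu(g)<\infty$,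 and finite exponential moment if $\int e^{c\,d(o,go)}d\mu(g)<\infty$ for some $c>0$. The Gromov product is $(y,z)_x=\tfrac12\big(d(x,y)+d(x,z)-d(y,z)\big)$. *)

theory Defs
  imports "HOL-Probability.Probability"
begin

definition geodesic_space :: "'x::metric_space itself \<Rightarrow> bool" where
  "geodesic_space TYPE('x) \<longleftrightarrow>
     (\<forall>x y::'x. \<exists>\<gamma>::real \<Rightarrow> 'x. \<gamma> 0 = x \<and> \<gamma> (dist x y) = y \<and>
        (\<forall>s\<in>{0..dist x y}. \<forall>t\<in>{0..dist x y}. dist (\<gamma> s) (\<gamma> t) = \<bar>s - t\<bar>))"

definition isometry :: "('x::metric_space \<Rightarrow> 'x) \<Rightarrow> bool" where
  "isometry g \<longleftrightarrow> bij g \<and> (\<forall>x y. dist (g x) (g y) = dist x y)"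

definition isometry_group :: "('x::metric_space \<Rightarrow> 'x) set \<Rightarrow> bool" where
  "isometry_group G \<longleftrightarrow> (\<forall>g\<in>G. isometry g) \<and> id \<in> G \<and>
     (\<forall>g\<in>G. \<forall>h\<in>G. g \<circ> h \<in> G) \<and> (\<forall>g\<in>G. inv g \<in> G)"

definition proj :: "'x::metric_space set \<Rightarrow> 'x \<Rightarrow> 'x set" where
  "proj A x = {a\<in>A. dist x a = infdist x A}"

definition contracting :: "real \<Rightarrow> 'x::metric_space set \<Rightarrow> bool" where
  "contracting K A \<longleftrightarrow> (\<forall>z. proj A z \<noteq> {}) \<and>
     (\<forall>x y. dist x y \<le> infdist x A - K \<longrightarrow>
        (\<forall>a\<in>proj A x \<union> proj A y. \<forall>b\<in>proj A x \<union> proj A y. dist a b \<le> K))"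

definition quasigeodesic_int :: "real \<Rightarrow> (int \<Rightarrow> 'x::metric_space) \<Rightarrow> bool" where
  "quasigeodesic_int K \<gamma> \<longleftrightarrow> K > 0 \<and> (\<forall>s t.
      \<bar>real_of_int (s - t)\<bar> / K - K \<le> dist (\<gamma> s) (\<gamma> t) \<and>
      dist (\<gamma> s) (\<gamma> t) \<le> K * \<bar>real_of_int (s - t)\<bar> + K)"

definition contracting_axis_int :: "real \<Rightarrow> (int \<Rightarrow> 'x::metric_space) \<Rightarrow> bool" where
  "contracting_axis_int K \<gamma> \<longleftrightarrow> quasigeodesic_int K \<gamma> \<and> contracting K (range \<gamma>)"

definition ipow :: "('x \<Rightarrow> 'x) \<Rightarrow> int \<Rightarrow> 'x \<Rightarrow> 'x" where
  "ipow g n = (if n \<ge> 0 then g ^^ nat n else inv g ^^ nat (- n))"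

definition contracting_isometry :: "'x::metric_space \<Rightarrow> ('x \<Rightarrow> 'x) \<Rightarrow> bool" where
  "contracting_isometry bp g \<longleftrightarrow> (\<exists>K. contracting_axis_int K (\<lambda>n. ipow g n bp))"

definition independent_seqs :: "(int \<Rightarrow> 'x::metric_space) \<Rightarrow> (int \<Rightarrow> 'x) \<Rightarrow> bool" where
  "independent_seqs x y \<longleftrightarrow>
     (\<forall>M>0. \<exists>N. \<forall>n m. dist (x n) (y m) < M \<longrightarrow> \<bar>n\<bar> \<le> N \<and> \<bar>m\<bar> \<le> N)"

definition independent_isometries :: "'x::metric_space \<Rightarrow> ('x \<Rightarrow> 'x) \<Rightarrow> ('x \<Rightarrow> 'x) \<Rightarrow> bool" where
  "independent_isometries bp g h \<longleftrightarrow> independent_seqs (\<lambda>n. ipow g n bp) (\<lambda>n. ipow h n bp)"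

definition has_two_independent_contracting :: "'x::metric_space \<Rightarrow> ('x \<Rightarrow> 'x) set \<Rightarrow> bool" where
  "has_two_independent_contracting bp S \<longleftrightarrow>
     (\<exists>g\<in>S. \<exists>h\<in>S. contracting_isometry bp g \<and> contracting_isometry bp h \<and> independent_isometries bp g h)"

definition gen_semigroup :: "('x \<Rightarrow> 'x) set \<Rightarrow> ('x \<Rightarrow> 'x) set" where
  "gen_semigroup S = {foldr (\<circ>) l id | l. l \<noteq> [] \<and> set l \<subseteq> S}"

definition non_elementary :: "'x::metric_space \<Rightarrow> ('x \<Rightarrow> 'x) pmf \<Rightarrow> bool" where
  "non_elementary bp \<mu> \<longleftrightarrow> has_two_independent_contracting bp (gen_semigroup (set_pmf \<mu>))"

definition finite_pth_moment :: "'x::metric_space \<Rightarrow> real \<Rightarrow> ('x \<Rightarrow> 'x) pmf \<Rightarrow> bool" where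
  "finite_pth_moment bp p \<mu> \<longleftrightarrow>
     (\<integral>\<^sup>+ g. ennreal (dist bp (g bp) powr p) \<partial>measure_pmf \<mu>) < \<infinity>"

definition finite_exp_moment :: "'x::metric_space \<Rightarrow> ('x \<Rightarrow> 'x) pmf \<Rightarrow> bool" where
  "finite_exp_moment bp \<mu> \<longleftrightarrow>
     (\<exists>c>0. (\<integral>\<^sup>+ g. ennreal (exp (c * dist bp (g bp))) \<partial>measure_pmf \<mu>) < \<infinity>)"

definition gromov :: "'x::metric_space \<Rightarrow> 'x \<Rightarrow> 'x \<Rightarrow> real" where
  "gromov x y z = (dist x y + dist x z - dist y z) / 2"

text \<open>Forward walk: s !! (i-1) is the step g_i; omega_n = g_1 bp ... bp g_n.\<close>
primrec fwd_walk :: "('x \<Rightarrow> 'x) stream \<Rightarrow> nat \<Rightarrow> 'x \<Rightarrow> 'x" where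
  "fwd_walk s 0 = id"
| "fwd_walk s (Suc n) = fwd_walk s n \<circ> (s !! n)"

text \<open>Backward walk: s !! (i-1) is g_{-i+1}; checkomega_n = g_0^-1 bp g_{-1}^-1 bp ... bp g_{-n+1}^-1.\<close>
primrec bwd_walk :: "('x \<Rightarrow> 'x) stream \<Rightarrow> nat \<Rightarrow> 'x \<Rightarrow> 'x" where
  "bwd_walk s 0 = id"
| "bwd_walk s (Suc n) = bwd_walk s n \<circ> inv (s !! n)"

end

theory Submission
  imports Defs "HOL-Real_Asymp.Real_Asymp"
begin

text \<open>
  Cut the walk into blocks of \<open>L\<close> steps.  With positive probability a block is one of four
  Schottky words \<open>g^(iM) h^m g^((3-i)M)\<close>, which are equally likely because they use the same letters.
  By a Behrstock inequality, for every point \<open>x\<close> at most one of the four words has its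
  \<open>h\<close>-segment badly placed as seen from \<open>x\<close> behind it, and similarly for a point \<open>z\<close> ahead;
  a word that is good at both ends blocks, that is, it bounds the Gromov product of \<open>x\<close> and \<open>z\<close>
  seen from it.  Whether the \<open>k\<close>-th block is good for \<open>x\<close> depends on the blocks up to \<open>k\<close> only,
  and whether it is good for \<open>z\<close> on the blocks from \<open>k\<close> on only.  So the two numbers of bad
  blocks are controlled by one supermartingale in each direction, and the probability that none of
  the first \<open>m\<close> blocks blocks is exponentially small, even when weighted by the size of a step.
  The Gromov product at a fixed time is at most the displacement up to the first blocking block.

  The supremum over all times is reduced to a fixed time by Ottaviani's maximal inequality, since a
  Schottky word inserted at time \<open>n\<close> preserves the Gromov product reached there up to a constant,
  whatever the later steps are.
\<close>

section \<open>Contracting sets\<close>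

text \<open>The obstacle is that goodness of a block for \<open>x\<close> is decided by the past and
  goodness for \<open>z\<close> by the future, so no single filtration controls both. Each end gets
  its own product of gains, and the two are combined only at the very end: if no block blocks, the
  product of the two is at least 1, so one of them is, and each has exponentially small mean. The
  \<open>h\<close>-segment is slid along a fixed total power of \<open>g\<close> so that the four
  words keep the same letters while their \<open>h\<close>-axes become translates of one another by
  powers of \<open>g\<close> large enough to separate them. Bounds are kept uniform in the far point
  \<open>x\<close> and in the point ahead. This permits freezing one walk while the other is
  averaged, and it lets the blocks after a given position be treated as a mere choice of
  \<open>z\<close>.\<close>

lemma isometry_dist [simp]: "isometry g \<Longrightarrow> dist (g x) (g y) = dist x y"
  by (simp add: isometry_def)

lemma isometry_bij: "isometry g \<Longrightarrow> bij g"
  by (simp add: isometry_def)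

lemma isometry_inv_f [simp]: "isometry g \<Longrightarrow> inv g (g x) = x"
  by (simp add: isometry_def bij_is_inj)

lemma isometry_f_inv [simp]: "isometry g \<Longrightarrow> g (inv g x) = x"
  by (simp add: isometry_def bij_is_surj surj_f_inv_f)

lemma isometry_inv: "isometry g \<Longrightarrow> isometry (inv g)"
  unfolding isometry_def by (metis bij_imp_bij_inv bij_inv_eq_iff)

lemma isometry_comp: "isometry g \<Longrightarrow> isometry h \<Longrightarrow> isometry (g \<circ> h)"
  by (simp add: isometry_def bij_comp)

lemma isometry_id: "isometry id"
  by (simp add: isometry_def)

lemma isometry_funpow: "isometry g \<Longrightarrow> isometry (g ^^ n)"
  by (induction n) (simp_all add: isometry_comp isometry_id del: o_apply)

lemma dist_inv_left: "isometry g \<Longrightarrow> dist (inv g x) y = dist x (g y)"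
  by (metis isometry_dist isometry_f_inv)

lemma infdist_isometry_image:
  assumes "isometry v"
  shows "infdist (v x) (v ` A) = infdist x A"
  using assms by (simp add: infdist_def image_comp o_def)

lemma proj_isometry:
  assumes "isometry v" "v ` A = A" "a \<in> proj A x"
  shows "v a \<in> proj A (v x)"
  using infdist_isometry_image[OF assms(1), of x A] assms by (auto simp: proj_def)

lemma proj_dist_le: "a \<in> proj A x \<Longrightarrow> b \<in> A \<Longrightarrow> dist x a \<le> dist x b"
  by (simp add: proj_def infdist_le)

lemma contracting_mono: "contracting K A \<Longrightarrow> K \<le> K' \<Longrightarrow> contracting K' A"
  unfolding contracting_def by (smt (verit))

lemma contracting_dist:
  assumes "contracting K A" "dist x y \<le> infdist x A - K" "a \<in> proj A x" "b \<in> proj A y"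
  shows "dist a b \<le> K"
  using assms unfolding contracting_def by blast

lemma geodesic_point:
  assumes "geodesic_space TYPE('x::metric_space)" "0 \<le> t" "t \<le> dist (x::'x) y"
  obtains w where "dist x w = t" "dist w y = dist x y - t"
proof -
  obtain \<gamma> where \<gamma>: "\<gamma> 0 = x" "\<gamma> (dist x y) = y"
    and d: "\<forall>s\<in>{0..dist x y}. \<forall>t\<in>{0..dist x y}. dist (\<gamma> s) (\<gamma> t) = \<bar>s - t\<bar>"
    using assms(1) unfolding geodesic_space_def by blast
  have "dist (\<gamma> 0) (\<gamma> t) = \<bar>0 - t\<bar>" "dist (\<gamma> t) (\<gamma> (dist x y)) = \<bar>t - dist x y\<bar>"
    using d assms(2,3) by auto
  then show ?thesis
    using \<gamma> assms(2,3) by (intro that[of "\<gamma> t"]) auto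
qed

text \<open>If the balls of radius \<open>infdist x A - K\<close> around \<open>x\<close> and \<open>infdist y A - K\<close>
  around \<open>y\<close> overlapped, a common point on the geodesic would have its projection within
  \<open>K\<close> of both projections.\<close>

lemma contracting_far_projections:
  fixes A :: "'x::metric_space set"
  assumes geo: "geodesic_space TYPE('x)" and A: "contracting K A"
    and a: "a \<in> proj A x" and b: "b \<in> proj A y" and far: "dist a b > 2 * K" and "K > 0"
  shows "infdist x A + infdist y A - 2 * K \<le> dist x y"
proof (rule ccontr)
  assume neg: "\<not> ?thesis"
  consider "infdist x A < K" | "infdist y A < K" | "infdist x A \<ge> K" "infdist y A \<ge> K"
    by linarith
  then show False
  proof cases
    case 1
    have "dist b a \<le> K"
      by (rule contracting_dist[OF A _ b a]) (use 1 neg in \<open>simp add: dist_commute\<close>)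
    then show False using far \<open>K > 0\<close> by (simp add: dist_commute)
  next
    case 2
    have "dist a b \<le> K"
      by (rule contracting_dist[OF A _ a b]) (use 2 neg in simp)
    then show False using far \<open>K > 0\<close> by simp
  next
    case 3
    define t where "t = min (infdist x A - K) (dist x y)"
    have t: "0 \<le> t" "t \<le> dist x y" using 3 by (auto simp: t_def)
    obtain w where w: "dist x w = t" "dist w y = dist x y - t"
      using geodesic_point[OF geo t] by blast
    obtain c where c: "c \<in> proj A w" using A unfolding contracting_def by blast
    have "dist a c \<le> K"
      by (rule contracting_dist[OF A _ a c]) (simp add: w t_def)
    moreover have "dist b c \<le> K"
      by (rule contracting_dist[OF A _ b c])
        (use w 3 neg in \<open>auto simp: t_def dist_commute min_def split: if_splits\<close>)
    ultimately show False
      using far dist_triangle[of a b c] by (simp add: dist_commute)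
  qed
qed

text \<open>A step of length \<open>infdist x A - K\<close> along a geodesic towards
  \<open>y\<close> moves the projection by at most \<open>K\<close>, and as long as \<open>x\<close>
  is farther than \<open>3 * K\<close> from \<open>A\<close> it covers at least
  \<open>2 * K\<close>. The number \<open>n\<close> of such steps only serves as induction
  measure.\<close>

lemma contracting_proj_lipschitz:
  fixes A :: "'x::metric_space set"
  assumes geo: "geodesic_space TYPE('x)" and A: "contracting K A" and K: "K > 0"
    and y: "y \<in> A" and a: "a \<in> proj A x" and "dist x y \<le> 2 * K * real n"
  shows "dist a y \<le> dist x y + 3 * K"
  using a \<open>dist x y \<le> _\<close>
proof (induction n arbitrary: x a)
  case 0
  then have "x = y" by simp
  with proj_dist_le[OF "0.prems"(1) y] show ?case using K by simp
next
  case (Suc n)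
  show ?case
  proof (cases "infdist x A \<le> 3 * K")
    case True
    then have "dist x a \<le> 3 * K" using Suc.prems by (simp add: proj_def)
    then show ?thesis using dist_triangle[of a y x] by (simp add: dist_commute)
  next
    case False
    define t where "t = infdist x A - K"
    have t: "0 \<le> t" "t \<le> dist x y"
      using False K infdist_le[OF y, of x] by (auto simp: t_def)
    obtain w where w: "dist x w = t" "dist w y = dist x y - t"
      using geodesic_point[OF geo t] by blast
    obtain c where c: "c \<in> proj A w" using A unfolding contracting_def by blast
    have "dist a c \<le> K"
      by (rule contracting_dist[OF A _ Suc.prems(1) c]) (simp add: w t_def)
    moreover have "dist c y \<le> dist w y + 3 * K"
      by (rule Suc.IH[OF c]) (use w False Suc.prems(2) in \<open>simp add: t_def algebra_simps\<close>)
    ultimately show ?thesis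
      using w False dist_triangle[of a y c] K by (simp add: t_def)
  qed
qed

text \<open>Up to \<open>6 * K\<close>, the way from \<open>x\<close> to a point of \<open>A\<close>
  leads through the projection of \<open>x\<close>: after a step of length
  \<open>infdist x A - K\<close> the projection has moved by at most \<open>K\<close>, and the
  coarse Lipschitz bound handles the rest.\<close>

lemma contracting_proj_between:
  fixes A :: "'x::metric_space set"
  assumes geo: "geodesic_space TYPE('x)" and A: "contracting K A" and K: "K > 0"
    and y: "y \<in> A" and a: "a \<in> proj A x"
  shows "infdist x A + dist a y \<le> dist x y + 6 * K"
proof -
  have lip: "dist c y \<le> dist w y + 3 * K" if "c \<in> proj A w" for w c
  proof -
    obtain n where "dist w y / (2 * K) \<le> real n" using real_arch_simple by blast
    then have "dist w y \<le> 2 * K * real n" using K by (simp add: field_simps)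
    then show ?thesis by (rule contracting_proj_lipschitz[OF geo A K y that])
  qed
  show ?thesis
  proof (cases "infdist x A \<le> 3 * K")
    case True
    then show ?thesis using lip[OF a] by simp
  next
    case False
    define t where "t = infdist x A - K"
    have t: "0 \<le> t" "t \<le> dist x y"
      using False K infdist_le[OF y, of x] by (auto simp: t_def)
    obtain w where w: "dist x w = t" "dist w y = dist x y - t"
      using geodesic_point[OF geo t] by blast
    obtain c where c: "c \<in> proj A w" using A unfolding contracting_def by blast
    have "dist a c \<le> K"
      by (rule contracting_dist[OF A _ a c]) (simp add: w t_def)
    then show ?thesis
      using w lip[OF c] dist_triangle[of a y c] K by (simp add: t_def)
  qed
qed

text \<open>Going from \<open>y\<close> to \<open>p\<close> through \<open>c\<close> costs at most
  \<open>6 * K\<close> extra, and so does going from \<open>c\<close> to \<open>p\<close> or to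
  \<open>y\<close> through the projection \<open>a\<close> of \<open>c\<close> to \<open>A\<close>.
  In the sum of the three estimates all that remains is \<open>2 * dist c a\<close> against
  \<open>18 * K\<close>. Projections of \<open>A\<close> to \<open>B\<close> thus stay close to
  \<open>A\<close>, where independence confines them.\<close>

lemma independent_proj_bounded:
  fixes A B :: "'x::metric_space set"
  assumes geo: "geodesic_space TYPE('x)" and A: "contracting K A" and B: "contracting K B" and K: "K > 0"
    and p: "p \<in> A" "p \<in> B" and y: "y \<in> A" and c: "c \<in> proj B y"
  shows "infdist c A \<le> 9 * K"
proof -
  obtain a where a: "a \<in> proj A c" using A unfolding contracting_def by blast
  have "infdist y B = dist y c" "infdist c A = dist c a" using a c by (auto simp: proj_def)
  then show ?thesis
    using contracting_proj_between[OF geo B K p(2) c]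
      contracting_proj_between[OF geo A K p(1) a] contracting_proj_between[OF geo A K y a]
      dist_triangle[of p y a]
    by (simp add: dist_commute)
qed

lemma translate_proj_bounded:
  fixes A B :: "'x::metric_space set"
  assumes geo: "geodesic_space TYPE('x)" and A: "contracting K A" and B: "contracting K B" and K: "K > 0"
    and p: "p \<in> A" "p \<in> B"
    and bdd: "\<And>y c. y \<in> A \<Longrightarrow> c \<in> proj B y \<Longrightarrow> dist c p \<le> D"
    and v: "isometry v" "v ` B = B" and far: "dist p (v p) > 2 * K + 2 * D"
    and y: "y \<in> A" and a: "a \<in> proj A (v y)"
  shows "dist a p \<le> dist p (v p) + 2 * D + 2 * K"
proof -
  obtain c where c: "c \<in> proj B a" using B unfolding contracting_def by blast
  obtain c' where c': "c' \<in> proj B y" using B unfolding contracting_def by blast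
  have aA: "a \<in> A" using a by (simp add: proj_def)
  have 1: "dist c p \<le> D" "dist c' p \<le> D" using bdd aA y c c' by blast+
  have vc: "v c' \<in> proj B (v y)" by (rule proj_isometry[OF v c'])
  have "dist (v c') (v p) \<le> D" using 1 v by simp
  then have "dist c (v c') > 2 * K"
    using far 1 dist_triangle[of p "v p" c] dist_triangle[of c "v p" "v c'"] by (simp add: dist_commute)
  from contracting_far_projections[OF geo B c vc this K]
  have "infdist a B + infdist (v y) B - 2 * K \<le> dist a (v y)" .
  moreover have "infdist a B = dist a c" "infdist (v y) B = dist (v y) (v c')"
    using c vc by (auto simp: proj_def)
  moreover have "dist (v y) a \<le> dist (v y) p" by (rule proj_dist_le[OF a p(1)])
  moreover have "dist (v c') (v p) \<le> D" by fact
  ultimately show ?thesis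
    using 1 dist_triangle[of a p c] dist_triangle[of "v y" "v p" "v c'"] dist_triangle[of "v y" p "v p"]
    by (simp add: dist_commute)
qed

text \<open>\<open>b\<close> is the projection of \<open>x\<close> to the translate of
  \<open>A\<close> by \<open>v\<close>, pulled back to \<open>A\<close>. If both projections were
  far from the base, each axis would lie closer to \<open>x\<close> than the other one, up to a
  constant.\<close>

lemma behrstock:
  fixes A :: "'x::metric_space set"
  assumes geo: "geodesic_space TYPE('x)" and A: "contracting K A" and K: "K > 0"
    and p: "p \<in> A" and v: "isometry v"
    and bdd1: "\<And>y c. y \<in> A \<Longrightarrow> c \<in> proj A (v y) \<Longrightarrow> dist c p \<le> D"
    and bdd2: "\<And>y c. y \<in> A \<Longrightarrow> c \<in> proj A (inv v y) \<Longrightarrow> dist c p \<le> D"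
    and a: "a \<in> proj A x" and b: "b \<in> proj A (inv v x)"
  shows "dist a p \<le> 8 * K + 3 * D \<or> dist b p \<le> 8 * K + 3 * D"
proof (rule ccontr)
  assume neg: "\<not> ?thesis"
  have aA: "a \<in> A" and bA: "b \<in> A" using a b by (auto simp: proj_def)
  obtain a2 where a2: "a2 \<in> proj A (v b)" using A unfolding contracting_def by blast
  obtain b2 where b2: "b2 \<in> proj A (inv v a)" using A unfolding contracting_def by blast
  obtain e where e: "e \<in> proj A (inv v p)" using A unfolding contracting_def by blast
  have d: "dist a2 p \<le> D" "dist b2 p \<le> D" "dist e p \<le> D"
    using bdd1[OF bA a2] bdd2[OF aA b2] bdd2[OF p e] .
  have D: "D \<ge> 0" using d(1) zero_le_dist[of a2 p] by linarith
  have "dist a a2 > 2 * K" "dist b b2 > 2 * K"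
    using neg d D K dist_triangle[of a p a2] dist_triangle[of b p b2] by auto
  note far = contracting_far_projections[OF geo A a a2 this(1) K]
    contracting_far_projections[OF geo A b b2 this(2) K]
  have eq: "infdist (inv v x) A = dist x (v b)" "infdist x A = dist x a"
    "dist (inv v x) (inv v a) = dist x a" "infdist (v b) A = dist (v b) a2"
    using a b a2 v isometry_inv[OF v] by (auto simp: proj_def dist_inv_left)
  have "dist (v b) a2 \<le> 4 * K"
    using far eq infdist_nonneg[of "inv v a" A] by simp
  moreover have "dist b (inv v p) = dist (v b) p"
    using v by (metis dist_commute dist_inv_left)
  ultimately have 1: "dist b (inv v p) \<le> 4 * K + D"
    using d dist_triangle[of "v b" p a2] by (simp add: dist_commute)
  \<comment> \<open>The way from \<open>b\<close> through \<open>inv v p\<close> and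
    \<open>e\<close> to \<open>p\<close> has length at most
    \<open>(4 * K + D) + (4 * K + D) + D\<close>, which is the constant
    \<open>8 * K + 3 * D\<close>.\<close>
  moreover have "dist (inv v p) e \<le> dist (inv v p) b"
    by (rule proj_dist_le[OF e bA])
  ultimately have "dist b p \<le> 8 * K + 3 * D"
    using d dist_triangle[of b p "inv v p"] dist_triangle[of "inv v p" p e] by (simp add: dist_commute)
  then show False using neg by simp
qed

section \<open>Schottky words\<close>

definition comp_list :: "('x \<Rightarrow> 'x) list \<Rightarrow> 'x \<Rightarrow> 'x" where
  "comp_list l = foldr (\<circ>) l id"

lemma comp_list_Nil [simp]: "comp_list [] = id"
  by (simp add: comp_list_def)

lemma comp_list_Cons [simp]: "comp_list (g # l) = g \<circ> comp_list l"
  by (simp add: comp_list_def)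

lemma comp_list_append [simp]: "comp_list (l @ l') = comp_list l \<circ> comp_list l'"
  by (induction l) (simp_all add: o_assoc)

lemma comp_list_power: "comp_list (concat (replicate n l)) = comp_list l ^^ n"
  by (induction n) simp_all

lemma isometry_comp_list: "(\<And>g. g \<in> set l \<Longrightarrow> isometry g) \<Longrightarrow> isometry (comp_list l)"
  by (induction l) (simp_all add: isometry_id isometry_comp del: o_apply)

lemma comp_list_rev_inv:
  assumes "\<And>g. g \<in> set l \<Longrightarrow> bij g"
  shows "comp_list (rev (map inv l)) = inv (comp_list l)"
proof -
  have "comp_list (rev (map inv l)) = inv (comp_list l) \<and> bij (comp_list l)"
    using assms
    by (induction l) (simp_all add: o_inv_distrib bij_comp del: o_apply)
  then show ?thesis by simp
qed

lemma ipow_Suc: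
  assumes "bij g"
  shows "ipow g (n + 1) x = g (ipow g n x)"
proof (cases "n \<ge> 0")
  case True
  then have "nat (n + 1) = Suc (nat n)" by simp
  then show ?thesis using True by (simp add: ipow_def)
next
  case False
  then have "nat (- n) = Suc (nat (- (n + 1)))" by simp
  then show ?thesis using False assms
    by (auto simp: ipow_def bij_is_surj surj_f_inv_f)
qed

lemma ipow_inv:
  assumes "bij g"
  shows "ipow (inv g) n = ipow g (- n)"
  using assms by (auto simp: ipow_def inv_inv_eq)

lemma ipow_orbit_image:
  assumes "bij g"
  shows "g ` range (\<lambda>n. ipow g n x) = range (\<lambda>n. ipow g n x)"
proof -
  have "ipow g n x \<in> g ` range (\<lambda>n. ipow g n x)" for n
    using ipow_Suc[OF assms, of "n - 1" x] by auto
  then show ?thesis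
    using ipow_Suc[OF assms, of _ x, symmetric] by (auto simp: image_iff)
qed

lemma funpow_image: "f ` A = A \<Longrightarrow> (f ^^ n) ` A = A"
  by (induction n) (simp_all add: image_comp [symmetric] del: o_apply)

lemma inv_image_invariant: "bij f \<Longrightarrow> f ` A = A \<Longrightarrow> inv f ` A = A"
  by (metis bij_is_inj image_inv_f_f)

lemma quasigeodesic_escape:
  assumes "quasigeodesic_int K (\<lambda>n. ipow g n x)"
  obtains M where "M > 0" "\<And>n. n \<ge> M \<Longrightarrow> dist x ((g ^^ n) x) > R"
proof -
  have K: "K > 0" using assms by (simp add: quasigeodesic_int_def)
  obtain M where M: "(\<bar>R\<bar> + K + 1) * K < real M" using reals_Archimedean2 by blast
  have "dist x ((g ^^ n) x) > R" if "n \<ge> M" for n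
  proof -
    have "\<bar>real_of_int (0 - int n)\<bar> / K - K \<le> dist (ipow g 0 x) (ipow g (int n) x)"
      using assms unfolding quasigeodesic_int_def by blast
    then have "real n / K - K \<le> dist x ((g ^^ n) x)" by (simp add: ipow_def)
    moreover have "(\<bar>R\<bar> + K + 1) < real n / K" using M that K by (simp add: field_simps)
    ultimately show ?thesis by linarith
  qed
  moreover have "M > 0" using M K by (cases M) (auto simp: mult_less_0_iff)
  ultimately show ?thesis using that by blast
qed

lemma independent_bounded:
  assumes "independent_isometries bp g h"
  obtains D where "\<And>a b. a \<in> range (\<lambda>n. ipow g n bp) \<Longrightarrow> b \<in> range (\<lambda>n. ipow h n bp) \<Longrightarrow>
    dist a b < M \<Longrightarrow> dist a bp \<le> D"
proof -
  obtain N where N: "\<And>n m. dist (ipow g n bp) (ipow h m bp) < max M 1 \<Longrightarrow> \<bar>n\<bar> \<le> N \<and> \<bar>m\<bar> \<le> N"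
    using assms unfolding independent_isometries_def independent_seqs_def
    by (meson max.strict_coboundedI2 zero_less_one)
  define D where "D = Max ((\<lambda>n. dist (ipow g n bp) bp) ` {-N..N})"
  have "dist a bp \<le> D"
    if "a \<in> range (\<lambda>n. ipow g n bp)" "b \<in> range (\<lambda>n. ipow h n bp)" "dist a b < M" for a b
  proof -
    obtain n m where nm: "a = ipow g n bp" "b = ipow h m bp" using \<open>a \<in> _\<close> \<open>b \<in> _\<close> by blast
    then have "\<bar>n\<bar> \<le> N" using N[of n m] that by auto
    then show ?thesis unfolding D_def nm by (intro Max_ge imageI) auto
  qed
  then show ?thesis using that by blast
qed

text \<open>\<open>F w x\<close> says that, seen from \<open>x\<close> behind the word, the contracting axis in \<open>w\<close> is
  entered near its start; \<open>E w z\<close> says the same for its end and a point \<open>z\<close> in the frame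
  following the word.\<close>

definition schottky ::
  "'x::metric_space \<Rightarrow> ('x \<Rightarrow> 'x) pmf \<Rightarrow> nat \<Rightarrow> ('x \<Rightarrow> 'x) list set \<Rightarrow> real \<Rightarrow> real \<Rightarrow>
   (('x \<Rightarrow> 'x) list \<Rightarrow> 'x \<Rightarrow> bool) \<Rightarrow> (('x \<Rightarrow> 'x) list \<Rightarrow> 'x \<Rightarrow> bool) \<Rightarrow> bool" where
  "schottky bp \<mu> L W \<alpha> C F E \<longleftrightarrow>
     (\<forall>g\<in>set_pmf \<mu>. isometry g) \<and> \<alpha> > 0 \<and> C \<ge> 0 \<and> card W = 4 \<and>
     (\<forall>w\<in>W. pmf (replicate_pmf L \<mu>) w = \<alpha>) \<and>
     (\<forall>x. \<forall>v\<in>W. \<forall>w\<in>W. \<not> F v x \<and> \<not> F w x \<longrightarrow> v = w) \<and>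
     (\<forall>z. \<forall>v\<in>W. \<forall>w\<in>W. \<not> E v z \<and> \<not> E w z \<longrightarrow> v = w) \<and>
     (\<forall>w\<in>W. \<forall>x z. F w x \<and> E w z \<longrightarrow> gromov bp x (comp_list w z) \<le> C)"

lemma pmf_replicate_pmf: "pmf (replicate_pmf (length w) \<mu>) w = prod_list (map (pmf \<mu>) w)"
proof (induction w)
  case (Cons g w)
  have eq: "replicate_pmf (Suc n) \<mu> = map_pmf (\<lambda>(x, xs). x # xs) (pair_pmf \<mu> (replicate_pmf n \<mu>))" for n
    by (simp add: pair_pmf_def map_bind_pmf)
  have inj: "inj (\<lambda>(x, xs). x # xs)" by (auto simp: inj_on_def)
  have "pmf (replicate_pmf (Suc (length w)) \<mu>) ((\<lambda>(x, xs). x # xs) (g, w)) =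
      pmf (pair_pmf \<mu> (replicate_pmf (length w) \<mu>)) (g, w)"
    unfolding eq by (rule pmf_map_inj'[OF inj])
  then show ?case using Cons.IH by (simp add: pmf_pair)
qed simp

text \<open>Word \<open>i\<close> runs along the translate by \<open>u i\<close> of the axis
  \<open>A\<close> of \<open>h\<close>, and these translates are strung along the axis
  \<open>B\<close> of \<open>g\<close>. Independence bounds the projections of \<open>A\<close> to
  \<open>B\<close>, hence those between different translates of \<open>A\<close>, and then the
  Behrstock inequality lets a point be badly placed for at most one of them. The constants are fixed
  in the order \<open>M\<close>, \<open>D\<close>, \<open>m\<close>.\<close>

lemma schottky_exists:
  fixes bp :: "'x::metric_space"
  assumes geo: "geodesic_space TYPE('x)" and iso: "\<And>g. g \<in> set_pmf \<mu> \<Longrightarrow> isometry g"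
    and ne: "non_elementary bp \<mu>"
  obtains L W \<alpha> C F E where "schottky bp \<mu> L W \<alpha> C F E"
proof -
  obtain g h where gh: "g \<in> gen_semigroup (set_pmf \<mu>)" "h \<in> gen_semigroup (set_pmf \<mu>)"
    and cg: "contracting_isometry bp g" and ch: "contracting_isometry bp h"
    and ind: "independent_isometries bp g h"
    using ne unfolding non_elementary_def has_two_independent_contracting_def by blast
  obtain lg lh where lg: "g = comp_list lg" "set lg \<subseteq> set_pmf \<mu>"
    and lh: "h = comp_list lh" "set lh \<subseteq> set_pmf \<mu>"
    using gh unfolding gen_semigroup_def comp_list_def by blast
  have isog: "isometry g" unfolding lg(1) by (rule isometry_comp_list) (use iso lg in blast)
  have isoh: "isometry h" unfolding lh(1) by (rule isometry_comp_list) (use iso lh in blast)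
  obtain K1 K2 where K1: "contracting_axis_int K1 (\<lambda>n. ipow g n bp)"
    and K2: "contracting_axis_int K2 (\<lambda>n. ipow h n bp)"
    using cg ch unfolding contracting_isometry_def by blast
  define K where "K = max K1 K2"
  define A where "A = range (\<lambda>n. ipow h n bp)"
  define B where "B = range (\<lambda>n. ipow g n bp)"
  have K: "K > 0" using K1 by (simp add: contracting_axis_int_def quasigeodesic_int_def K_def less_max_iff_disj)
  have cA: "contracting K A"
    by (rule contracting_mono[of K2]) (use K2 in \<open>auto simp: contracting_axis_int_def A_def K_def\<close>)
  have cB: "contracting K B"
    by (rule contracting_mono[of K1]) (use K1 in \<open>auto simp: contracting_axis_int_def B_def K_def\<close>)
  have pA: "bp \<in> A" unfolding A_def by (rule range_eqI[of _ _ 0]) (simp add: ipow_def)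
  have pB: "bp \<in> B" unfolding B_def by (rule range_eqI[of _ _ 0]) (simp add: ipow_def)
  have neA: "\<exists>a. a \<in> proj A x" for x using cA unfolding contracting_def by blast
  \<comment> \<open>\<open>9 * K\<close> is the bound of \<open>independent_proj_bounded\<close>;
    the extra 1 provides the strict inequality that independence requires.\<close>
  obtain D1 where D1: "\<And>b a. b \<in> B \<Longrightarrow> a \<in> A \<Longrightarrow> dist b a < 9 * K + 1 \<Longrightarrow> dist b bp \<le> D1"
    using independent_bounded[OF ind, of "9 * K + 1"] unfolding A_def B_def by blast
  have bdd: "dist c bp \<le> D1" if "y \<in> A" "c \<in> proj B y" for y c
  proof -
    obtain a where a: "a \<in> proj A c" using neA by blast
    have "infdist c A \<le> 9 * K"
      by (rule independent_proj_bounded[OF geo cA cB K pA pB that])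
    then have "dist c a < 9 * K + 1" "a \<in> A" "c \<in> B" using a that by (auto simp: proj_def)
    then show ?thesis using D1 by blast
  qed
  obtain M where M: "M > 0" "\<And>n. n \<ge> M \<Longrightarrow> dist bp ((g ^^ n) bp) > 2 * K + 2 * D1"
    using quasigeodesic_escape K1 unfolding contracting_axis_int_def by blast
  have gB: "(g ^^ n) ` B = B" for n
    unfolding B_def by (intro funpow_image ipow_orbit_image isometry_bij isog)
  have ison: "isometry (g ^^ n)" "isometry (h ^^ n)" for n using isog isoh by (auto intro: isometry_funpow)
  \<comment> \<open>All powers of \<open>g\<close> that occur have exponent at most
    \<open>3 * M\<close>: the prefixes and suffixes of the words, and the quotients
    \<open>g ^^ ((j - i) * M)\<close> of two prefixes.\<close>
  define R where "R = Max ((\<lambda>n. dist bp ((g ^^ n) bp)) ` {..3 * M})"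
  have R: "dist bp ((g ^^ n) bp) \<le> R" if "n \<le> 3 * M" for n
    unfolding R_def using that by (intro Max_ge) auto
  have R0: "R \<ge> 0" using R[of 0] by simp
  \<comment> \<open>\<open>D1\<close> comes without a sign; the absolute value makes
    \<open>D2\<close> nonnegative.\<close>
  define D2 where "D2 = R + 2 * \<bar>D1\<bar> + 2 * K"
  have trg: "dist c bp \<le> D2"
    if v: "isometry v" "v ` B = B" "dist bp (v bp) = dist bp ((g ^^ n) bp)"
      and n: "M \<le> n" "n \<le> 3 * M" and yc: "y \<in> A" "c \<in> proj A (v y)" for v c y n
  proof -
    have "dist c bp \<le> dist bp (v bp) + 2 * D1 + 2 * K"
      by (rule translate_proj_bounded[OF geo cA cB K pA pB _ v(1,2) _ yc])
        (use bdd M(2)[OF n(1)] v(3) in auto)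
    then show ?thesis using R[OF n(2)] v(3) by (simp add: D2_def)
  qed
  have tr: "dist c bp \<le> D2" if "y \<in> A" "c \<in> proj A ((g ^^ n) y)" "M \<le> n" "n \<le> 3 * M" for c y n
    by (rule trg[OF ison(1) gB refl that(3,4,1,2)])
  have tr': "dist c bp \<le> D2" if "y \<in> A" "c \<in> proj A (inv (g ^^ n) y)" "M \<le> n" "n \<le> 3 * M" for c y n
  proof (rule trg[where v = "inv (g ^^ n)" and n = n and y = y])
    show "isometry (inv (g ^^ n))" by (rule isometry_inv[OF ison(1)])
    show "inv (g ^^ n) ` B = B" by (rule inv_image_invariant[OF isometry_bij[OF ison(1)] gB])
    show "dist bp (inv (g ^^ n) bp) = dist bp ((g ^^ n) bp)"
      by (metis dist_commute dist_inv_left ison(1))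
  qed (use that in auto)
  define D where "D = 8 * K + 3 * D2"
  have D2: "D2 \<le> D" "D \<ge> 0" "D2 \<ge> 0" using K R0 by (auto simp: D_def D2_def)
  have sep: "dist a bp \<le> D \<or> dist b bp \<le> D"
    if "a \<in> proj A x" "b \<in> proj A (inv (g ^^ n) x)" "M \<le> n" "n \<le> 3 * M" for a b x n
    unfolding D_def by (rule behrstock[OF geo cA K pA ison(1)[of n] tr tr' that(1,2)]) (use that in auto)
  \<comment> \<open>The power of \<open>h\<close> is chosen after \<open>D\<close>: it must carry
    the ball of radius \<open>D\<close> around \<open>bp\<close> more than \<open>2 * K\<close> away
    from itself, so that entering near one end and leaving near the other gives projections far
    apart.\<close>
  obtain m where m: "dist bp ((h ^^ m) bp) > 2 * K + 2 * D"
    using quasigeodesic_escape K2 unfolding contracting_axis_int_def by blast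
  define H where "H = h ^^ m"
  have isoH: "isometry H" unfolding H_def by (rule ison)
  have HA: "H ` A = A" unfolding H_def A_def by (intro funpow_image ipow_orbit_image isometry_bij isoh)
  define u where "u i = g ^^ (i * M)" for i
  define wd where "wd i = concat (replicate (i * M) lg) @ concat (replicate m lh) @ concat (replicate ((3 - i) * M) lg)" for i
  \<comment> \<open>Projections to the translated axis are read off in its own frame, which is why
    \<open>x\<close> is pulled back by \<open>u i\<close>.\<close>
  define P where "P i x \<longleftrightarrow> (\<forall>a\<in>proj A (inv (u i) x). dist a bp \<le> D)" for i x
  define Q where "Q i z \<longleftrightarrow> (\<forall>a\<in>proj A (u (3 - i) z). dist a bp \<le> D)" for i z
  have isou: "isometry (u i)" for i unfolding u_def by (rule ison)
  have wd: "comp_list (wd i) = u i \<circ> H \<circ> u (3 - i)" for i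
    by (simp add: wd_def u_def H_def comp_list_power o_assoc flip: lg(1) lh(1))
  have u_add: "u (i + k) = u i \<circ> u k" for i k by (simp add: u_def funpow_add add_mult_distrib)
  have jM: "M \<le> (j - i) * M" "(j - i) * M \<le> 3 * M" if "i < j" "j \<le> 3" for i j
  proof -
    have "1 \<le> j - i" "j - i \<le> 3" using that by linarith+
    then show "M \<le> (j - i) * M" "(j - i) * M \<le> 3 * M"
      using mult_le_mono1[of 1 "j - i" M] by simp_all
  qed
  have Puniq: "P i x \<or> P j x" if ij: "i < j" "j \<le> 3" for i j x
  proof (rule ccontr)
    assume "\<not> ?thesis"
    then obtain a b where ab: "a \<in> proj A (inv (u i) x)" "dist a bp > D" "b \<in> proj A (inv (u j) x)" "dist b bp > D"
      unfolding P_def by force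
    \<comment> \<open>The frames of the words \<open>i\<close> and \<open>j\<close> differ by
      \<open>g ^^ ((j - i) * M)\<close>, whose exponent lies in the range covered by
      \<open>sep\<close>.\<close>
    have "u j = u i \<circ> u (j - i)" using ij u_add[of i "j - i"] by simp
    then have "inv (u j) x = inv (u (j - i)) (inv (u i) x)"
      by (simp add: o_inv_distrib isometry_bij isou)
    with ab sep[of a "inv (u i) x" b "(j - i) * M"] jM[OF ij] show False
      by (auto simp: u_def)
  qed
  have Quniq: "Q i z \<or> Q j z" if ij: "i < j" "j \<le> 3" for i j z
  proof (rule ccontr)
    assume "\<not> ?thesis"
    then obtain a b where ab: "a \<in> proj A (u (3 - i) z)" "dist a bp > D" "b \<in> proj A (u (3 - j) z)" "dist b bp > D"
      unfolding Q_def by force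
    have "u (3 - i) = u (j - i) \<circ> u (3 - j)" using ij u_add[of "j - i" "3 - j"] by simp
    then have "u (3 - j) z = inv (u (j - i)) (u (3 - i) z)"
      by (simp add: isou)
    with ab sep[of a "u (3 - i) z" b "(j - i) * M"] jM[OF ij] show False
      by (auto simp: u_def)
  qed
  define C where "C = R + D + K + dist bp (H bp)"
  have C0: "C \<ge> 0" using R0 D2 K by (simp add: C_def)
  \<comment> \<open>In the frame of the axis, \<open>x\<close> projects near \<open>bp\<close> and
    the endpoint near \<open>H bp\<close>. Hence their distance is, up to \<open>2 * K\<close>, at
    least the sum of their distances to \<open>A\<close>, while the distances from \<open>bp\<close>
    exceed these two only by constants.\<close>
  have block: "gromov bp x (u i (H (u (3 - i) z))) \<le> C" if i: "i \<le> 3" and PQ: "P i x" "Q i z" for i x z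
  proof -
    define s where "s = u (3 - i) z"
    obtain a where a: "a \<in> proj A (inv (u i) x)" using neA by blast
    obtain b where b: "b \<in> proj A s" using neA by blast
    have ab: "dist a bp \<le> D" "dist b bp \<le> D" using PQ a b by (auto simp: P_def Q_def s_def)
    have Hb: "H b \<in> proj A (H s)" by (rule proj_isometry[OF isoH HA b])
    have d1: "dist (H b) (H bp) \<le> D" using ab isoH by simp
    have "dist a (H b) > 2 * K"
      using m ab d1 dist_triangle[of bp "H bp" a] dist_triangle[of a "H bp" "H b"]
      by (simp add: H_def dist_commute)
    from contracting_far_projections[OF geo cA a Hb this K]
    have 1: "dist (inv (u i) x) a + dist (H s) (H b) - 2 * K \<le> dist (inv (u i) x) (H s)"
      using a Hb by (auto simp: proj_def)
    have 2: "dist (inv (u i) x) (H s) = dist x (u i (H s))"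
      by (simp add: dist_inv_left isou)
    have r: "dist bp (u i bp) \<le> R" unfolding u_def by (rule R) (use i in simp)
    have 3: "dist bp x \<le> R + D + dist (inv (u i) x) a"
    proof -
      have "dist bp x = dist (inv (u i) x) (inv (u i) bp)"
        by (simp add: isometry_inv isou dist_commute)
      moreover have "dist bp (inv (u i) bp) \<le> R"
        using r by (metis dist_commute dist_inv_left isou)
      ultimately show ?thesis
        using ab dist_triangle[of "inv (u i) x" "inv (u i) bp" a] dist_triangle[of a "inv (u i) bp" bp]
        by simp
    qed
    have 4: "dist bp (u i (H s)) \<le> R + dist bp (H bp) + D + dist (H s) (H b)"
    proof -
      have "dist (u i bp) (u i (H s)) = dist bp (H s)" by (simp add: isou)
      then show ?thesis
        using r d1 dist_triangle[of bp "u i (H s)" "u i bp"] dist_triangle[of bp "H s" "H bp"]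
          dist_triangle[of "H bp" "H s" "H b"] by (simp add: dist_commute)
    qed
    show ?thesis
      using 1 3 4 zero_le_dist[of bp "H bp"]
      unfolding gromov_def C_def s_def[symmetric] 2[symmetric] by argo
  qed
  have Qbp: "Q i bp" if "i \<le> 3" for i
  proof (cases "i = 3")
    case True
    have "infdist bp A = 0" using pA by simp
    then show ?thesis using True D2 by (auto simp: Q_def u_def proj_def)
  next
    case False
    show ?thesis unfolding Q_def u_def
    proof
      fix a assume "a \<in> proj A ((g ^^ ((3 - i) * M)) bp)"
      then have "dist a bp \<le> D2" by (rule tr[OF pA]) (use False that in auto)
      then show "dist a bp \<le> D" using D2 by simp
    qed
  qed
  \<comment> \<open>This serves to show that the four lists differ, although nothing is known about
    the letters of \<open>lg\<close> and \<open>lh\<close>. The endpoint of word \<open>i\<close>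
    projects beyond the \<open>h\<close>-segment, so it is bad for the index \<open>i\<close>, and
    no point is bad for two indices.\<close>
  have nP: "\<not> P i (u i (H (u (3 - i) bp)))" if "i \<le> 3" for i
  proof
    assume P: "P i (u i (H (u (3 - i) bp)))"
    obtain b where b: "b \<in> proj A (u (3 - i) bp)" using neA by blast
    then have 1: "dist b bp \<le> D" using Qbp[OF that] by (auto simp: Q_def)
    have "H b \<in> proj A (H (u (3 - i) bp))" by (rule proj_isometry[OF isoH HA b])
    then have "dist (H b) bp \<le> D" using P by (simp add: P_def isou)
    moreover have "dist (H b) (H bp) \<le> D" using 1 isoH by simp
    ultimately show False
      using m K dist_triangle[of bp "H bp" "H b"] by (simp add: H_def dist_commute)
  qed
  have inj: "inj_on wd {..3}"
  proof -
    have "wd i \<noteq> wd j" if "i < j" "j \<le> 3" for i j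
    proof
      assume "wd i = wd j"
      then have "(u i \<circ> H \<circ> u (3 - i)) bp = (u j \<circ> H \<circ> u (3 - j)) bp" using wd by metis
      then show False
        using nP[of i] nP[of j] Puniq[OF that, of "u i (H (u (3 - i) bp))"] that by simp
    qed
    then show ?thesis by (auto simp: inj_on_def) (metis linorder_neqE_nat)
  qed
  \<comment> \<open>\<open>F\<close> and \<open>E\<close> have to be predicates on words, so the
    index is recovered from the word.\<close>
  define ix where "ix = the_inv_into {..3} wd"
  have ix: "ix (wd i) = i" if "i \<le> 3" for i
    unfolding ix_def using inj that by (simp add: the_inv_into_f_f)
  define L where "L = length (wd 0)"
  have len: "length (wd i) = L \<and> prod_list (map (pmf \<mu>) (wd i)) = prod_list (map (pmf \<mu>) (wd 0))"
    if "i \<le> 3" for i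
  proof -
    have ll: "length (concat (replicate n l)) = n * length l" for n and l :: "('x \<Rightarrow> 'x) list"
      by (induction n) auto
    have pp: "prod_list (map (pmf \<mu>) (concat (replicate n l))) = prod_list (map (pmf \<mu>) l) ^ n"
      for n and l by (induction n) auto
    have "i * M + (3 - i) * M = 3 * M"
      using that by (metis add_mult_distrib le_add_diff_inverse)
    then have "a ^ (i * M) * a ^ ((3 - i) * M) = a ^ (3 * M)" "i * M * k + (3 - i) * M * k = 3 * M * k"
      for a :: real and k
      by (metis power_add, metis add_mult_distrib)
    then show ?thesis
      by (simp add: wd_def L_def ll pp mult.left_commute mult.assoc)
  qed
  define \<alpha> where "\<alpha> = prod_list (map (pmf \<mu>) (wd 0))"
  have "\<alpha> > 0"
  proof -
    have "set (wd 0) \<subseteq> set_pmf \<mu>" using lg lh by (auto simp: wd_def set_replicate_conv_if)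
    moreover have "set l \<subseteq> set_pmf \<mu> \<Longrightarrow> prod_list (map (pmf \<mu>) l) > 0" for l
      by (induction l) (auto simp: pmf_positive)
    ultimately show ?thesis by (simp add: \<alpha>_def)
  qed
  moreover have "pmf (replicate_pmf L \<mu>) (wd i) = \<alpha>" if "i \<le> 3" for i
    using pmf_replicate_pmf[of "wd i" \<mu>] len[OF that] by (simp add: \<alpha>_def)
  moreover have "card (wd ` {..3}) = 4" using inj by (simp add: card_image)
  moreover have "\<forall>x. \<forall>v\<in>wd ` {..3}. \<forall>w\<in>wd ` {..3}. \<not> P (ix v) x \<and> \<not> P (ix w) x \<longrightarrow> v = w"
  proof (intro allI ballI impI, elim imageE conjE, goal_cases)
    case (1 x v w i j)
    then have "i = j" using Puniq[of i j x] Puniq[of j i x] by (cases i j rule: linorder_cases) (auto simp: ix)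
    then show ?case using 1 by simp
  qed
  moreover have "\<forall>x. \<forall>v\<in>wd ` {..3}. \<forall>w\<in>wd ` {..3}. \<not> Q (ix v) x \<and> \<not> Q (ix w) x \<longrightarrow> v = w"
  proof (intro allI ballI impI, elim imageE conjE, goal_cases)
    case (1 x v w i j)
    then have "i = j" using Quniq[of i j x] Quniq[of j i x] by (cases i j rule: linorder_cases) (auto simp: ix)
    then show ?case using 1 by simp
  qed
  moreover have "\<forall>w\<in>wd ` {..3}. \<forall>x z. P (ix w) x \<and> Q (ix w) z \<longrightarrow> gromov bp x (comp_list w z) \<le> C"
    using block by (auto simp: ix wd)
  ultimately have "schottky bp \<mu> L (wd ` {..3}) \<alpha> C (\<lambda>w. P (ix w)) (\<lambda>w. Q (ix w))"
    unfolding schottky_def using iso C0 by blast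
  then show ?thesis by (rule that)
qed

section \<open>Inverse step laws, which drive the backward walk\<close>

lemma independent_isometries_inv:
  assumes "bij g" "bij h" "independent_isometries bp g h"
  shows "independent_isometries bp (inv g) (inv h)"
  using assms(3) unfolding independent_isometries_def independent_seqs_def
    ipow_inv[OF assms(1)] ipow_inv[OF assms(2)]
  by (metis abs_minus_cancel)

lemma contracting_isometry_inv:
  assumes "bij g" "contracting_isometry bp g"
  shows "contracting_isometry bp (inv g)"
proof -
  obtain K where K: "contracting_axis_int K (\<lambda>n. ipow g n bp)"
    using assms unfolding contracting_isometry_def by blast
  have "range (\<lambda>n. ipow (inv g) n bp) = range (\<lambda>n. ipow g n bp)"
    unfolding ipow_inv[OF assms(1)] by (auto simp: image_iff) (metis minus_minus)
  moreover have "quasigeodesic_int K (\<lambda>n. ipow (inv g) n bp)"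
    unfolding quasigeodesic_int_def
  proof (intro conjI allI)
    show "K > 0" using K by (simp add: contracting_axis_int_def quasigeodesic_int_def)
    fix s t
    have eq: "\<bar>real_of_int (- s - - t)\<bar> = \<bar>real_of_int (s - t)\<bar>" by simp
    have "\<bar>real_of_int (- s - - t)\<bar> / K - K \<le> dist (ipow g (- s) bp) (ipow g (- t) bp) \<and>
      dist (ipow g (- s) bp) (ipow g (- t) bp) \<le> K * \<bar>real_of_int (- s - - t)\<bar> + K"
      using K unfolding contracting_axis_int_def quasigeodesic_int_def by blast
    then show "\<bar>real_of_int (s - t)\<bar> / K - K \<le> dist (ipow (inv g) s bp) (ipow (inv g) t bp)"
      "dist (ipow (inv g) s bp) (ipow (inv g) t bp) \<le> K * \<bar>real_of_int (s - t)\<bar> + K"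
      unfolding eq ipow_inv[OF assms(1)] by auto
  qed
  ultimately show ?thesis
    using K unfolding contracting_isometry_def contracting_axis_int_def by auto
qed

text \<open>The inverse of a product of steps is the reversed product of the inverse steps, and
  reversing the time of an orbit affects neither contraction nor independence.\<close>

lemma non_elementary_inv:
  assumes bij: "\<And>g. g \<in> set_pmf \<mu> \<Longrightarrow> bij g" and ne: "non_elementary bp \<mu>"
  shows "non_elementary bp (map_pmf inv \<mu>)"
proof -
  have *: "bij g \<and> inv g \<in> gen_semigroup (set_pmf (map_pmf inv \<mu>))" if "g \<in> gen_semigroup (set_pmf \<mu>)" for g
  proof -
    obtain l where l: "g = comp_list l" "l \<noteq> []" "set l \<subseteq> set_pmf \<mu>"
      using \<open>g \<in> _\<close> unfolding gen_semigroup_def comp_list_def by blast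
    have "bij g" unfolding l(1) using l(3) bij by (induction l) (auto intro: bij_comp)
    moreover have "inv g = comp_list (rev (map inv l))"
      unfolding l(1) by (rule comp_list_rev_inv[symmetric]) (use l bij in blast)
    ultimately show ?thesis
      using l unfolding gen_semigroup_def comp_list_def
      by (intro conjI CollectI exI[of _ "rev (map inv l)"]) auto
  qed
  then show ?thesis
    using ne contracting_isometry_inv independent_isometries_inv
    unfolding non_elementary_def has_two_independent_contracting_def by meson
qed

section \<open>Blocks of steps\<close>

lemma gromov_commute: "gromov a x y = gromov a y x"
  by (simp add: gromov_def dist_commute)

lemma gromov_nonneg: "gromov a x y \<ge> 0"
  using dist_triangle[of x y a] by (simp add: gromov_def dist_commute)

text \<open>Commuting two binds replaces Fubini: over an uncountable type the product of two
  discrete sigma-algebras need not be discrete, so an arbitrary \<open>f\<close> need not be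
  measurable for a product measure.\<close>

lemma nn_integral_pmf_swap:
  "(\<integral>\<^sup>+x. \<integral>\<^sup>+y. f x y \<partial>measure_pmf B \<partial>measure_pmf A) =
   (\<integral>\<^sup>+y. \<integral>\<^sup>+x. f x y \<partial>measure_pmf A \<partial>measure_pmf B)"
proof -
  have "(\<integral>\<^sup>+z. f (fst z) (snd z) \<partial>bind_pmf A (\<lambda>x. bind_pmf B (\<lambda>y. return_pmf (x, y)))) =
    (\<integral>\<^sup>+z. f (fst z) (snd z) \<partial>bind_pmf B (\<lambda>y. bind_pmf A (\<lambda>x. return_pmf (x, y))))"
    by (subst bind_commute_pmf) simp
  then show ?thesis by simp
qed

lemma nn_integral_replicate_pmf_add:
  "(\<integral>\<^sup>+l. f l \<partial>replicate_pmf (m + n) p) =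
   (\<integral>\<^sup>+l. \<integral>\<^sup>+l'. f (l @ l') \<partial>replicate_pmf n p \<partial>replicate_pmf m p)"
  unfolding replicate_pmf_distrib by simp

lemma replicate_pmf_concat:
  "map_pmf concat (replicate_pmf n (replicate_pmf k p)) = replicate_pmf (n * k) p"
proof (induction n)
  case (Suc n)
  have "replicate_pmf (Suc n * k) p = replicate_pmf (k + n * k) p" by simp
  also have "\<dots> = map_pmf concat (replicate_pmf (Suc n) (replicate_pmf k p))"
    unfolding replicate_pmf_distrib Suc.IH [symmetric]
    by (simp add: map_bind_pmf bind_map_pmf map_pmf_def bind_assoc_pmf bind_return_pmf)
  finally show ?case ..
qed simp

lemma nn_integral_replicate_pmf_sum_list:
  fixes f :: "'a \<Rightarrow> ennreal"
  shows "(\<integral>\<^sup>+l. sum_list (map f l) \<partial>replicate_pmf n p) = of_nat n * (\<integral>\<^sup>+x. f x \<partial>p)"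
  by (induction n) (simp_all add: nn_integral_add measure_pmf.emeasure_space_1 algebra_simps)

lemma nn_integral_replicate_pmf_prod_list:
  fixes f :: "'a \<Rightarrow> ennreal"
  shows "(\<integral>\<^sup>+l. prod_list (map f l) \<partial>replicate_pmf n p) = (\<integral>\<^sup>+x. f x \<partial>p) ^ n"
  by (induction n) (simp_all add: nn_integral_cmult nn_integral_multc)

lemma AE_replicate_pmf:
  "AE l in measure_pmf (replicate_pmf n p). length l = n \<and> set l \<subseteq> set_pmf p"
  by (auto simp: AE_measure_pmf_iff set_replicate_pmf)

section \<open>Displacements, and products of gains along blocks\<close>

definition displacement :: "'x::metric_space \<Rightarrow> ('x \<Rightarrow> 'x) list \<Rightarrow> real" where
  "displacement bp l = (\<Sum>g\<leftarrow>l. dist bp (g bp))"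

lemma displacement_nonneg: "displacement bp l \<ge> 0"
  unfolding displacement_def by (intro sum_list_nonneg) auto

lemma displacement_Nil [simp]: "displacement bp [] = 0"
  by (simp add: displacement_def)

lemma displacement_append [simp]: "displacement bp (l @ l') = displacement bp l + displacement bp l'"
  by (simp add: displacement_def)

lemma dist_comp_list_le:
  assumes "\<And>g. g \<in> set l \<Longrightarrow> isometry g"
  shows "dist bp (comp_list l bp) \<le> displacement bp l"
  using assms
proof (induction l)
  case (Cons g l)
  then have "dist (g bp) (g (comp_list l bp)) \<le> displacement bp l" by simp
  then show ?case
    using dist_triangle[of bp "g (comp_list l bp)" "g bp"] by (simp add: displacement_def)
qed simp

text \<open>A factor sees \<open>x\<close> in the frame reached after the preceding blocks, so it
  depends on the blocks up to its own. In \<open>backward_prod\<close> it sees \<open>z\<close>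
  moved by the following blocks, so it depends on the blocks from its own on. With \<open>q\<close>
  a gain these are the two supermartingales.\<close>

primrec forward_prod :: "(('x \<Rightarrow> 'x) list \<Rightarrow> 'x \<Rightarrow> real) \<Rightarrow> ('x \<Rightarrow> 'x) list list \<Rightarrow> 'x \<Rightarrow> ennreal" where
  "forward_prod q [] x = 1"
| "forward_prod q (c # cs) x = ennreal (q c x) * forward_prod q cs (inv (comp_list c) x)"

primrec backward_prod :: "(('x \<Rightarrow> 'x) list \<Rightarrow> 'x \<Rightarrow> real) \<Rightarrow> ('x \<Rightarrow> 'x) list list \<Rightarrow> 'x \<Rightarrow> ennreal" where
  "backward_prod q [] z = 1"
| "backward_prod q (c # cs) z = ennreal (q c (comp_list (concat cs) z)) * backward_prod q cs z"

text \<open>The factor may depend on the position, so that a moment can be placed on one chosen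
  block as well as on all of them.\<close>

definition weight :: "(nat \<Rightarrow> 'a \<Rightarrow> ennreal) \<Rightarrow> 'a list \<Rightarrow> ennreal" where
  "weight w cs = (\<Prod>k<length cs. w k (cs ! k))"

lemma weight_Nil [simp]: "weight w [] = 1"
  by (simp add: weight_def)

lemma weight_Cons [simp]: "weight w (c # cs) = w 0 c * weight (\<lambda>k. w (Suc k)) cs"
  unfolding weight_def by (simp add: prod.lessThan_Suc_shift del: prod.lessThan_Suc)

text \<open>Given the first block, the induction hypothesis bounds the integral over the others
  uniformly in the shifted point; the first block is integrated last.\<close>

lemma nn_integral_forward_prod_le:
  assumes "\<And>k x. (\<integral>\<^sup>+c. w k c * ennreal (q c x) \<partial>measure_pmf \<nu>) \<le> r k"
  shows "(\<integral>\<^sup>+cs. weight w cs * forward_prod q cs x \<partial>replicate_pmf m \<nu>) \<le> (\<Prod>k<m. r k)"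
  using assms
proof (induction m arbitrary: w r x)
  case (Suc m)
  have "(\<integral>\<^sup>+cs. weight w cs * forward_prod q cs x \<partial>replicate_pmf (Suc m) \<nu>) =
    (\<integral>\<^sup>+c. \<integral>\<^sup>+cs. (w 0 c * ennreal (q c x)) *
      (weight (\<lambda>k. w (Suc k)) cs * forward_prod q cs (inv (comp_list c) x)) \<partial>replicate_pmf m \<nu> \<partial>\<nu>)"
    by (simp add: ac_simps)
  also have "\<dots> = (\<integral>\<^sup>+c. w 0 c * ennreal (q c x) *
      (\<integral>\<^sup>+cs. weight (\<lambda>k. w (Suc k)) cs * forward_prod q cs (inv (comp_list c) x) \<partial>replicate_pmf m \<nu>) \<partial>\<nu>)"
    by (subst nn_integral_cmult) simp_all
  also have "\<dots> \<le> (\<integral>\<^sup>+c. w 0 c * ennreal (q c x) * (\<Prod>k<m. r (Suc k)) \<partial>\<nu>)"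
    by (intro nn_integral_mono mult_left_mono Suc.IH Suc.prems) auto
  also have "\<dots> = (\<integral>\<^sup>+c. w 0 c * ennreal (q c x) \<partial>\<nu>) * (\<Prod>k<m. r (Suc k))"
    by (simp add: nn_integral_multc)
  also have "\<dots> \<le> r 0 * (\<Prod>k<m. r (Suc k))"
    by (intro mult_right_mono Suc.prems) auto
  finally show ?case by (simp add: prod.lessThan_Suc_shift del: prod.lessThan_Suc)
qed simp

text \<open>The factor of the first block involves all later blocks, so the order is reversed: the
  first block is integrated first, with the later ones fixed.\<close>

lemma nn_integral_backward_prod_le:
  assumes "\<And>k x. (\<integral>\<^sup>+c. w k c * ennreal (q c x) \<partial>measure_pmf \<nu>) \<le> r k"
  shows "(\<integral>\<^sup>+cs. weight w cs * backward_prod q cs z \<partial>replicate_pmf m \<nu>) \<le> (\<Prod>k<m. r k)"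
  using assms
proof (induction m arbitrary: w r)
  case (Suc m)
  have "(\<integral>\<^sup>+cs. weight w cs * backward_prod q cs z \<partial>replicate_pmf (Suc m) \<nu>) =
    (\<integral>\<^sup>+c. \<integral>\<^sup>+cs. weight (\<lambda>k. w (Suc k)) cs * backward_prod q cs z *
      (w 0 c * ennreal (q c (comp_list (concat cs) z))) \<partial>replicate_pmf m \<nu> \<partial>\<nu>)"
    by (simp add: ac_simps)
  also have "\<dots> = (\<integral>\<^sup>+cs. weight (\<lambda>k. w (Suc k)) cs * backward_prod q cs z *
      (\<integral>\<^sup>+c. w 0 c * ennreal (q c (comp_list (concat cs) z)) \<partial>\<nu>) \<partial>replicate_pmf m \<nu>)"
    by (subst nn_integral_pmf_swap) (simp add: nn_integral_cmult)
  also have "\<dots> \<le> (\<integral>\<^sup>+cs. weight (\<lambda>k. w (Suc k)) cs * backward_prod q cs z * r 0 \<partial>replicate_pmf m \<nu>)"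
    by (intro nn_integral_mono mult_left_mono Suc.prems) auto
  also have "\<dots> = (\<integral>\<^sup>+cs. weight (\<lambda>k. w (Suc k)) cs * backward_prod q cs z \<partial>replicate_pmf m \<nu>) * r 0"
    by (simp add: nn_integral_multc)
  also have "\<dots> \<le> (\<Prod>k<m. r (Suc k)) * r 0"
    by (intro mult_right_mono Suc.IH Suc.prems) auto
  finally show ?case by (simp add: prod.lessThan_Suc_shift ac_simps del: prod.lessThan_Suc)
qed simp

locale schottky_walk =
  fixes bp :: "'x::metric_space" and \<mu> L W \<alpha> C F E
  assumes schottky: "schottky bp \<mu> L W \<alpha> C F E"
begin

definition block_pmf :: "('x \<Rightarrow> 'x) list pmf" where
  "block_pmf = replicate_pmf L \<mu>"

text \<open>The values are reciprocal, so one good end cannot outweigh one bad end. With four words,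
  at most one of them bad, the mean is at most \<open>1 + \<alpha> * (1 - 3 / 2)\<close>; with three
  words one bad word could balance the two good ones exactly.\<close>

definition gain :: "(('x \<Rightarrow> 'x) list \<Rightarrow> 'x \<Rightarrow> bool) \<Rightarrow> ('x \<Rightarrow> 'x) list \<Rightarrow> 'x \<Rightarrow> real" where
  "gain P c x = (if c \<in> W then if P c x then 1 / 2 else 2 else 1)"

primrec unblocked :: "('x \<Rightarrow> 'x) list list \<Rightarrow> 'x \<Rightarrow> 'x \<Rightarrow> bool" where
  "unblocked [] x z \<longleftrightarrow> True"
| "unblocked (c # cs) x z \<longleftrightarrow>
     \<not> (c \<in> W \<and> F c x \<and> E c (comp_list (concat cs) z)) \<and> unblocked cs (inv (comp_list c) x) z"

lemma isometry_step: "g \<in> set_pmf \<mu> \<Longrightarrow> isometry g"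
  and \<alpha>_pos: "\<alpha> > 0"
  and C_nonneg: "C \<ge> 0"
  and card_W: "card W = 4"
  and pmf_W: "w \<in> W \<Longrightarrow> pmf block_pmf w = \<alpha>"
  and F_unique: "v \<in> W \<Longrightarrow> w \<in> W \<Longrightarrow> \<not> F v x \<Longrightarrow> \<not> F w x \<Longrightarrow> v = w"
  and E_unique: "v \<in> W \<Longrightarrow> w \<in> W \<Longrightarrow> \<not> E v x \<Longrightarrow> \<not> E w x \<Longrightarrow> v = w"
  and W_block: "w \<in> W \<Longrightarrow> F w x \<Longrightarrow> E w z \<Longrightarrow> gromov bp x (comp_list w z) \<le> C"
proof -
  note S = schottky[unfolded schottky_def]
  show "g \<in> set_pmf \<mu> \<Longrightarrow> isometry g" "\<alpha> > 0" "C \<ge> 0" "card W = 4"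
    "w \<in> W \<Longrightarrow> pmf block_pmf w = \<alpha>"
    using S by (simp_all add: block_pmf_def)
  have "\<forall>x. \<forall>v\<in>W. \<forall>w\<in>W. \<not> F v x \<and> \<not> F w x \<longrightarrow> v = w" using S by (elim conjE)
  then show "v \<in> W \<Longrightarrow> w \<in> W \<Longrightarrow> \<not> F v x \<Longrightarrow> \<not> F w x \<Longrightarrow> v = w" by blast
  have "\<forall>z. \<forall>v\<in>W. \<forall>w\<in>W. \<not> E v z \<and> \<not> E w z \<longrightarrow> v = w" using S by (elim conjE)
  then show "v \<in> W \<Longrightarrow> w \<in> W \<Longrightarrow> \<not> E v x \<Longrightarrow> \<not> E w x \<Longrightarrow> v = w" by blast
  have "\<forall>w\<in>W. \<forall>x z. F w x \<and> E w z \<longrightarrow> gromov bp x (comp_list w z) \<le> C" using S by (elim conjE)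
  then show "w \<in> W \<Longrightarrow> F w x \<Longrightarrow> E w z \<Longrightarrow> gromov bp x (comp_list w z) \<le> C" by blast
qed

lemma finite_W: "finite W"
  by (rule ccontr) (use card_W in simp)

lemma \<alpha>_le_1: "\<alpha> \<le> 1"
proof -
  have "W \<noteq> {}" using card_W by auto
  then obtain w where "w \<in> W" by blast
  then show ?thesis using pmf_W[of w] pmf_le_1[of block_pmf w] by simp
qed

lemma set_block_pmf: "c \<in> set_pmf block_pmf \<Longrightarrow> set c \<subseteq> set_pmf \<mu>"
  by (auto simp: block_pmf_def set_replicate_pmf)

lemma W_subset: "w \<in> W \<Longrightarrow> w \<in> set_pmf block_pmf"
  using pmf_W[of w] \<alpha>_pos by (simp add: set_pmf_iff)

lemma L_pos: "L > 0"
proof (rule ccontr)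
  assume "\<not> L > 0"
  then have "set_pmf block_pmf = {[]}" unfolding block_pmf_def by simp
  then have "W \<subseteq> {[]}" using W_subset by blast
  then have "card W \<le> card {[] :: ('x \<Rightarrow> 'x) list}" by (intro card_mono) auto
  then show False using card_W by simp
qed

lemma isometry_blocks:
  assumes "set cs \<subseteq> set_pmf block_pmf" "c \<in> set cs" "g \<in> set c"
  shows "isometry g"
proof -
  have "c \<in> set_pmf block_pmf" using assms by auto
  then have "g \<in> set_pmf \<mu>" using set_block_pmf assms(3) by auto
  then show ?thesis by (rule isometry_step)
qed

lemma gain_nonneg: "gain P c x \<ge> 0"
  by (simp add: gain_def)

lemma gain_le_2: "gain P c x \<le> 2"
  by (simp add: gain_def)

lemma nn_integral_gain_le:
  assumes "\<And>v w. v \<in> W \<Longrightarrow> w \<in> W \<Longrightarrow> \<not> P v x \<Longrightarrow> \<not> P w x \<Longrightarrow> v = w"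
  shows "(\<integral>\<^sup>+c. ennreal (gain P c x) \<partial>block_pmf) \<le> ennreal (1 - \<alpha> / 2)"
proof -
  \<comment> \<open>The deviation of the gain from 1 on a Schottky word: it is 1 for at most one
    word and -1/2 for the others.\<close>
  define e where "e v = (if P v x then - 1 / 2 else 1 :: real)" for v
  have gain: "gain P c x = 1 + (\<Sum>v\<in>W. e v * indicator {v} c)" for c
  proof (cases "c \<in> W")
    case True
    then have "(\<Sum>v\<in>W. e v * indicator {v} c) = e c"
      using finite_W by (simp add: indicator_def if_distrib[of "\<lambda>t. e _ * t"] cong: if_cong)
    then show ?thesis using True by (simp add: gain_def e_def)
  next
    case False
    then have "(\<Sum>v\<in>W. e v * indicator {v} c) = 0"
      by (intro sum.neutral) (auto simp: indicator_def)
    then show ?thesis using False by (simp add: gain_def)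
  qed
  have int: "integrable (measure_pmf block_pmf) (\<lambda>c. \<Sum>v\<in>W. e v * indicator {v} c)"
    by (intro Bochner_Integration.integrable_sum integrable_mult_right
        measure_pmf.integrable_const_bound[where B = 1]) (auto simp: indicator_def)
  have "measure_pmf.expectation block_pmf (\<lambda>c. gain P c x) = 1 + (\<Sum>v\<in>W. e v * \<alpha>)"
  proof -
    have "measure_pmf.expectation block_pmf (\<lambda>c. \<Sum>v\<in>W. e v * indicator {v} c) =
      (\<Sum>v\<in>W. measure_pmf.expectation block_pmf (\<lambda>c. e v * indicator {v} c))"
      by (intro Bochner_Integration.integral_sum integrable_mult_right
        measure_pmf.integrable_const_bound[where B = 1]) (auto simp: indicator_def)
    also have "\<dots> = (\<Sum>v\<in>W. e v * \<alpha>)"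
      by (intro sum.cong) (auto simp: pmf_W measure_pmf_single)
    finally show ?thesis unfolding gain using int by simp
  qed
  moreover have "(\<Sum>v\<in>W. e v) \<le> - 1 / 2"
  proof (cases "\<exists>v\<in>W. \<not> P v x")
    case True
    then obtain v where v: "v \<in> W" "\<not> P v x" by blast
    have "(\<Sum>v\<in>W. e v) = e v + (\<Sum>w\<in>W - {v}. e w)"
      using v finite_W by (simp add: sum.remove)
    also have "(\<Sum>w\<in>W - {v}. e w) = (\<Sum>w\<in>W - {v}. - 1 / 2)"
      by (intro sum.cong) (use assms v in \<open>auto simp: e_def\<close>)
    finally show ?thesis using v card_W finite_W by (simp add: e_def)
  next
    case False
    then have "(\<Sum>v\<in>W. e v) = (\<Sum>v\<in>W. - 1 / 2)"
      by (intro sum.cong) (auto simp: e_def)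
    then show ?thesis using card_W by simp
  qed
  ultimately have "measure_pmf.expectation block_pmf (\<lambda>c. gain P c x) \<le> 1 - \<alpha> / 2"
    using \<alpha>_pos mult_right_mono[of "\<Sum>v\<in>W. e v" "- 1 / 2" \<alpha>] by (simp flip: sum_distrib_right)
  moreover have "integrable (measure_pmf block_pmf) (\<lambda>c. gain P c x)"
    by (rule measure_pmf.integrable_const_bound[where B = 2]) (auto simp: gain_def)
  ultimately show ?thesis
    by (subst nn_integral_eq_integral) (auto simp: gain_nonneg ennreal_leI)
qed

text \<open>The gains average to less than 1, but a block that is bad at either end has gain product at
  least 1.\<close>

lemma unblocked_gain:
  assumes "unblocked cs x z"
  shows "1 \<le> forward_prod (gain F) cs x * backward_prod (gain E) cs z"
  using assms
proof (induction cs arbitrary: x)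
  case (Cons c cs)
  have "\<not> (c \<in> W \<and> F c x \<and> E c (comp_list (concat cs) z))"
    using Cons.prems unfolding unblocked.simps by (rule conjunct1)
  then have "1 \<le> gain F c x * gain E c (comp_list (concat cs) z)"
    unfolding gain_def
    by (cases "c \<in> W"; cases "F c x"; cases "E c (comp_list (concat cs) z)") simp_all
  then have 1: "1 \<le> ennreal (gain F c x) * ennreal (gain E c (comp_list (concat cs) z))"
    by (simp add: gain_nonneg flip: ennreal_mult)
  have "1 \<le> forward_prod (gain F) cs (inv (comp_list c) x) * backward_prod (gain E) cs z"
    using Cons by simp
  from mult_mono[OF 1 this] show ?case by (simp add: ac_simps)
qed simp

text \<open>The forward and backward products depend on overlapping sets of blocks, so the mean of
  their product is out of reach. The mean of their sum is not.\<close>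

lemma one_le_sum_of_prod:
  fixes a b :: ennreal
  assumes "1 \<le> a * b"
  shows "1 \<le> a + b"
proof (rule ccontr)
  assume "\<not> ?thesis"
  then have "a + b < 1" by simp
  moreover have "a \<le> a + b" "b \<le> a + b" by simp_all
  ultimately have "a \<le> 1" "b < 1" by (meson le_less_trans less_imp_le)+
  then have "a * b \<le> 1 * b" by (intro mult_right_mono) simp_all
  then show False using assms \<open>b < 1\<close> by simp
qed

text \<open>The factor 2 counts the two directions, each of which contributes the same
  bound.\<close>

lemma nn_integral_unblocked_le:
  assumes w: "\<And>k P x. P = F \<or> P = E \<Longrightarrow> (\<integral>\<^sup>+c. w k c * ennreal (gain P c x) \<partial>block_pmf) \<le> r k"
  shows "(\<integral>\<^sup>+cs. weight w cs * indicator {cs. unblocked cs x z} cs \<partial>replicate_pmf m block_pmf) \<le>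
    2 * (\<Prod>k<m. r k)"
proof -
  have "(\<integral>\<^sup>+cs. weight w cs * indicator {cs. unblocked cs x z} cs \<partial>replicate_pmf m block_pmf) \<le>
    (\<integral>\<^sup>+cs. weight w cs * (forward_prod (gain F) cs x + backward_prod (gain E) cs z) \<partial>replicate_pmf m block_pmf)"
    by (intro nn_integral_mono mult_left_mono)
      (auto simp: indicator_def intro!: one_le_sum_of_prod unblocked_gain)
  also have "\<dots> = (\<integral>\<^sup>+cs. weight w cs * forward_prod (gain F) cs x \<partial>replicate_pmf m block_pmf) +
    (\<integral>\<^sup>+cs. weight w cs * backward_prod (gain E) cs z \<partial>replicate_pmf m block_pmf)"
    by (simp add: distrib_left nn_integral_add)
  also have "\<dots> \<le> (\<Prod>k<m. r k) + (\<Prod>k<m. r k)"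
    by (intro add_mono nn_integral_forward_prod_le nn_integral_backward_prod_le w) auto
  finally show ?thesis by (simp add: mult_2)
qed

text \<open>Measuring from the image of \<open>bp\<close> instead of \<open>bp\<close> changes the
  distances to \<open>x\<close> and to the endpoint by at most the displacement each, and leaves
  their mutual distance alone.\<close>

lemma gromov_comp_list_le:
  assumes "\<And>g. g \<in> set c \<Longrightarrow> isometry g"
  shows "gromov bp x (comp_list c y) \<le> displacement bp c + gromov bp (inv (comp_list c) x) y"
proof -
  define v where "v = comp_list c"
  have v: "isometry v" unfolding v_def by (rule isometry_comp_list[OF assms])
  have 1: "dist bp (v bp) \<le> displacement bp c"
    unfolding v_def by (rule dist_comp_list_le[OF assms])
  have "dist x (v bp) = dist bp (inv v x)" "dist x (v y) = dist (inv v x) y" "dist (v bp) (v y) = dist bp y"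
    using v by (metis dist_commute dist_inv_left, metis dist_inv_left, simp)
  then show ?thesis
    using 1 dist_triangle[of bp x "v bp"] dist_triangle[of bp "v y" "v bp"]
    unfolding gromov_def v_def[symmetric] by (simp add: dist_commute field_simps)
qed

text \<open>The blocks of the prefix are tested against the true endpoint, so the point ahead of the
  prefix is the image of \<open>bp\<close> under all remaining blocks. If no block blocks,
  \<open>m\<close> is the full length and the Gromov product left over is that of a point with
  \<open>bp\<close>, which is 0.\<close>

lemma first_block:
  assumes "set cs \<subseteq> set_pmf block_pmf"
  shows "\<exists>m\<le>length cs. unblocked (take m cs) x (comp_list (concat (drop m cs)) bp) \<and>
    gromov bp x (comp_list (concat cs) bp) \<le> displacement bp (concat (take m cs)) + C"
  using assms
proof (induction cs arbitrary: x)
  case Nil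
  then show ?case using C_nonneg by (simp add: gromov_def dist_commute)
next
  case (Cons c cs)
  show ?case
  proof (cases "c \<in> W \<and> F c x \<and> E c (comp_list (concat cs) bp)")
    case True
    then show ?thesis using W_block by (intro exI[of _ 0]) simp
  next
    case False
    obtain m where m: "m \<le> length cs"
      "unblocked (take m cs) (inv (comp_list c) x) (comp_list (concat (drop m cs)) bp)"
      "gromov bp (inv (comp_list c) x) (comp_list (concat cs) bp) \<le> displacement bp (concat (take m cs)) + C"
      using Cons.IH[of "inv (comp_list c) x"] Cons.prems by auto
    have "comp_list (concat (take m cs)) (comp_list (concat (drop m cs)) bp) = comp_list (concat cs) bp"
      by (metis append_take_drop_id comp_apply comp_list_append concat_append)
    moreover have "gromov bp x (comp_list c (comp_list (concat cs) bp)) \<le>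
        displacement bp c + gromov bp (inv (comp_list c) x) (comp_list (concat cs) bp)"
      by (rule gromov_comp_list_le) (use Cons.prems isometry_blocks[of "c # cs" c] in simp)
    ultimately show ?thesis
      using m False by (intro exI[of _ "Suc m"]) simp
  qed
qed

end

section \<open>Moments of the displacement before the first blocking block\<close>

lemma nn_integral_affine_sum:
  fixes f :: "'b \<Rightarrow> 'a \<Rightarrow> ennreal"
  shows "(\<integral>\<^sup>+x. a * (b * u x + (\<Sum>j\<in>J. f j x * u x)) \<partial>measure_pmf q) =
    a * (b * (\<integral>\<^sup>+x. u x \<partial>measure_pmf q) + (\<Sum>j\<in>J. \<integral>\<^sup>+x. f j x * u x \<partial>measure_pmf q))"
  by (simp add: nn_integral_cmult nn_integral_add nn_integral_sum)

lemma nn_integral_replicate_pmf_mono: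
  assumes "\<And>l. length l = n \<Longrightarrow> set l \<subseteq> set_pmf p \<Longrightarrow> f l \<le> g l"
  shows "(\<integral>\<^sup>+l. f l \<partial>replicate_pmf n p) \<le> (\<integral>\<^sup>+l. g l \<partial>replicate_pmf n p)"
  by (rule nn_integral_mono_AE) (use AE_replicate_pmf[of n p] assms in auto)

lemma nn_integral_replicate_pmf_cong:
  assumes "\<And>l. length l = n \<Longrightarrow> set l \<subseteq> set_pmf p \<Longrightarrow> f l = g l"
  shows "(\<integral>\<^sup>+l. f l \<partial>replicate_pmf n p) = (\<integral>\<^sup>+l. g l \<partial>replicate_pmf n p)"
  by (intro antisym nn_integral_replicate_pmf_mono) (simp_all add: assms)

text \<open>Bounding the sum by the length times the maximum treats \<open>p < 1\<close> and
  \<open>p \<ge> 1\<close> alike, at the price of a polynomial factor that the exponential decay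
  absorbs.\<close>

lemma sum_list_powr_le:
  fixes xs :: "real list"
  assumes "\<And>x. x \<in> set xs \<Longrightarrow> x \<ge> 0" "p > 0"
  shows "sum_list xs powr p \<le> real (length xs) powr p * (\<Sum>x\<leftarrow>xs. x powr p)"
proof (cases "xs = []")
  case False
  define M where "M = Max (set xs)"
  have M: "M \<in> set xs" unfolding M_def using False by (intro Max_in) auto
  have "sum_list xs \<le> (\<Sum>x\<leftarrow>xs. M)"
    using sum_list_mono[of xs "\<lambda>x. x" "\<lambda>_. M"] by (simp add: M_def)
  then have "sum_list xs \<le> real (length xs) * M" by (simp add: sum_list_triv)
  moreover have "sum_list xs \<ge> 0" using assms(1) by (rule sum_list_nonneg)
  ultimately have "sum_list xs powr p \<le> (real (length xs) * M) powr p"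
    using assms(2) by (intro powr_mono2) auto
  also have "\<dots> = real (length xs) powr p * M powr p"
    using assms(1) M by (simp add: powr_mult)
  also have "M powr p \<le> (\<Sum>x\<leftarrow>xs. x powr p)"
    by (rule member_le_sum_list) (use M in auto)
  finally show ?thesis by (simp add: mult_left_mono)
qed (use assms in simp)

lemma sum_list_ennreal:
  "(\<And>x. x \<in> set xs \<Longrightarrow> f x \<ge> 0) \<Longrightarrow> (\<Sum>x\<leftarrow>xs. ennreal (f x)) = ennreal (\<Sum>x\<leftarrow>xs. f x)"
proof (induction xs)
  case (Cons x xs)
  then have "0 \<le> (\<Sum>x\<leftarrow>xs. f x)" by (intro sum_list_nonneg) auto
  then show ?case using Cons by (simp add: ennreal_plus)
qed simp

lemma summable_powr_geometric:
  fixes q \<rho> :: real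
  assumes "0 < \<rho>" "\<rho> < 1"
  shows "summable (\<lambda>m. real (m + 1) powr q * \<rho> ^ m)"
proof (rule summable_comparison_test_bigo)
  define s where "s = - ln \<rho>"
  have s: "s > 0" "\<rho> = exp (- s)" using assms by (auto simp: s_def)
  show "summable (\<lambda>m. norm (exp (- s / 2) ^ m))" using s by (simp add: summable_geometric)
  show "(\<lambda>m. real (m + 1) powr q * \<rho> ^ m) \<in> O(\<lambda>m. exp (- s / 2) ^ m)"
    unfolding s(2) using s(1) by real_asymp
qed

lemma displacement_concat: "displacement bp (concat cs) = (\<Sum>c\<leftarrow>cs. displacement bp c)"
  by (induction cs) simp_all

text \<open>\<open>D\<close> is counted as one more summand, whence
  \<open>length cs + 1\<close>.\<close>

lemma displacement_concat_powr_le: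
  assumes "p > 0" "D \<ge> 0"
  shows "(displacement bp (concat cs) + D) powr p \<le>
    real (length cs + 1) powr p * (D powr p + (\<Sum>k<length cs. displacement bp (cs ! k) powr p))"
proof -
  have "(\<Sum>c\<leftarrow>cs. displacement bp c powr p) = (\<Sum>k<length cs. displacement bp (cs ! k) powr p)"
    by (simp add: sum_list_sum_nth atLeast0LessThan)
  moreover have "x \<ge> 0" if "x \<in> set (D # map (displacement bp) cs)" for x
    using that assms displacement_nonneg by auto
  note sum_list_powr_le[of "D # map (displacement bp) cs" p, OF this assms(1)]
  ultimately show ?thesis by (simp add: displacement_concat o_def add_ac)
qed

lemma nn_integral_take_drop:
  assumes "m \<le> Q"
  shows "(\<integral>\<^sup>+cs. f (take m cs) (drop m cs) \<partial>replicate_pmf Q \<nu>) =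
    (\<integral>\<^sup>+ds. \<integral>\<^sup>+cs. f cs ds \<partial>replicate_pmf m \<nu> \<partial>replicate_pmf (Q - m) \<nu>)"
proof -
  have "(\<integral>\<^sup>+cs. f (take m cs) (drop m cs) \<partial>replicate_pmf (m + (Q - m)) \<nu>) =
    (\<integral>\<^sup>+cs. \<integral>\<^sup>+ds. f (take m (cs @ ds)) (drop m (cs @ ds)) \<partial>replicate_pmf (Q - m) \<nu> \<partial>replicate_pmf m \<nu>)"
    by (rule nn_integral_replicate_pmf_add)
  also have "\<dots> = (\<integral>\<^sup>+cs. \<integral>\<^sup>+ds. f cs ds \<partial>replicate_pmf (Q - m) \<nu> \<partial>replicate_pmf m \<nu>)"
    by (rule nn_integral_replicate_pmf_cong) simp
  also have "\<dots> = (\<integral>\<^sup>+ds. \<integral>\<^sup>+cs. f cs ds \<partial>replicate_pmf m \<nu> \<partial>replicate_pmf (Q - m) \<nu>)"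
    by (rule nn_integral_pmf_swap)
  finally show ?thesis using assms by simp
qed

context schottky_walk
begin

text \<open>The blocks after position \<open>m\<close> are independent of the prefix and enter only
  as the point ahead of it, over which \<open>B\<close> is uniform.\<close>

lemma nn_integral_unblocked_take_le:
  assumes B: "\<And>x z. (\<integral>\<^sup>+cs. f cs * indicator {cs. unblocked cs x z} cs \<partial>replicate_pmf m block_pmf) \<le> B"
    and "m \<le> Q"
  shows "(\<integral>\<^sup>+cs. f (take m cs) * indicator {ds. unblocked ds x (comp_list (concat (drop m cs)) bp)} (take m cs)
    \<partial>replicate_pmf Q block_pmf) \<le> B"
proof -
  have "(\<integral>\<^sup>+cs. f (take m cs) * indicator {ds. unblocked ds x (comp_list (concat (drop m cs)) bp)} (take m cs)
    \<partial>replicate_pmf Q block_pmf) = (\<integral>\<^sup>+ds. \<integral>\<^sup>+cs. f cs * indicator {cs. unblocked cs x (comp_list (concat ds) bp)} cs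
      \<partial>replicate_pmf m block_pmf \<partial>replicate_pmf (Q - m) block_pmf)"
    by (rule nn_integral_take_drop[OF \<open>m \<le> Q\<close>, where f = "\<lambda>cs ds. f cs *
        indicator {cs. unblocked cs x (comp_list (concat ds) bp)} cs"])
  also have "\<dots> \<le> (\<integral>\<^sup>+ds. B \<partial>replicate_pmf (Q - m) block_pmf)"
    by (intro nn_integral_mono B)
  finally show ?thesis by (simp add: measure_pmf.emeasure_space_1)
qed

text \<open>The random position of the first blocking block is replaced by a sum over all positions,
  each restricted to the event that the prefix is unblocked.\<close>

lemma nn_integral_gromov_le:
  fixes h :: "real \<Rightarrow> ennreal"
  assumes mono: "\<And>s t. 0 \<le> s \<Longrightarrow> s \<le> t \<Longrightarrow> h s \<le> h t"
    and B: "\<And>m x z. (\<integral>\<^sup>+cs. h (displacement bp (concat cs) + C) * indicator {cs. unblocked cs x z} cs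
      \<partial>replicate_pmf m block_pmf) \<le> B m"
  shows "(\<integral>\<^sup>+l. h (gromov bp x (comp_list l bp)) \<partial>replicate_pmf (Q * L) \<mu>) \<le> (\<Sum>m\<le>Q. B m)"
proof -
  define f where "f m cs = h (displacement bp (concat (take m cs)) + C) *
    indicator {ds. unblocked ds x (comp_list (concat (drop m cs)) bp)} (take m cs)" for m cs
  have "(\<integral>\<^sup>+l. h (gromov bp x (comp_list l bp)) \<partial>replicate_pmf (Q * L) \<mu>) =
    (\<integral>\<^sup>+cs. h (gromov bp x (comp_list (concat cs) bp)) \<partial>replicate_pmf Q block_pmf)"
    by (simp add: block_pmf_def flip: replicate_pmf_concat)
  also have "\<dots> \<le> (\<integral>\<^sup>+cs. (\<Sum>m\<le>Q. f m cs) \<partial>replicate_pmf Q block_pmf)"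
  proof (rule nn_integral_replicate_pmf_mono)
    fix cs assume cs: "length cs = Q" "set cs \<subseteq> set_pmf block_pmf"
    then obtain m where m: "m \<le> Q" "unblocked (take m cs) x (comp_list (concat (drop m cs)) bp)"
      "gromov bp x (comp_list (concat cs) bp) \<le> displacement bp (concat (take m cs)) + C"
      using first_block[of cs x] by auto
    have "h (gromov bp x (comp_list (concat cs) bp)) \<le> f m cs"
      using m by (simp add: f_def mono gromov_nonneg)
    also have "\<dots> \<le> (\<Sum>m\<le>Q. f m cs)"
      by (rule member_le_sum) (use m in auto)
    finally show "h (gromov bp x (comp_list (concat cs) bp)) \<le> (\<Sum>m\<le>Q. f m cs)" .
  qed
  also have "\<dots> = (\<Sum>m\<le>Q. \<integral>\<^sup>+cs. f m cs \<partial>replicate_pmf Q block_pmf)"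
    by (simp add: nn_integral_sum)
  also have "\<dots> \<le> (\<Sum>m\<le>Q. B m)"
  proof (rule sum_mono)
    fix m assume "m \<in> {..Q}"
    then show "(\<integral>\<^sup>+cs. f m cs \<partial>replicate_pmf Q block_pmf) \<le> B m"
      unfolding f_def
      by (intro nn_integral_unblocked_take_le[where f = "\<lambda>cs. h (displacement bp (concat cs) + C)"] B) simp
  qed
  finally show ?thesis .
qed

definition \<rho> :: real where "\<rho> = 1 - \<alpha> / 2"

lemma \<rho>: "1 / 2 \<le> \<rho>" "\<rho> < 1"
  using \<alpha>_pos \<alpha>_le_1 by (auto simp: \<rho>_def)

lemma nn_integral_gain_FE:
  assumes "P = F \<or> P = E"
  shows "(\<integral>\<^sup>+c. ennreal (gain P c x) \<partial>block_pmf) \<le> ennreal \<rho>"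
  unfolding \<rho>_def
proof (rule nn_integral_gain_le)
  show "v = w" if "v \<in> W" "w \<in> W" "\<not> P v x" "\<not> P w x" for v w
    using assms
  proof
    assume "P = F"
    with that show ?thesis by (metis F_unique)
  next
    assume "P = E"
    with that show ?thesis by (metis E_unique)
  qed
qed

lemma nn_integral_block_moment:
  assumes "p > 0" "A \<ge> 0" "(\<integral>\<^sup>+g. ennreal (dist bp (g bp) powr p) \<partial>\<mu>) = ennreal A"
  shows "(\<integral>\<^sup>+c. ennreal (displacement bp c powr p) \<partial>block_pmf) \<le> ennreal (real L powr p * (real L * A))"
proof -
  have "(\<integral>\<^sup>+c. ennreal (displacement bp c powr p) \<partial>block_pmf) \<le>
    (\<integral>\<^sup>+c. ennreal (real L powr p) * (\<Sum>g\<leftarrow>c. ennreal (dist bp (g bp) powr p)) \<partial>block_pmf)"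
    unfolding block_pmf_def
  proof (rule nn_integral_replicate_pmf_mono)
    fix c :: "('x \<Rightarrow> 'x) list" assume "length c = L"
    then have "displacement bp c powr p \<le> real L powr p * (\<Sum>g\<leftarrow>c. dist bp (g bp) powr p)"
      using sum_list_powr_le[of "map (\<lambda>g. dist bp (g bp)) c" p, OF _ assms(1)]
      by (fastforce simp: displacement_def o_def)
    moreover have "0 \<le> (\<Sum>g\<leftarrow>c. dist bp (g bp) powr p)" by (intro sum_list_nonneg) auto
    ultimately show "ennreal (displacement bp c powr p) \<le>
        ennreal (real L powr p) * (\<Sum>g\<leftarrow>c. ennreal (dist bp (g bp) powr p))"
      by (simp add: sum_list_ennreal ennreal_leI flip: ennreal_mult)
  qed
  also have "\<dots> = ennreal (real L powr p) * (of_nat L * ennreal A)"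
    unfolding block_pmf_def
    by (subst nn_integral_cmult, simp, subst nn_integral_replicate_pmf_sum_list, simp only: assms(3))
  also have "\<dots> = ennreal (real L powr p * (real L * A))"
    using assms(2) by (simp add: ennreal_mult ennreal_of_nat_eq_real_of_nat)
  finally show ?thesis .
qed

text \<open>The first bound decays through the event that nothing blocks. The second has no event
  and grows polynomially; it is needed for the pair of walks, where the event of only one walk is
  exploited at a time.\<close>

lemma moment_bounds:
  assumes p: "p > 0" and D: "D \<ge> 0"
    and fin: "(\<integral>\<^sup>+g. ennreal (dist bp (g bp) powr p) \<partial>\<mu>) < \<infinity>"
  shows "\<exists>K\<ge>0. (\<forall>m x z. (\<integral>\<^sup>+cs. ennreal ((displacement bp (concat cs) + D) powr p) * indicator {cs. unblocked cs x z} cs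
      \<partial>replicate_pmf m block_pmf) \<le> ennreal (K * real (m + 1) powr (p + 1) * \<rho> ^ m)) \<and>
    (\<forall>m. (\<integral>\<^sup>+cs. ennreal ((displacement bp (concat cs) + D) powr p) \<partial>replicate_pmf m block_pmf)
      \<le> ennreal (K * real (m + 1) powr (p + 1)))"
proof -
  obtain A0 where A0: "A0 \<ge> 0" "(\<integral>\<^sup>+g. ennreal (dist bp (g bp) powr p) \<partial>\<mu>) = ennreal A0"
    using fin by (cases "\<integral>\<^sup>+g. ennreal (dist bp (g bp) powr p) \<partial>\<mu>") auto
  define A where "A = real L powr p * (real L * A0)"
  have A: "A \<ge> 0" using A0 by (simp add: A_def)
  have block: "(\<integral>\<^sup>+c. ennreal (displacement bp c powr p) \<partial>block_pmf) \<le> ennreal A"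
    unfolding A_def by (rule nn_integral_block_moment[OF p A0])
  \<comment> \<open>\<open>weight (w j)\<close> is the \<open>p\<close>-th power of the displacement
    of block \<open>j\<close> alone, so the displacement of all blocks is handled one block at a
    time.\<close>
  define w where "w j k c = (if k = j then ennreal (displacement bp c powr p) else 1)" for j k :: nat and c
  have weight_w: "weight (w j) cs = ennreal (displacement bp (cs ! j) powr p)" if "j < length cs" for j cs
  proof -
    have "weight (w j) cs = w j j (cs ! j) * (\<Prod>k\<in>{..<length cs} - {j}. w j k (cs ! k))"
      unfolding weight_def using that by (intro prod.remove) auto
    also have "(\<Prod>k\<in>{..<length cs} - {j}. w j k (cs ! k)) = 1"
      by (intro prod.neutral) (auto simp: w_def)
    also have "w j j (cs ! j) = ennreal (displacement bp (cs ! j) powr p)" by (simp add: w_def)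
    finally show ?thesis by simp
  qed
  \<comment> \<open>\<open>2 * D powr p\<close> carries the factor 2 of the two directions. In
    \<open>8 * A\<close>, one factor 2 is that one, one bounds the gain of the weighted block, and
    one trades \<open>\<rho> ^ (m - 1)\<close> for \<open>\<rho> ^ m\<close>, since
    \<open>\<rho> \<ge> 1 / 2\<close>.\<close>
  define K where "K = 2 * D powr p + 8 * A"
  have K: "K \<ge> 0" using A by (simp add: K_def)
  have grow: "real (m + 1) powr p * (2 * D powr p + 8 * A * real m) \<le> K * real (m + 1) powr (p + 1)" for m
  proof -
    have "2 * D powr p + 8 * A * real m \<le> K * real (m + 1)"
      using A by (simp add: K_def algebra_simps)
    then have "real (m + 1) powr p * (2 * D powr p + 8 * A * real m) \<le> real (m + 1) powr p * (K * real (m + 1))"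
      by (intro mult_left_mono) auto
    then show ?thesis by (simp add: powr_add mult_ac)
  qed
  have pointwise: "ennreal ((displacement bp (concat cs) + D) powr p) \<le>
      ennreal (real (m + 1) powr p) * (ennreal (D powr p) + (\<Sum>j<m. weight (w j) cs))"
    if cs: "length cs = m" for m cs
  proof -
    have "(\<Sum>j<m. weight (w j) cs) = ennreal (\<Sum>j<m. displacement bp (cs ! j) powr p)"
      using cs by (simp add: weight_w flip: sum_ennreal)
    moreover have "(displacement bp (concat cs) + D) powr p \<le>
        real (m + 1) powr p * (D powr p + (\<Sum>k<m. displacement bp (cs ! k) powr p))"
      using displacement_concat_powr_le[OF p D, of bp cs] cs by simp
    ultimately show "ennreal ((displacement bp (concat cs) + D) powr p) \<le>
      ennreal (real (m + 1) powr p) * (ennreal (D powr p) + (\<Sum>j<m. weight (w j) cs))"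
      by (simp add: sum_nonneg ennreal_leI flip: ennreal_mult ennreal_plus)
  qed
  have main: "(\<integral>\<^sup>+cs. ennreal ((displacement bp (concat cs) + D) powr p) * indicator {cs. unblocked cs x z} cs
      \<partial>replicate_pmf m block_pmf) \<le> ennreal (K * real (m + 1) powr (p + 1) * \<rho> ^ m)" for m x z
  proof -
    let ?I = "indicator {cs. unblocked cs x z} :: _ \<Rightarrow> ennreal"
    have 0: "(\<integral>\<^sup>+cs. ?I cs \<partial>replicate_pmf m block_pmf) \<le> ennreal (2 * \<rho> ^ m)"
    proof -
      have "(\<integral>\<^sup>+cs. weight (\<lambda>_ _. 1) cs * ?I cs \<partial>replicate_pmf m block_pmf) \<le> 2 * (\<Prod>k<m. ennreal \<rho>)"
        by (rule nn_integral_unblocked_le) (simp add: nn_integral_gain_FE)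
      then show ?thesis using \<rho> by (simp add: weight_def ennreal_power ennreal_mult)
    qed
    have 1: "(\<integral>\<^sup>+cs. weight (w j) cs * ?I cs \<partial>replicate_pmf m block_pmf) \<le> ennreal (8 * A * \<rho> ^ m)"
      if "j < m" for j
    proof -
      define r where "r k = (if k = j then ennreal (2 * A) else ennreal \<rho>)" for k
      have "(\<integral>\<^sup>+cs. weight (w j) cs * ?I cs \<partial>replicate_pmf m block_pmf) \<le> 2 * (\<Prod>k<m. r k)"
      proof (rule nn_integral_unblocked_le)
        fix k P x assume P: "P = F \<or> P = E"
        show "(\<integral>\<^sup>+c. w j k c * ennreal (gain P c x) \<partial>block_pmf) \<le> r k"
        proof (cases "k = j")
          case True
          have "(\<integral>\<^sup>+c. w j k c * ennreal (gain P c x) \<partial>block_pmf) \<le>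
              (\<integral>\<^sup>+c. ennreal (displacement bp c powr p) * ennreal 2 \<partial>block_pmf)"
            using True by (intro nn_integral_mono mult_mono ennreal_leI gain_le_2) (auto simp: w_def)
          also have "\<dots> \<le> ennreal A * ennreal 2"
            by (subst nn_integral_multc) (auto intro!: mult_right_mono block)
          finally show ?thesis using True A by (simp add: r_def ennreal_mult mult.commute)
        qed (use nn_integral_gain_FE[OF P] in \<open>simp add: w_def r_def\<close>)
      qed
      also have "(\<Prod>k<m. r k) = r j * (\<Prod>k\<in>{..<m} - {j}. r k)"
        using that by (intro prod.remove) auto
      also have "(\<Prod>k\<in>{..<m} - {j}. r k) = (\<Prod>k\<in>{..<m} - {j}. ennreal \<rho>)"
        by (intro prod.cong) (auto simp: r_def)
      also have "(\<Prod>k\<in>{..<m} - {j}. ennreal \<rho>) = ennreal (\<rho> ^ (m - 1))"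
        using that \<rho> by (simp add: ennreal_power)
      also have "2 * (r j * ennreal (\<rho> ^ (m - 1))) = ennreal (2 * (2 * A * \<rho> ^ (m - 1)))"
        using A \<rho> by (simp add: r_def flip: ennreal_mult ennreal_numeral)
      also have "\<dots> \<le> ennreal (8 * A * \<rho> ^ m)"
      proof (rule ennreal_leI)
        have "\<rho> ^ m = \<rho> * \<rho> ^ (m - 1)" using that by (metis gr_implies_not0 power_eq_if)
        then have "\<rho> ^ (m - 1) \<le> 2 * \<rho> ^ m"
          using mult_right_mono[of "1 / 2" \<rho> "\<rho> ^ (m - 1)"] \<rho> by simp
        then show "2 * (2 * A * \<rho> ^ (m - 1)) \<le> 8 * A * \<rho> ^ m"
          using A mult_left_mono[of "\<rho> ^ (m - 1)" "2 * \<rho> ^ m" "4 * A"] by simp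
      qed
      finally show ?thesis .
    qed
    have "(\<integral>\<^sup>+cs. ennreal ((displacement bp (concat cs) + D) powr p) * ?I cs \<partial>replicate_pmf m block_pmf) \<le>
      (\<integral>\<^sup>+cs. ennreal (real (m + 1) powr p) * (ennreal (D powr p) * ?I cs + (\<Sum>j<m. weight (w j) cs * ?I cs))
        \<partial>replicate_pmf m block_pmf)"
    proof (rule nn_integral_replicate_pmf_mono)
      fix cs :: "('x \<Rightarrow> 'x) list list" assume "length cs = m"
      from pointwise[OF this] show "ennreal ((displacement bp (concat cs) + D) powr p) * ?I cs \<le>
        ennreal (real (m + 1) powr p) * (ennreal (D powr p) * ?I cs + (\<Sum>j<m. weight (w j) cs * ?I cs))"
        by (cases "unblocked cs x z") simp_all
    qed
    also have "\<dots> = ennreal (real (m + 1) powr p) * (ennreal (D powr p) * (\<integral>\<^sup>+cs. ?I cs \<partial>replicate_pmf m block_pmf)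
        + (\<Sum>j<m. \<integral>\<^sup>+cs. weight (w j) cs * ?I cs \<partial>replicate_pmf m block_pmf))"
      by (rule nn_integral_affine_sum)
    also have "\<dots> \<le> ennreal (real (m + 1) powr p) * (ennreal (D powr p) * ennreal (2 * \<rho> ^ m)
        + (\<Sum>j<m. ennreal (8 * A * \<rho> ^ m)))"
      by (intro mult_left_mono add_mono sum_mono 0 1) auto
    also have "\<dots> = ennreal (real (m + 1) powr p * (D powr p * (2 * \<rho> ^ m) + real m * (8 * A * \<rho> ^ m)))"
      using A \<rho> by (simp add: ennreal_mult ennreal_plus ennreal_of_nat_eq_real_of_nat)
    also have "\<dots> = ennreal (real (m + 1) powr p * (2 * D powr p + 8 * A * real m) * \<rho> ^ m)"
      by (simp add: algebra_simps)
    also have "\<dots> \<le> ennreal (K * real (m + 1) powr (p + 1) * \<rho> ^ m)"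
      using grow[of m] \<rho> by (intro ennreal_leI mult_right_mono) auto
    finally show ?thesis .
  qed
  have "(\<integral>\<^sup>+cs. ennreal ((displacement bp (concat cs) + D) powr p) \<partial>replicate_pmf m block_pmf)
      \<le> ennreal (K * real (m + 1) powr (p + 1))" for m
  proof -
    have 1: "(\<integral>\<^sup>+cs. weight (w j) cs \<partial>replicate_pmf m block_pmf) \<le> ennreal A" if "j < m" for j
    proof -
      \<comment> \<open>With constant gain 1 the bound for forward products reduces to independence
        of the blocks.\<close>
      have one: "forward_prod (\<lambda>_ _. 1) cs bp = 1" for cs
      proof -
        have "forward_prod (\<lambda>_ _. 1) cs x = 1" for x :: 'x
          by (induction cs arbitrary: x) auto
        then show ?thesis .
      qed
      define r where "r k = (if k = j then ennreal A else 1)" for k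
      have "(\<integral>\<^sup>+cs. weight (w j) cs * forward_prod (\<lambda>_ _. 1) cs bp \<partial>replicate_pmf m block_pmf) \<le> (\<Prod>k<m. r k)"
        by (rule nn_integral_forward_prod_le)
          (use block in \<open>auto simp: w_def r_def measure_pmf.emeasure_space_1\<close>)
      also have "(\<Prod>k<m. r k) = ennreal A"
        using that by (simp add: r_def)
      finally show ?thesis by (simp add: one)
    qed
    have "(\<integral>\<^sup>+cs. ennreal ((displacement bp (concat cs) + D) powr p) \<partial>replicate_pmf m block_pmf) \<le>
      (\<integral>\<^sup>+cs. ennreal (real (m + 1) powr p) * (ennreal (D powr p) + (\<Sum>j<m. weight (w j) cs))
        \<partial>replicate_pmf m block_pmf)"
      by (rule nn_integral_replicate_pmf_mono) (rule pointwise)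
    also have "\<dots> = ennreal (real (m + 1) powr p) * (ennreal (D powr p)
        + (\<Sum>j<m. \<integral>\<^sup>+cs. weight (w j) cs \<partial>replicate_pmf m block_pmf))"
      by (simp add: nn_integral_cmult nn_integral_add nn_integral_sum measure_pmf.emeasure_space_1)
    also have "\<dots> \<le> ennreal (real (m + 1) powr p) * (ennreal (D powr p) + (\<Sum>j<m. ennreal A))"
      by (intro mult_left_mono add_mono sum_mono 1) auto
    also have "\<dots> = ennreal (real (m + 1) powr p * (D powr p + real m * A))"
      using A by (simp add: ennreal_mult ennreal_plus ennreal_of_nat_eq_real_of_nat)
    also have "\<dots> \<le> ennreal (real (m + 1) powr p * (2 * D powr p + 8 * A * real m))"
      using A by (intro ennreal_leI mult_left_mono add_mono) (auto simp: mult.commute intro!: mult_right_mono)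
    also have "\<dots> \<le> ennreal (K * real (m + 1) powr (p + 1))"
      by (rule ennreal_leI[OF grow])
    finally show ?thesis .
  qed
  with K main show ?thesis by blast
qed

text \<open>For small \<open>\<kappa>\<close> the exponential weight of a block is so close to 1 in
  mean that it uses up only half of the decay \<open>\<alpha> / 2\<close> of the gain. Neither
  \<open>\<kappa>\<close> nor \<open>r\<close> depends on \<open>D\<close>, which later takes
  several values.\<close>

lemma exponential_bound:
  assumes c: "c > 0" and fin: "(\<integral>\<^sup>+g. ennreal (exp (c * dist bp (g bp))) \<partial>\<mu>) < \<infinity>"
  shows "\<exists>\<kappa>>0. \<exists>r\<ge>0. r < 1 \<and> (\<forall>m D x z. (\<integral>\<^sup>+cs. ennreal (exp (\<kappa> * (displacement bp (concat cs) + D))) * indicator {cs. unblocked cs x z} cs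
      \<partial>replicate_pmf m block_pmf) \<le> ennreal (exp (\<kappa> * D) * 2 * r ^ m))"
proof -
  obtain M where M: "M \<ge> 0" "(\<integral>\<^sup>+g. ennreal (exp (c * dist bp (g bp))) \<partial>\<mu>) = ennreal M"
    using fin by (cases "\<integral>\<^sup>+g. ennreal (exp (c * dist bp (g bp))) \<partial>\<mu>") auto
  \<comment> \<open>\<open>1 + k / c * M\<close> will bound the exponential moment of one step with
    exponent \<open>k\<close>; its \<open>L\<close>-th power tends to 1.\<close>
  have "((\<lambda>k. (1 + k / c * M) ^ L) \<longlongrightarrow> (1 + 0 / c * M) ^ L) (at_right 0)"
    by (intro tendsto_intros) (use c in auto)
  then have "eventually (\<lambda>k. (1 + k / c * M) ^ L < 1 + \<alpha> / 8) (at_right 0)"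
    by (rule order_tendstoD) (use \<alpha>_pos in auto)
  moreover have "eventually (\<lambda>k. 0 < k \<and> k < c) (at_right 0)"
    using c by (simp add: eventually_at_right_less eventually_conj_iff eventually_at_right_field)
      (auto intro!: exI[of _ c])
  ultimately have "eventually (\<lambda>k. (1 + k / c * M) ^ L < 1 + \<alpha> / 8 \<and> 0 < k \<and> k < c) (at_right 0)"
    by (rule eventually_conj)
  then obtain \<kappa> where \<kappa>: "(1 + \<kappa> / c * M) ^ L < 1 + \<alpha> / 8" "0 < \<kappa>" "\<kappa> < c"
    using eventually_happens[of _ "at_right (0::real)"] by auto
  have step: "(\<integral>\<^sup>+g. ennreal (exp (\<kappa> * dist bp (g bp))) \<partial>\<mu>) \<le> ennreal (1 + \<kappa> / c * M)"
  proof -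
    have "exp (\<kappa> * t) \<le> 1 + \<kappa> / c * exp (c * t)" for t
    proof -
      \<comment> \<open>\<open>\<kappa> * t\<close> is the convex combination of 0 and
        \<open>c * t\<close> with weight \<open>\<kappa> / c\<close>.\<close>
      have "convex_on UNIV exp" by (rule exp_convex)
      then have "exp ((1 - \<kappa> / c) *\<^sub>R 0 + (\<kappa> / c) *\<^sub>R (c * t)) \<le> (1 - \<kappa> / c) * exp 0 + \<kappa> / c * exp (c * t)"
        by (rule convex_onD) (use \<kappa> c in auto)
      then show ?thesis using \<kappa> c by (simp add: divide_simps)
    qed
    then have "(\<integral>\<^sup>+g. ennreal (exp (\<kappa> * dist bp (g bp))) \<partial>\<mu>) \<le>
      (\<integral>\<^sup>+g. 1 + ennreal (\<kappa> / c) * ennreal (exp (c * dist bp (g bp))) \<partial>\<mu>)"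
      using \<kappa> c by (intro nn_integral_mono) (auto simp: ennreal_leI simp flip: ennreal_mult ennreal_plus ennreal_1)
    also have "\<dots> = 1 + ennreal (\<kappa> / c) * ennreal M"
      by (simp add: nn_integral_add nn_integral_cmult measure_pmf.emeasure_space_1 M)
    also have "\<dots> = ennreal (1 + \<kappa> / c * M)"
      using M \<kappa> c by (simp flip: ennreal_mult ennreal_plus ennreal_1)
    finally show ?thesis .
  qed
  have prod: "ennreal (exp (\<kappa> * displacement bp l)) = prod_list (map (\<lambda>g. ennreal (exp (\<kappa> * dist bp (g bp)))) l)" for l
    by (induction l) (simp_all add: displacement_def distrib_left exp_add ennreal_mult)
  have blk: "(\<integral>\<^sup>+c. ennreal (exp (\<kappa> * displacement bp c)) \<partial>block_pmf) \<le> ennreal (1 + \<alpha> / 8)"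
  proof -
    have "(\<integral>\<^sup>+c. ennreal (exp (\<kappa> * displacement bp c)) \<partial>block_pmf) = (\<integral>\<^sup>+g. ennreal (exp (\<kappa> * dist bp (g bp))) \<partial>\<mu>) ^ L"
      unfolding block_pmf_def prod by (rule nn_integral_replicate_pmf_prod_list)
    also have "\<dots> \<le> ennreal (1 + \<kappa> / c * M) ^ L" by (intro power_mono step) auto
    also have "\<dots> = ennreal ((1 + \<kappa> / c * M) ^ L)"
      using \<kappa> M c by (intro ennreal_power) simp
    also have "\<dots> \<le> ennreal (1 + \<alpha> / 8)"
      using \<kappa>(1) by (intro ennreal_leI) simp
    finally show ?thesis .
  qed
  define r where "r = 1 - \<alpha> / 4"
  have r: "0 \<le> r" "r < 1" using \<alpha>_pos \<alpha>_le_1 by (auto simp: r_def)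
  have gain: "(\<integral>\<^sup>+c. ennreal (exp (\<kappa> * displacement bp c)) * ennreal (gain P c x) \<partial>block_pmf) \<le> ennreal r"
    if P: "P = F \<or> P = E" for P x
  proof -
    \<comment> \<open>As the gain is at most 2, the weight \<open>e \<ge> 1\<close> satisfies
      \<open>e * gain \<le> gain + 2 * (e - 1)\<close>. The 2 stands on the left to avoid
      subtraction in \<open>ennreal\<close>, and
      \<open>\<rho> + 2 * (\<alpha> / 8) = r\<close>.\<close>
    have "(\<integral>\<^sup>+c. ennreal (exp (\<kappa> * displacement bp c)) * ennreal (gain P c x) \<partial>block_pmf) + 2 \<le>
      (\<integral>\<^sup>+c. ennreal (gain P c x) + 2 * ennreal (exp (\<kappa> * displacement bp c)) \<partial>block_pmf)"
    proof -
      have "exp (\<kappa> * displacement bp c) * gain P c x + 2 \<le> gain P c x + 2 * exp (\<kappa> * displacement bp c)" for c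
      proof -
        have "1 \<le> exp (\<kappa> * displacement bp c)" using \<kappa> by (simp add: displacement_nonneg)
        then have "(exp (\<kappa> * displacement bp c) - 1) * gain P c x \<le> (exp (\<kappa> * displacement bp c) - 1) * 2"
          by (intro mult_left_mono gain_le_2) auto
        then show ?thesis by (simp add: algebra_simps)
      qed
      then have "ennreal (exp (\<kappa> * displacement bp c)) * ennreal (gain P c x) + 2 \<le>
          ennreal (gain P c x) + 2 * ennreal (exp (\<kappa> * displacement bp c))" for c
        by (simp add: gain_nonneg ennreal_leI flip: ennreal_mult ennreal_plus ennreal_numeral)
      then have "(\<integral>\<^sup>+c. ennreal (exp (\<kappa> * displacement bp c)) * ennreal (gain P c x) + 2 \<partial>block_pmf) \<le>
          (\<integral>\<^sup>+c. ennreal (gain P c x) + 2 * ennreal (exp (\<kappa> * displacement bp c)) \<partial>block_pmf)"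
        by (rule nn_integral_mono)
      then show ?thesis by (simp add: nn_integral_add measure_pmf.emeasure_space_1)
    qed
    also have "\<dots> = (\<integral>\<^sup>+c. ennreal (gain P c x) \<partial>block_pmf) + 2 * (\<integral>\<^sup>+c. ennreal (exp (\<kappa> * displacement bp c)) \<partial>block_pmf)"
      by (simp add: nn_integral_add nn_integral_cmult)
    also have "\<dots> \<le> ennreal \<rho> + 2 * ennreal (1 + \<alpha> / 8)"
      by (intro add_mono mult_left_mono blk nn_integral_gain_FE P) auto
    also have "\<dots> = ennreal r + 2"
    proof -
      have "ennreal \<rho> + 2 * ennreal (1 + \<alpha> / 8) = ennreal (\<rho> + 2 * (1 + \<alpha> / 8))"
        using \<rho> \<alpha>_pos by (simp del: ennreal_plus flip: ennreal_mult ennreal_numeral ennreal_plus)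
      also have "\<rho> + 2 * (1 + \<alpha> / 8) = r + 2" by (simp add: \<rho>_def r_def)
      finally show ?thesis using r by (simp add: ennreal_plus)
    qed
    finally show ?thesis by (simp add: add.commute[of _ 2] ennreal_add_left_cancel_le)
  qed
  have "(\<integral>\<^sup>+cs. ennreal (exp (\<kappa> * (displacement bp (concat cs) + D))) * indicator {cs. unblocked cs x z} cs
      \<partial>replicate_pmf m block_pmf) \<le> ennreal (exp (\<kappa> * D) * 2 * r ^ m)" for m D x z
  proof -
    have w: "ennreal (exp (\<kappa> * (displacement bp (concat cs) + D))) =
        ennreal (exp (\<kappa> * D)) * weight (\<lambda>_ c. ennreal (exp (\<kappa> * displacement bp c))) cs" for cs
    proof -
      have "ennreal (exp (\<kappa> * displacement bp (concat cs))) = weight (\<lambda>_ c. ennreal (exp (\<kappa> * displacement bp c))) cs"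
        by (induction cs) (simp_all add: distrib_left exp_add ennreal_mult)
      then show ?thesis by (simp add: distrib_left exp_add ennreal_mult mult.commute)
    qed
    have "(\<integral>\<^sup>+cs. weight (\<lambda>_ c. ennreal (exp (\<kappa> * displacement bp c))) cs * indicator {cs. unblocked cs x z} cs
      \<partial>replicate_pmf m block_pmf) \<le> 2 * (\<Prod>k<m. ennreal r)"
      by (rule nn_integral_unblocked_le) (rule gain)
    then have "ennreal (exp (\<kappa> * D)) * (\<integral>\<^sup>+cs. weight (\<lambda>_ c. ennreal (exp (\<kappa> * displacement bp c))) cs *
        indicator {cs. unblocked cs x z} cs \<partial>replicate_pmf m block_pmf) \<le> ennreal (exp (\<kappa> * D)) * (2 * (\<Prod>k<m. ennreal r))"
      by (rule mult_left_mono) simp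
    then show ?thesis
      using r by (simp add: w mult.assoc nn_integral_cmult ennreal_mult ennreal_power)
  qed
  with \<kappa>(2) r show ?thesis by blast
qed

end

section \<open>The maximal inequality\<close>

text \<open>Finiteness of \<open>b\<close> excludes \<open>\<top> - \<top>\<close>, which is
  \<open>\<top>\<close> in \<open>ennreal\<close>.\<close>

lemma ennreal_max_diff_le1:
  fixes a b s :: ennreal
  assumes "b \<le> a" "b < \<top>"
  shows "max b s - a \<le> s - a"
proof -
  have "b - a = 0" using assms by (simp add: diff_eq_0_iff_ennreal)
  then show ?thesis by (cases "b \<le> s") (simp_all add: max_def)
qed

lemma ennreal_max_diff_le2:
  fixes a b s :: ennreal
  assumes "a \<le> b" "b < \<top>"
  shows "max b s - a \<le> (b - a) + (s - b)"
proof (cases "s \<le> b")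
  case False
  then show ?thesis
    using assms by (cases a; cases b; cases s) (auto simp: max_def ennreal_minus simp flip: ennreal_plus)
qed (simp add: max_def)

text \<open>The excess of \<open>z\<close> over \<open>a\<close> is cut at the level
  \<open>b\<close>; the lower piece is full as soon as \<open>z\<close> reaches
  \<open>b\<close>.\<close>

lemma ennreal_diff_split_le:
  fixes a b z :: ennreal
  assumes "a \<le> b" "b < \<top>"
  shows "(z - b) + (b - a) * indicator {t. b \<le> t} z \<le> z - a"
proof (cases "b \<le> z")
  case True
  then show ?thesis
    using assms by (cases a; cases b; cases z)
      (auto simp: ennreal_minus top_unique simp flip: ennreal_plus)
next
  case False
  then have "z < \<top>" using assms(2) by simp
  then have "z - b = 0" using False by (simp add: diff_eq_0_iff_ennreal)
  then show ?thesis using False by simp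
qed

lemma SUP_atMost_take_Cons:
  fixes Z :: "('x \<Rightarrow> 'x) \<Rightarrow> ennreal"
  shows "(SUP n\<in>{..Suc T}. Z (v \<circ> comp_list (take n (g # l)))) =
    max (Z v) (SUP n\<in>{..T}. Z ((v \<circ> g) \<circ> comp_list (take n l)))"
proof -
  have "{..Suc T} = insert 0 (Suc ` {..T})"
    by (auto simp: image_iff) (metis Suc_le_mono atMost_iff not0_implies_Suc)
  then show ?thesis
    by (simp add: image_comp sup_max o_def)
qed

context schottky_walk
begin

text \<open>At most one word is bad for the past and at most one for the future, so a good one
  remains among four. It makes the path from \<open>bp\<close> to the final point pass near
  \<open>v bp\<close>, and the choice of \<open>w\<close> does not depend on \<open>y\<close>, which
  permits a supremum over \<open>y\<close> later.\<close>

lemma exists_word: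
  assumes "isometry v" "isometry u"
  obtains w where "w \<in> W"
    "\<And>y. gromov bp y (v bp) \<le> gromov bp y (v (comp_list w (u bp))) + C"
proof -
  define B1 where "B1 = {w \<in> W. \<not> F w (inv v bp)}"
  define B2 where "B2 = {w \<in> W. \<not> E w (u bp)}"
  have fin: "finite B1" "finite B2" using finite_W by (auto simp: B1_def B2_def)
  have "card B1 \<le> Suc 0"
    using fin F_unique by (subst card_le_Suc0_iff_eq) (auto simp: B1_def)
  moreover have "card B2 \<le> Suc 0"
    using fin E_unique by (subst card_le_Suc0_iff_eq) (auto simp: B2_def)
  ultimately have "card (B1 \<union> B2) < card W"
    using card_Un_le[of B1 B2] card_W by simp
  then have "\<not> W \<subseteq> B1 \<union> B2"
    using card_mono[of "B1 \<union> B2" W] fin by auto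
  then obtain w where w: "w \<in> W" "F w (inv v bp)" "E w (u bp)" by (auto simp: B1_def B2_def)
  define z where "z = comp_list w (u bp)"
  have "gromov bp (inv v bp) z \<le> C"
    unfolding z_def by (rule W_block[OF w])
  moreover have "dist bp (inv v bp) = dist bp (v bp)" "dist (inv v bp) z = dist bp (v z)"
    "dist (v bp) (v z) = dist bp z"
    using assms(1) by (metis dist_commute dist_inv_left, metis dist_inv_left, simp)
  ultimately have 1: "dist bp (v bp) + dist (v bp) (v z) - dist bp (v z) \<le> 2 * C"
    by (simp add: gromov_def)
  have "gromov bp y (v bp) \<le> gromov bp y (v z) + C" for y
    using 1 dist_triangle[of y "v z" "v bp"] by (simp add: gromov_def field_simps)
  with w(1) show ?thesis unfolding z_def by (rule that)
qed

text \<open>Ottaviani's inequality: whatever happens after time \<open>n\<close>, some Schottky word inserted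
  there keeps the value reached at time \<open>n\<close>.  The subtraction of \<open>a\<close>
  makes the induction on the first step go through.\<close>

lemma maximal_inequality:
  fixes Z Z' :: "('x \<Rightarrow> 'x) \<Rightarrow> ennreal"
  assumes fin: "\<And>v. isometry v \<Longrightarrow> Z v < \<top>"
    and insert: "\<And>v l. isometry v \<Longrightarrow> set l \<subseteq> set_pmf \<mu> \<Longrightarrow> \<exists>w\<in>W. Z v \<le> Z' (v \<circ> comp_list (w @ l))"
    and "isometry v"
  shows "ennreal \<alpha> * (\<integral>\<^sup>+l. (SUP n\<in>{..T}. Z (v \<circ> comp_list (take n l))) - a \<partial>replicate_pmf T \<mu>)
    \<le> (\<integral>\<^sup>+l. Z' (v \<circ> comp_list l) - a \<partial>replicate_pmf (L + T) \<mu>)"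
  using \<open>isometry v\<close>
proof (induction T arbitrary: v a)
  \<comment> \<open>The present excess \<open>Z v - a\<close> is paid for by the event that the
    final value reaches \<open>Z v\<close>, of probability at least \<open>\<alpha>\<close>; the
    final excess above \<open>Z v\<close> remains available for later times.\<close>
  have key: "ennreal \<alpha> * (Z v - a) + (\<integral>\<^sup>+l. Z' (v \<circ> comp_list l) - Z v \<partial>replicate_pmf (L + T) \<mu>)
    \<le> (\<integral>\<^sup>+l. Z' (v \<circ> comp_list l) - a \<partial>replicate_pmf (L + T) \<mu>)"
    if v: "isometry v" and a: "a \<le> Z v" for v a T
  proof -
    let ?I = "\<lambda>l. indicator {t. Z v \<le> t} (Z' (v \<circ> comp_list l)) :: ennreal"
    have "ennreal \<alpha> = (\<integral>\<^sup>+l. ennreal \<alpha> \<partial>replicate_pmf T \<mu>)"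
      by (simp add: measure_pmf.emeasure_space_1)
    also have "\<dots> \<le> (\<integral>\<^sup>+l. \<integral>\<^sup>+w. ?I (w @ l) \<partial>block_pmf \<partial>replicate_pmf T \<mu>)"
    proof (rule nn_integral_replicate_pmf_mono)
      fix l assume "set l \<subseteq> set_pmf \<mu>"
      \<comment> \<open>The future \<open>l\<close> is fixed first, so \<open>w0\<close> may depend
        on it; the block before it is independent of \<open>l\<close> and equals \<open>w0\<close>
        with probability \<open>\<alpha>\<close>.\<close>
      from insert[OF v this] obtain w0 where w0: "w0 \<in> W" "Z v \<le> Z' (v \<circ> comp_list (w0 @ l))" by blast
      have "ennreal \<alpha> = (\<integral>\<^sup>+w. indicator {w0} w \<partial>block_pmf)"
        using w0(1) by (simp add: emeasure_pmf_single pmf_W)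
      also have "\<dots> \<le> (\<integral>\<^sup>+w. ?I (w @ l) \<partial>block_pmf)"
        using w0(2) by (intro nn_integral_mono) (auto simp: indicator_def)
      finally show "ennreal \<alpha> \<le> (\<integral>\<^sup>+w. ?I (w @ l) \<partial>block_pmf)" .
    qed
    also have "\<dots> = (\<integral>\<^sup>+l. ?I l \<partial>replicate_pmf (L + T) \<mu>)"
      unfolding block_pmf_def nn_integral_replicate_pmf_add by (rule nn_integral_pmf_swap)
    finally have "ennreal \<alpha> * (Z v - a) + (\<integral>\<^sup>+l. Z' (v \<circ> comp_list l) - Z v \<partial>replicate_pmf (L + T) \<mu>) \<le>
      (\<integral>\<^sup>+l. ?I l \<partial>replicate_pmf (L + T) \<mu>) * (Z v - a) +
      (\<integral>\<^sup>+l. Z' (v \<circ> comp_list l) - Z v \<partial>replicate_pmf (L + T) \<mu>)"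
      by (intro add_right_mono mult_right_mono) auto
    also have "\<dots> = (\<integral>\<^sup>+l. (Z' (v \<circ> comp_list l) - Z v) + (Z v - a) * ?I l \<partial>replicate_pmf (L + T) \<mu>)"
      by (subst nn_integral_add) (simp_all add: nn_integral_cmult mult.commute add.commute)
    also have "\<dots> \<le> (\<integral>\<^sup>+l. Z' (v \<circ> comp_list l) - a \<partial>replicate_pmf (L + T) \<mu>)"
      by (intro nn_integral_mono ennreal_diff_split_le a fin v)
    finally show ?thesis .
  qed
  {
    case 0
    show ?case
    proof (cases "a \<le> Z v")
      case True
      have "ennreal \<alpha> * (Z v - a) \<le> (\<integral>\<^sup>+l. Z' (v \<circ> comp_list l) - a \<partial>replicate_pmf (L + 0) \<mu>)"
        by (rule order_trans[OF _ key[OF 0 True]]) simp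
      then show ?thesis by (simp add: o_def)
    next
      case False
      then have "Z v - a = 0" using fin[OF 0] by (simp add: diff_eq_0_iff_ennreal)
      then show ?thesis by (simp add: o_def)
    qed
  next
    case (Suc T)
    let ?M = "\<lambda>g l. SUP n\<in>{..T}. Z ((v \<circ> g) \<circ> comp_list (take n l))"
    have step: "(\<integral>\<^sup>+l. f l \<partial>replicate_pmf (Suc n) \<mu>) = (\<integral>\<^sup>+g. \<integral>\<^sup>+l. f (g # l) \<partial>replicate_pmf n \<mu> \<partial>\<mu>)" for f n
      by simp
    have IH: "(\<integral>\<^sup>+g. ennreal \<alpha> * (\<integral>\<^sup>+l. ?M g l - b \<partial>replicate_pmf T \<mu>) \<partial>\<mu>) \<le>
      (\<integral>\<^sup>+l. Z' (v \<circ> comp_list l) - b \<partial>replicate_pmf (L + Suc T) \<mu>)" for b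
    proof -
      have "(\<integral>\<^sup>+g. ennreal \<alpha> * (\<integral>\<^sup>+l. ?M g l - b \<partial>replicate_pmf T \<mu>) \<partial>\<mu>) \<le>
        (\<integral>\<^sup>+g. \<integral>\<^sup>+l. Z' ((v \<circ> g) \<circ> comp_list l) - b \<partial>replicate_pmf (L + T) \<mu> \<partial>\<mu>)"
      proof (rule nn_integral_mono_AE, rule AE_pmfI)
        fix g assume "g \<in> set_pmf \<mu>"
        then have "isometry (v \<circ> g)" using Suc.prems isometry_step isometry_comp by blast
        then show "ennreal \<alpha> * (\<integral>\<^sup>+l. ?M g l - b \<partial>replicate_pmf T \<mu>) \<le>
            (\<integral>\<^sup>+l. Z' ((v \<circ> g) \<circ> comp_list l) - b \<partial>replicate_pmf (L + T) \<mu>)"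
          by (rule Suc.IH)
      qed
      \<comment> \<open>All steps are i.i.d., so the step \<open>g\<close> followed by
        \<open>L + T\<close> steps has the law of \<open>L + Suc T\<close> steps, wherever the extra
        block was inserted.\<close>
      also have "\<dots> = (\<integral>\<^sup>+l. Z' (v \<circ> comp_list l) - b \<partial>replicate_pmf (L + Suc T) \<mu>)"
        by (simp only: add_Suc_right step comp_list_Cons o_assoc)
      finally show ?thesis .
    qed
    have eq: "(\<integral>\<^sup>+l. (SUP n\<in>{..Suc T}. Z (v \<circ> comp_list (take n l))) - a \<partial>replicate_pmf (Suc T) \<mu>) =
      (\<integral>\<^sup>+g. \<integral>\<^sup>+l. max (Z v) (?M g l) - a \<partial>replicate_pmf T \<mu> \<partial>\<mu>)"
      unfolding step SUP_atMost_take_Cons ..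
    show ?case
    proof (cases "a \<le> Z v")
      \<comment> \<open>A present value below the level \<open>a\<close> contributes nothing to the
        excess.\<close>
      case False
      have "ennreal \<alpha> * (\<integral>\<^sup>+g. \<integral>\<^sup>+l. max (Z v) (?M g l) - a \<partial>replicate_pmf T \<mu> \<partial>\<mu>) \<le>
        ennreal \<alpha> * (\<integral>\<^sup>+g. \<integral>\<^sup>+l. ?M g l - a \<partial>replicate_pmf T \<mu> \<partial>\<mu>)"
        by (intro mult_left_mono nn_integral_mono ennreal_max_diff_le1) (use False fin Suc.prems in auto)
      also have "\<dots> = (\<integral>\<^sup>+g. ennreal \<alpha> * (\<integral>\<^sup>+l. ?M g l - a \<partial>replicate_pmf T \<mu>) \<partial>\<mu>)"
        by (rule nn_integral_cmult[symmetric]) simp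
      also note IH[of a]
      finally show ?thesis unfolding eq .
    next
      \<comment> \<open>For the remaining steps the level is raised from \<open>a\<close> to
        \<open>Z v\<close>, and \<open>key\<close> pays for the difference.\<close>
      case True
      have "ennreal \<alpha> * (\<integral>\<^sup>+g. \<integral>\<^sup>+l. max (Z v) (?M g l) - a \<partial>replicate_pmf T \<mu> \<partial>\<mu>) \<le>
        ennreal \<alpha> * (\<integral>\<^sup>+g. \<integral>\<^sup>+l. (Z v - a) + (?M g l - Z v) \<partial>replicate_pmf T \<mu> \<partial>\<mu>)"
        by (intro mult_left_mono nn_integral_mono ennreal_max_diff_le2 True fin Suc.prems) auto
      also have "\<dots> = ennreal \<alpha> * (Z v - a) + ennreal \<alpha> * (\<integral>\<^sup>+g. \<integral>\<^sup>+l. ?M g l - Z v \<partial>replicate_pmf T \<mu> \<partial>\<mu>)"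
        by (subst nn_integral_add, simp, simp, subst nn_integral_add)
          (simp_all add: measure_pmf.emeasure_space_1 distrib_left)
      also have "ennreal \<alpha> * (\<integral>\<^sup>+g. \<integral>\<^sup>+l. ?M g l - Z v \<partial>replicate_pmf T \<mu> \<partial>\<mu>) =
        (\<integral>\<^sup>+g. ennreal \<alpha> * (\<integral>\<^sup>+l. ?M g l - Z v \<partial>replicate_pmf T \<mu>) \<partial>\<mu>)"
        by (rule nn_integral_cmult[symmetric]) simp
      also have "ennreal \<alpha> * (Z v - a) + \<dots> \<le> ennreal \<alpha> * (Z v - a) +
          (\<integral>\<^sup>+l. Z' (v \<circ> comp_list l) - Z v \<partial>replicate_pmf (L + Suc T) \<mu>)"
        by (intro add_left_mono IH)
      also have "\<dots> \<le> (\<integral>\<^sup>+l. Z' (v \<circ> comp_list l) - a \<partial>replicate_pmf (L + Suc T) \<mu>)"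
        by (rule key[OF Suc.prems True])
      finally show ?thesis unfolding eq .
    qed
  }
qed

text \<open>Finiteness of \<open>Y\<close> keeps the supremum below \<open>\<top>\<close>. The set
  will be a single point, or the points visited by the other walk up to a fixed time.\<close>

lemma maximal_gromov:
  fixes h :: "real \<Rightarrow> ennreal"
  assumes mono: "\<And>s t. 0 \<le> s \<Longrightarrow> s \<le> t \<Longrightarrow> h s \<le> h t" and fin: "\<And>t. h t < \<top>" and Y: "finite Y"
  shows "ennreal \<alpha> * (\<integral>\<^sup>+l. (SUP n\<in>{..T}. SUP y\<in>Y. h (gromov bp y (comp_list (take n l) bp))) \<partial>replicate_pmf T \<mu>)
    \<le> (\<integral>\<^sup>+l. (SUP y\<in>Y. h (gromov bp y (comp_list l bp) + C)) \<partial>replicate_pmf (L + T) \<mu>)"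
proof -
  define Z where "Z v = (SUP y\<in>Y. h (gromov bp y (v bp)))" for v
  define Z' where "Z' v = (SUP y\<in>Y. h (gromov bp y (v bp) + C))" for v
  have "ennreal \<alpha> * (\<integral>\<^sup>+l. (SUP n\<in>{..T}. Z (id \<circ> comp_list (take n l))) - 0 \<partial>replicate_pmf T \<mu>)
    \<le> (\<integral>\<^sup>+l. Z' (id \<circ> comp_list l) - 0 \<partial>replicate_pmf (L + T) \<mu>)"
  proof (rule maximal_inequality)
    show "Z v < \<top>" for v
    proof (cases "Y = {}")
      case False
      then show ?thesis
        using Y fin by (simp add: Z_def finite_Sup_less_iff)
    qed (simp add: Z_def bot_ennreal)
    show "isometry (id :: 'x \<Rightarrow> 'x)" by (rule isometry_id)
    fix v :: "'x \<Rightarrow> 'x" and l assume v: "isometry v" and l: "set l \<subseteq> set_pmf \<mu>"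
    have "isometry (comp_list l)" by (rule isometry_comp_list) (use l isometry_step in blast)
    from exists_word[OF v this] obtain w where w: "w \<in> W"
      "\<And>y. gromov bp y (v bp) \<le> gromov bp y (v (comp_list w (comp_list l bp))) + C" by metis
    have "Z v \<le> Z' (v \<circ> comp_list (w @ l))"
      unfolding Z_def Z'_def using w(2) by (intro SUP_mono) (auto intro!: mono gromov_nonneg)
    with w(1) show "\<exists>w\<in>W. Z v \<le> Z' (v \<circ> comp_list (w @ l))" by blast
  qed
  then show ?thesis by (simp add: Z_def Z'_def)
qed

end

section \<open>Infinite trajectories\<close>

text \<open>The function space need not be countable, so \<open>stake n\<close> is not measurable into lists of
  functions.  It becomes so after retracting the steps onto the countable support.\<close>

definition support_retract :: "'a pmf \<Rightarrow> 'a \<Rightarrow> 'a" where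
  "support_retract p x = from_nat_into (set_pmf p) (to_nat_on (set_pmf p) x)"

lemma support_retract [simp]: "x \<in> set_pmf p \<Longrightarrow> support_retract p x = x"
  by (simp add: support_retract_def)

abbreviation iid_stream :: "'a pmf \<Rightarrow> 'a stream measure" where
  "iid_stream p \<equiv> stream_space (measure_pmf p)"

lemma measurable_stake_to_nat:
  "(\<lambda>s. stake n (smap (to_nat_on (set_pmf p)) s)) \<in> measurable (iid_stream p) (count_space UNIV)"
proof -
  have "to_nat_on (set_pmf p) \<in> measurable (measure_pmf p) (count_space UNIV)" by simp
  then show ?thesis
    by (intro measurable_compose[OF measurable_smap measurable_stake])
qed

lemma stake_smap_retract:
  "stake n (smap (support_retract p) s) =
    map (from_nat_into (set_pmf p)) (stake n (smap (to_nat_on (set_pmf p)) s))"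
  by (simp add: support_retract_def o_def)

lemma borel_measurable_stake:
  "(\<lambda>s. f (stake n (smap (support_retract p) s))) \<in> borel_measurable (iid_stream p)"
  unfolding stake_smap_retract
  by (rule measurable_compose[OF measurable_stake_to_nat]) simp

text \<open>Both coordinates factor through lists of naturals, and on countable types the product of
  the discrete sigma-algebras is discrete.\<close>

lemma borel_measurable_stake_pair:
  "(\<lambda>st. f (stake n (smap (support_retract p) (fst st))) (stake m (smap (support_retract q) (snd st))))
    \<in> borel_measurable (iid_stream p \<Otimes>\<^sub>M iid_stream q)"
proof -
  have "(\<lambda>st. (stake n (smap (to_nat_on (set_pmf p)) (fst st)), stake m (smap (to_nat_on (set_pmf q)) (snd st))))
    \<in> measurable (iid_stream p \<Otimes>\<^sub>M iid_stream q) (count_space UNIV \<Otimes>\<^sub>M count_space UNIV)"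
    by (intro measurable_Pair measurable_compose[OF measurable_fst measurable_stake_to_nat]
        measurable_compose[OF measurable_snd measurable_stake_to_nat])
  then have "(\<lambda>st. (stake n (smap (to_nat_on (set_pmf p)) (fst st)), stake m (smap (to_nat_on (set_pmf q)) (snd st))))
    \<in> measurable (iid_stream p \<Otimes>\<^sub>M iid_stream q) (count_space UNIV)"
    by (simp add: pair_measure_countable)
  from measurable_compose[OF this, where g = "\<lambda>(a, b). f (map (from_nat_into (set_pmf p)) a) (map (from_nat_into (set_pmf q)) b)"]
  show ?thesis unfolding stake_smap_retract by simp
qed

lemma nn_integral_stake:
  fixes f :: "'a list \<Rightarrow> ennreal"
  shows "(\<integral>\<^sup>+s. f (stake n (smap (support_retract p) s)) \<partial>iid_stream p) = (\<integral>\<^sup>+l. f l \<partial>replicate_pmf n p)"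
proof (induction n arbitrary: f)
  case 0
  interpret prob_space "iid_stream p" by (rule prob_space.prob_space_stream_space[OF measure_pmf.prob_space_axioms])
  show ?case by (simp add: emeasure_space_1)
next
  case (Suc n)
  have "(\<integral>\<^sup>+s. f (stake (Suc n) (smap (support_retract p) s)) \<partial>iid_stream p) =
    (\<integral>\<^sup>+x. \<integral>\<^sup>+s. f (support_retract p x # stake n (smap (support_retract p) s)) \<partial>iid_stream p \<partial>p)"
    by (subst prob_space.nn_integral_stream_space[OF measure_pmf.prob_space_axioms borel_measurable_stake]) (simp del: stake_smap)
  also have "\<dots> = (\<integral>\<^sup>+x. \<integral>\<^sup>+l. f (support_retract p x # l) \<partial>replicate_pmf n p \<partial>p)"
    by (simp only: Suc.IH[of "\<lambda>l. f (support_retract p _ # l)"])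
  also have "\<dots> = (\<integral>\<^sup>+x. \<integral>\<^sup>+l. f (x # l) \<partial>replicate_pmf n p \<partial>p)"
    by (intro nn_integral_cong_AE AE_pmfI) simp
  finally show ?case by simp
qed

lemma AE_iid_stream:
  "AE s in iid_stream p. \<forall>n. support_retract p (s !! n) = s !! n"
proof -
  have "AE s in iid_stream p. stream_all (\<lambda>x. support_retract p x = x) s"
    by (rule prob_space.AE_stream_all[OF measure_pmf.prob_space_axioms]) (auto simp: AE_measure_pmf_iff)
  then show ?thesis by (simp add: sset_range)
qed

lemma smap_retract_id:
  assumes "\<forall>n. support_retract p (s !! n) = s !! n"
  shows "smap (support_retract p) s = s"
  using assms by (intro stream.map_ident_strong) (auto simp: sset_range)

text \<open>Finite-time bounds exist for whole numbers of blocks only; the horizons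
  \<open>Q * L\<close> are cofinal.\<close>

lemma SUP_stake:
  fixes f :: "'a list \<Rightarrow> ennreal"
  assumes "L > 0"
  shows "(SUP n. f (stake n s)) = (SUP Q. SUP n\<in>{..Q * L}. f (take n (stake (Q * L) s)))"
proof (rule antisym)
  show "(SUP n. f (stake n s)) \<le> (SUP Q. SUP n\<in>{..Q * L}. f (take n (stake (Q * L) s)))"
  proof (rule SUP_least)
    fix n
    have n: "n \<le> n * L" using assms by simp
    then have "f (stake n s) = f (take n (stake (n * L) s))" by (simp add: take_stake min_def)
    also have "\<dots> \<le> (SUP k\<in>{..n * L}. f (take k (stake (n * L) s)))"
      by (rule SUP_upper) (use n in simp)
    also have "\<dots> \<le> (SUP Q. SUP n\<in>{..Q * L}. f (take n (stake (Q * L) s)))"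
      by (rule SUP_upper) simp
    finally show "f (stake n s) \<le> (SUP Q. SUP n\<in>{..Q * L}. f (take n (stake (Q * L) s)))" .
  qed
qed (auto simp: take_stake intro!: SUP_least SUP_upper)

text \<open>Monotone convergence in the horizon \<open>Q\<close>, applied to the retracted stream,
  which is almost surely the original one and has measurable prefixes.\<close>

lemma nn_integral_stream_SUP_le:
  fixes f :: "'a list \<Rightarrow> ennreal"
  assumes L: "L > 0"
    and B: "\<And>Q. (\<integral>\<^sup>+l. (SUP n\<in>{..Q * L}. f (take n l)) \<partial>replicate_pmf (Q * L) p) \<le> B"
  shows "(\<integral>\<^sup>+s. (SUP n. f (stake n s)) \<partial>iid_stream p) \<le> B"
proof -
  define G where "G Q l = (SUP n\<in>{..Q * L}. f (take n l))" for Q l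
  let ?r = "smap (support_retract p)"
  have "(\<integral>\<^sup>+s. (SUP n. f (stake n s)) \<partial>iid_stream p) = (\<integral>\<^sup>+s. (SUP Q. G Q (stake (Q * L) (?r s))) \<partial>iid_stream p)"
    unfolding G_def SUP_stake[OF L, symmetric]
  proof (rule nn_integral_cong_AE)
    show "AE s in iid_stream p. (SUP n. f (stake n s)) = (SUP n. f (stake n (?r s)))"
      using AE_iid_stream[of p] by eventually_elim (simp only: smap_retract_id simp_thms)
  qed
  also have "\<dots> = (SUP Q. \<integral>\<^sup>+s. G Q (stake (Q * L) (?r s)) \<partial>iid_stream p)"
  proof (rule nn_integral_monotone_convergence_SUP)
    show "incseq (\<lambda>Q s. G Q (stake (Q * L) (?r s)))"
    proof (rule incseq_SucI, rule le_funI)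
      fix Q s
      have "f (take n (stake (Q * L) s)) = f (take n (stake (Suc Q * L) s))" if "n \<le> Q * L" for n s
        using that by (simp add: take_stake min_def)
      then have "G Q (stake (Q * L) s) \<le> G (Suc Q) (stake (Suc Q * L) s)" for s
        unfolding G_def by (intro SUP_least) (auto intro!: SUP_upper2 trans_le_add2)
      then show "G Q (stake (Q * L) (?r s)) \<le> G (Suc Q) (stake (Suc Q * L) (?r s))" .
    qed
  qed (rule borel_measurable_stake)
  also have "\<dots> \<le> B"
  proof (rule SUP_least)
    fix Q
    show "(\<integral>\<^sup>+s. G Q (stake (Q * L) (?r s)) \<partial>iid_stream p) \<le> B"
      using B[of Q] unfolding nn_integral_stake[where f = "G Q"] by (simp add: G_def [abs_def])
  qed
  finally show ?thesis .
qed

lemma SUP_stake_pair: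
  fixes f :: "'a list \<Rightarrow> 'b list \<Rightarrow> ennreal"
  assumes "L > 0" "L' > 0"
  shows "(SUP n. SUP m. f (stake n s) (stake m t)) =
    (SUP Q. SUP n\<in>{..Q * L}. SUP m\<in>{..Q * L'}. f (take n (stake (Q * L) s)) (take m (stake (Q * L') t)))"
proof (rule antisym)
  show "(SUP n. SUP m. f (stake n s) (stake m t)) \<le>
    (SUP Q. SUP n\<in>{..Q * L}. SUP m\<in>{..Q * L'}. f (take n (stake (Q * L) s)) (take m (stake (Q * L') t)))"
  proof (intro SUP_least)
    fix n m :: nat
    \<comment> \<open>A common number of blocks covers both times although the block lengths
      \<open>L\<close> and \<open>L'\<close> may differ.\<close>
    define Q where "Q = max n m"
    have n: "n \<le> Q * L" "m \<le> Q * L'"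
      using assms by (auto simp: Q_def max_def intro: order_trans[OF _ mult_le_mono2[of 1]])
    then have "f (stake n s) (stake m t) = f (take n (stake (Q * L) s)) (take m (stake (Q * L') t))"
      by (simp add: take_stake min_def)
    also have "\<dots> \<le> (SUP m\<in>{..Q * L'}. f (take n (stake (Q * L) s)) (take m (stake (Q * L') t)))"
      by (rule SUP_upper) (use n in simp)
    also have "\<dots> \<le> (SUP n\<in>{..Q * L}. SUP m\<in>{..Q * L'}. f (take n (stake (Q * L) s)) (take m (stake (Q * L') t)))"
      by (rule SUP_upper) (use n in simp)
    also have "\<dots> \<le> (SUP Q. SUP n\<in>{..Q * L}. SUP m\<in>{..Q * L'}. f (take n (stake (Q * L) s)) (take m (stake (Q * L') t)))"
      by (rule SUP_upper) simp
    finally show "f (stake n s) (stake m t) \<le>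
      (SUP Q. SUP n\<in>{..Q * L}. SUP m\<in>{..Q * L'}. f (take n (stake (Q * L) s)) (take m (stake (Q * L') t)))" .
  qed
next
  have "f (take n (stake (Q * L) s)) (take m (stake (Q * L') t)) \<le> (SUP n. SUP m. f (stake n s) (stake m t))" for Q n m :: nat
    unfolding take_stake by (rule SUP_upper2[OF UNIV_I], rule SUP_upper) simp
  then show "(SUP Q. SUP n\<in>{..Q * L}. SUP m\<in>{..Q * L'}. f (take n (stake (Q * L) s)) (take m (stake (Q * L') t)))
    \<le> (SUP n. SUP m. f (stake n s) (stake m t))"
    by (intro SUP_least)
qed

lemma nn_integral_stream_pair_SUP_le:
  fixes f :: "'a list \<Rightarrow> 'b list \<Rightarrow> ennreal"
  assumes L: "L > 0" "L' > 0"
    and B: "\<And>Q. (\<integral>\<^sup>+l. \<integral>\<^sup>+l'. (SUP n\<in>{..Q * L}. SUP m\<in>{..Q * L'}. f (take n l) (take m l'))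
      \<partial>replicate_pmf (Q * L') q \<partial>replicate_pmf (Q * L) p) \<le> B"
  shows "(\<integral>\<^sup>+st. (SUP n. SUP m. f (stake n (fst st)) (stake m (snd st))) \<partial>(iid_stream p \<Otimes>\<^sub>M iid_stream q)) \<le> B"
proof -
  define G where "G Q l l' = (SUP n\<in>{..Q * L}. SUP m\<in>{..Q * L'}. f (take n l) (take m l'))" for Q l l'
  let ?r = "smap (support_retract p)" and ?r' = "smap (support_retract q)"
  let ?G = "\<lambda>Q st. G Q (stake (Q * L) (?r (fst st))) (stake (Q * L') (?r' (snd st)))"
  interpret P: prob_space "iid_stream p" by (rule prob_space.prob_space_stream_space[OF measure_pmf.prob_space_axioms])
  interpret Q: prob_space "iid_stream q" by (rule prob_space.prob_space_stream_space[OF measure_pmf.prob_space_axioms])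
  interpret PQ: pair_sigma_finite "iid_stream p" "iid_stream q" ..
  have AE: "AE st in iid_stream p \<Otimes>\<^sub>M iid_stream q.
    \<forall>n. support_retract p (fst st !! n) = fst st !! n \<and> support_retract q (snd st !! n) = snd st !! n"
  proof (rule PQ.AE_pair_measure)
    have "Measurable.pred (iid_stream p \<Otimes>\<^sub>M iid_stream q) (\<lambda>st. \<forall>n. support_retract p (fst st !! n) = fst st !! n
       \<and> support_retract q (snd st !! n) = snd st !! n)"
    proof (intro pred_intros_countable pred_intros_logic)
      fix n
      show "Measurable.pred (iid_stream p \<Otimes>\<^sub>M iid_stream q) (\<lambda>st. support_retract p (fst st !! n) = fst st !! n)"
        by (rule measurable_compose[OF measurable_compose[OF measurable_fst measurable_snth]]) simp
      show "Measurable.pred (iid_stream p \<Otimes>\<^sub>M iid_stream q) (\<lambda>st. support_retract q (snd st !! n) = snd st !! n)"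
        by (rule measurable_compose[OF measurable_compose[OF measurable_snd measurable_snth]]) simp
    qed
    then show "{st \<in> space (iid_stream p \<Otimes>\<^sub>M iid_stream q). \<forall>n. support_retract p (fst st !! n) = fst st !! n
       \<and> support_retract q (snd st !! n) = snd st !! n} \<in> sets (iid_stream p \<Otimes>\<^sub>M iid_stream q)"
      by (simp only: pred_def)
    show "AE s in iid_stream p. AE t in iid_stream q. \<forall>n. support_retract p (fst (s, t) !! n) = fst (s, t) !! n
       \<and> support_retract q (snd (s, t) !! n) = snd (s, t) !! n"
      using AE_iid_stream[of p]
    proof eventually_elim
      case (elim s)
      show ?case using AE_iid_stream[of q] by eventually_elim (use elim in simp)
    qed
  qed
  have "(\<integral>\<^sup>+st. (SUP n. SUP m. f (stake n (fst st)) (stake m (snd st))) \<partial>(iid_stream p \<Otimes>\<^sub>M iid_stream q)) =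
    (\<integral>\<^sup>+st. (SUP Q. ?G Q st) \<partial>(iid_stream p \<Otimes>\<^sub>M iid_stream q))"
    unfolding G_def SUP_stake_pair[OF L, symmetric]
  proof (rule nn_integral_cong_AE)
    show "AE st in iid_stream p \<Otimes>\<^sub>M iid_stream q. (SUP n. SUP m. f (stake n (fst st)) (stake m (snd st))) =
      (SUP n. SUP m. f (stake n (?r (fst st))) (stake m (?r' (snd st))))"
      using AE by eventually_elim (simp only: smap_retract_id simp_thms)
  qed
  also have "\<dots> = (SUP Q. \<integral>\<^sup>+st. ?G Q st \<partial>(iid_stream p \<Otimes>\<^sub>M iid_stream q))"
  proof (rule nn_integral_monotone_convergence_SUP)
    show "incseq ?G"
    proof (rule incseq_SucI, rule le_funI)
      fix Q st
      have "f (take n (stake (Q * L) s)) (take m (stake (Q * L') t)) =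
          f (take n (stake (Suc Q * L) s)) (take m (stake (Suc Q * L') t))"
        if "n \<le> Q * L" "m \<le> Q * L'" for n m s t
        using that by (simp add: take_stake min_def)
      then have "G Q (stake (Q * L) s) (stake (Q * L') t) \<le> G (Suc Q) (stake (Suc Q * L) s) (stake (Suc Q * L') t)" for s t
        unfolding G_def by (intro SUP_least) (auto intro!: SUP_upper2 trans_le_add2)
      then show "?G Q st \<le> ?G (Suc Q) st" .
    qed
  qed (rule borel_measurable_stake_pair)
  also have "\<dots> \<le> B"
  proof (rule SUP_least)
    fix Q :: nat
    have "(\<integral>\<^sup>+st. ?G Q st \<partial>(iid_stream p \<Otimes>\<^sub>M iid_stream q)) =
      (\<integral>\<^sup>+s. \<integral>\<^sup>+t. G Q (stake (Q * L) (?r s)) (stake (Q * L') (?r' t)) \<partial>iid_stream q \<partial>iid_stream p)"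
      using Q.nn_integral_fst[OF borel_measurable_stake_pair[of "G Q" "Q * L" p "Q * L'" q]] by simp
    also have "\<dots> = (\<integral>\<^sup>+l. \<integral>\<^sup>+l'. G Q l l' \<partial>replicate_pmf (Q * L') q \<partial>replicate_pmf (Q * L) p)"
      by (simp only: nn_integral_stake[where p = q]
        nn_integral_stake[where p = p and f = "\<lambda>l. \<integral>\<^sup>+l'. G Q l l' \<partial>replicate_pmf (Q * L') q"])
    finally show "(\<integral>\<^sup>+st. ?G Q st \<partial>(iid_stream p \<Otimes>\<^sub>M iid_stream q)) \<le> B"
      using B by (simp add: G_def [abs_def])
  qed
  finally show ?thesis .
qed

section \<open>Moment and exponential estimates\<close>

lemma fwd_walk_eq: "fwd_walk s n = comp_list (stake n s)"
  by (induction n) (simp_all add: stake_Suc del: stake.simps(2))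

lemma bwd_walk_eq: "bwd_walk s n = comp_list (map inv (stake n s))"
  by (induction n) (simp_all add: stake_Suc del: stake.simps(2))

lemma map_replicate_pmf: "map_pmf (map f) (replicate_pmf n p) = replicate_pmf n (map_pmf f p)"
proof (induction n)
  case (Suc n)
  show ?case by (simp add: map_bind_pmf bind_map_pmf flip: Suc.IH)
qed simp

lemma ennreal_le_divide_of_mult_le:
  assumes "a > 0" "S \<ge> 0" "ennreal a * I \<le> ennreal S"
  shows "I \<le> ennreal (S / a)"
proof -
  have "I = ennreal (1 / a) * (ennreal a * I)"
    using assms(1) by (simp add: mult.assoc[symmetric] ennreal_mult[symmetric])
  also have "\<dots> \<le> ennreal (1 / a) * ennreal S"
    by (rule mult_left_mono[OF assms(3)]) simp
  finally show ?thesis using assms by (simp flip: ennreal_mult)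
qed

lemma sum_ennreal_le_suminf:
  fixes B :: "nat \<Rightarrow> real"
  assumes "\<And>m. B m \<ge> 0" "summable B"
  shows "(\<Sum>m\<le>Q. ennreal (B m)) \<le> ennreal (\<Sum>m. B m)"
  using assms by (simp add: sum_ennreal ennreal_leI sum_le_suminf)

lemma ennreal_powr_mono: "p > 0 \<Longrightarrow> 0 \<le> s \<Longrightarrow> s \<le> t \<Longrightarrow> ennreal (s powr p) \<le> ennreal (t powr p)"
  by (intro ennreal_leI powr_mono2) auto

context schottky_walk
begin

text \<open>Of the \<open>2 * C\<close>, one \<open>C\<close> is lost at the word inserted by the
  maximal inequality and one at the blocking word. The inserted word adds exactly one block to the
  horizon.\<close>

lemma forward_stream_bound:
  fixes h :: "real \<Rightarrow> ennreal" and B :: "nat \<Rightarrow> real"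
  assumes mono: "\<And>s t. 0 \<le> s \<Longrightarrow> s \<le> t \<Longrightarrow> h s \<le> h t" and fin: "\<And>t. h t < \<top>"
    and B: "\<And>m x z. (\<integral>\<^sup>+cs. h (displacement bp (concat cs) + 2 * C) * indicator {cs. unblocked cs x z} cs
      \<partial>replicate_pmf m block_pmf) \<le> ennreal (B m)"
    and B0: "\<And>m. B m \<ge> 0" and sB: "summable B"
  shows "(\<integral>\<^sup>+s. (SUP n. h (gromov bp x (fwd_walk s n bp))) \<partial>iid_stream \<mu>) \<le> ennreal ((\<Sum>m. B m) / \<alpha>)"
  unfolding fwd_walk_eq
proof (rule nn_integral_stream_SUP_le[OF L_pos, where f = "\<lambda>l. h (gromov bp x (comp_list l bp))"])
  fix Q
  have "ennreal \<alpha> * (\<integral>\<^sup>+l. (SUP n\<in>{..Q * L}. h (gromov bp x (comp_list (take n l) bp))) \<partial>replicate_pmf (Q * L) \<mu>)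
    \<le> (\<integral>\<^sup>+l. h (gromov bp x (comp_list l bp) + C) \<partial>replicate_pmf (Suc Q * L) \<mu>)"
    using maximal_gromov[of h "{x}" "Q * L", OF mono fin] by simp
  also have "\<dots> \<le> (\<Sum>m\<le>Suc Q. ennreal (B m))"
  proof (rule nn_integral_gromov_le[where h = "\<lambda>t. h (t + C)"])
    show "h (s + C) \<le> h (t + C)" if "0 \<le> s" "s \<le> t" for s t
      using that C_nonneg by (intro mono) auto
    show "(\<integral>\<^sup>+cs. h (displacement bp (concat cs) + C + C) * indicator {cs. unblocked cs x z} cs
      \<partial>replicate_pmf m block_pmf) \<le> ennreal (B m)" for m x z
      using B[of m x z] by (simp add: add.assoc)
  qed
  also have "\<dots> \<le> ennreal (\<Sum>m. B m)"
    by (rule sum_ennreal_le_suminf[OF B0 sB])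
  finally show "(\<integral>\<^sup>+l. (SUP n\<in>{..Q * L}. h (gromov bp x (comp_list (take n l) bp))) \<partial>replicate_pmf (Q * L) \<mu>)
      \<le> ennreal ((\<Sum>m. B m) / \<alpha>)"
    by (intro ennreal_le_divide_of_mult_le \<alpha>_pos suminf_nonneg sB B0)
qed

end

section \<open>The forward and the backward walk together\<close>

locale two_sided_walk = fwd: schottky_walk bp \<mu> L W \<alpha> C F E +
  bwd: schottky_walk bp "map_pmf inv \<mu>" L' W' \<alpha>' C' F' E'
  for bp :: "'x::metric_space" and \<mu> L W \<alpha> C F E L' W' \<alpha>' C' F' E'
begin

text \<open>The maximal inequality is used once per walk with the other walk frozen, which costs
  \<open>C\<close> and \<open>C'\<close> and divides by \<open>\<alpha>\<close> and
  \<open>\<alpha>'\<close>.\<close>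

lemma two_sided_stream_bound:
  fixes h :: "real \<Rightarrow> ennreal"
  assumes mono: "\<And>s t. 0 \<le> s \<Longrightarrow> s \<le> t \<Longrightarrow> h s \<le> h t" and fin: "\<And>t. h t < \<top>"
    and S: "\<And>Q. (\<integral>\<^sup>+l. \<integral>\<^sup>+l'. h (gromov bp (comp_list l' bp) (comp_list l bp) + (C + C'))
      \<partial>replicate_pmf (Q * L') (map_pmf inv \<mu>) \<partial>replicate_pmf (Q * L) \<mu>) \<le> ennreal S"
    and S0: "S \<ge> 0"
  shows "(\<integral>\<^sup>+st. (SUP n. SUP n'. h (gromov bp (bwd_walk (snd st) n' bp) (fwd_walk (fst st) n bp)))
    \<partial>(iid_stream \<mu> \<Otimes>\<^sub>M iid_stream \<mu>)) \<le> ennreal (S / (\<alpha> * \<alpha>'))"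
  unfolding fwd_walk_eq bwd_walk_eq
proof (rule nn_integral_stream_pair_SUP_le[OF fwd.L_pos bwd.L_pos,
      where f = "\<lambda>l l'. h (gromov bp (comp_list (map inv l') bp) (comp_list l bp))"])
  fix Q
  let ?R = "replicate_pmf (Q * L) \<mu>" and ?R' = "replicate_pmf (Q * L') (map_pmf inv \<mu>)"
  let ?R1 = "replicate_pmf (L + Q * L) \<mu>" and ?R1' = "replicate_pmf (L' + Q * L') (map_pmf inv \<mu>)"
  \<comment> \<open>For the forward walk, the whole backward path up to the horizon is the finite
    set of far points, so its supremum is still inside when the forward time is fixed.\<close>
  let ?Y = "\<lambda>l'. (\<lambda>m. comp_list (take m l') bp) ` {..Q * L'}"
  let ?I = "\<integral>\<^sup>+l. \<integral>\<^sup>+l'. (SUP n\<in>{..Q * L}. SUP m\<in>{..Q * L'}.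
    h (gromov bp (comp_list (map inv (take m l')) bp) (comp_list (take n l) bp)))
    \<partial>replicate_pmf (Q * L') \<mu> \<partial>?R"
  have "?I = (\<integral>\<^sup>+l. \<integral>\<^sup>+l'. (SUP n\<in>{..Q * L}. SUP m\<in>{..Q * L'}.
      h (gromov bp (comp_list (take m l') bp) (comp_list (take n l) bp))) \<partial>?R' \<partial>?R)"
    by (simp add: take_map flip: map_replicate_pmf)
  also have "\<dots> = (\<integral>\<^sup>+l'. \<integral>\<^sup>+l. (SUP n\<in>{..Q * L}. SUP y\<in>?Y l'. h (gromov bp y (comp_list (take n l) bp))) \<partial>?R \<partial>?R')"
    by (subst nn_integral_pmf_swap) (simp add: image_comp o_def)
  finally have I: "?I = \<dots>" .
  have "ennreal \<alpha> * ?I = (\<integral>\<^sup>+l'. ennreal \<alpha> * (\<integral>\<^sup>+l. (SUP n\<in>{..Q * L}. SUP y\<in>?Y l'.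
      h (gromov bp y (comp_list (take n l) bp))) \<partial>?R) \<partial>?R')"
    unfolding I by (rule nn_integral_cmult[symmetric]) simp
  also have "\<dots> \<le> (\<integral>\<^sup>+l'. \<integral>\<^sup>+l. (SUP y\<in>?Y l'. h (gromov bp y (comp_list l bp) + C)) \<partial>?R1 \<partial>?R')"
    by (intro nn_integral_mono fwd.maximal_gromov mono fin) auto
  also have "\<dots> = (\<integral>\<^sup>+l. \<integral>\<^sup>+l'. (SUP m\<in>{..Q * L'}. SUP y\<in>{comp_list l bp}.
      h (gromov bp y (comp_list (take m l') bp) + C)) \<partial>?R' \<partial>?R1)"
    by (subst nn_integral_pmf_swap) (simp add: image_comp o_def gromov_commute[of bp "comp_list _ bp" "comp_list (take _ _) bp"])
  finally have 1: "ennreal \<alpha> * ?I \<le> \<dots>" .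
  have "ennreal (\<alpha> * \<alpha>') * ?I = ennreal \<alpha>' * (ennreal \<alpha> * ?I)"
    using fwd.\<alpha>_pos bwd.\<alpha>_pos by (simp add: ennreal_mult ac_simps)
  also have "\<dots> \<le> ennreal \<alpha>' * (\<integral>\<^sup>+l. \<integral>\<^sup>+l'. (SUP m\<in>{..Q * L'}. SUP y\<in>{comp_list l bp}.
      h (gromov bp y (comp_list (take m l') bp) + C)) \<partial>?R' \<partial>?R1)"
    by (rule mult_left_mono[OF 1]) simp
  also have "\<dots> = (\<integral>\<^sup>+l. ennreal \<alpha>' * (\<integral>\<^sup>+l'. (SUP m\<in>{..Q * L'}. SUP y\<in>{comp_list l bp}.
      h (gromov bp y (comp_list (take m l') bp) + C)) \<partial>?R') \<partial>?R1)"
    by (rule nn_integral_cmult[symmetric]) simp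
  also have "\<dots> \<le> (\<integral>\<^sup>+l. \<integral>\<^sup>+l'. (SUP y\<in>{comp_list l bp}. h (gromov bp y (comp_list l' bp) + C' + C)) \<partial>?R1' \<partial>?R1)"
    by (intro nn_integral_mono bwd.maximal_gromov[where h = "\<lambda>t. h (t + C)"])
      (use mono fin fwd.C_nonneg in auto)
  also have "\<dots> = (\<integral>\<^sup>+l. \<integral>\<^sup>+l'. h (gromov bp (comp_list l' bp) (comp_list l bp) + (C + C'))
      \<partial>replicate_pmf (Suc Q * L') (map_pmf inv \<mu>) \<partial>replicate_pmf (Suc Q * L) \<mu>)"
  proof -
    have *: "gromov bp (comp_list l bp) (comp_list l' bp) + C' + C =
        gromov bp (comp_list l' bp) (comp_list l bp) + (C + C')" for l l'
      by (simp add: gromov_commute)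
    show ?thesis by (simp only: mult_Suc image_insert image_empty cSup_singleton *)
  qed
  also have "\<dots> \<le> ennreal S" by (rule S)
  finally show "?I \<le> ennreal (S / (\<alpha> * \<alpha>'))"
    using fwd.\<alpha>_pos bwd.\<alpha>_pos S0 by (intro ennreal_le_divide_of_mult_le) auto
qed

text \<open>A block of either walk that blocks bounds the Gromov product, so its \<open>2p\<close>-th power is at
  most the product of the \<open>p\<close>-th powers of both displacements, which decouples the two walks.\<close>

lemma two_sided_moment:
  assumes p: "p > 0" and R: "R \<ge> 0"
    and fin: "(\<integral>\<^sup>+g. ennreal (dist bp (g bp) powr p) \<partial>\<mu>) < \<infinity>"
      "(\<integral>\<^sup>+g. ennreal (dist bp (g bp) powr p) \<partial>map_pmf inv \<mu>) < \<infinity>"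
  shows "\<exists>S\<ge>0. \<forall>Q. (\<integral>\<^sup>+l. \<integral>\<^sup>+l'. ennreal ((gromov bp (comp_list l' bp) (comp_list l bp) + R) powr (2 * p))
      \<partial>replicate_pmf (Q * L') (map_pmf inv \<mu>) \<partial>replicate_pmf (Q * L) \<mu>) \<le> ennreal S"
proof -
  have D: "C + R \<ge> 0" "C' + R \<ge> 0" using fwd.C_nonneg bwd.C_nonneg R by auto
  obtain K where K: "K \<ge> 0"
    "\<And>m x z. (\<integral>\<^sup>+cs. ennreal ((displacement bp (concat cs) + (C + R)) powr p) * indicator {cs. fwd.unblocked cs x z} cs
      \<partial>replicate_pmf m fwd.block_pmf) \<le> ennreal (K * real (m + 1) powr (p + 1) * fwd.\<rho> ^ m)"
    "\<And>m. (\<integral>\<^sup>+cs. ennreal ((displacement bp (concat cs) + (C + R)) powr p) \<partial>replicate_pmf m fwd.block_pmf)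
      \<le> ennreal (K * real (m + 1) powr (p + 1))"
    using fwd.moment_bounds[OF p D(1) fin(1)] by blast
  obtain K' where K': "K' \<ge> 0"
    "\<And>m x z. (\<integral>\<^sup>+cs. ennreal ((displacement bp (concat cs) + (C' + R)) powr p) * indicator {cs. bwd.unblocked cs x z} cs
      \<partial>replicate_pmf m bwd.block_pmf) \<le> ennreal (K' * real (m + 1) powr (p + 1) * bwd.\<rho> ^ m)"
    "\<And>m. (\<integral>\<^sup>+cs. ennreal ((displacement bp (concat cs) + (C' + R)) powr p) \<partial>replicate_pmf m bwd.block_pmf)
      \<le> ennreal (K' * real (m + 1) powr (p + 1))"
    using bwd.moment_bounds[OF p D(2) fin(2)] by blast
  define r where "r = max fwd.\<rho> bwd.\<rho>"
  \<comment> \<open>Decay is available only in the larger of two indices, but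
    \<open>r ^ max m m' \<le> \<sigma> ^ (m + m')\<close>, so the double sum factors.\<close>
  define \<sigma> where "\<sigma> = sqrt r"
  have r: "0 < r" "r < 1" "fwd.\<rho> \<le> r" "bwd.\<rho> \<le> r"
    using fwd.\<rho> bwd.\<rho> by (auto simp: r_def)
  have \<sigma>: "0 < \<sigma>" "\<sigma> < 1" "r = \<sigma>\<^sup>2" using r by (auto simp: \<sigma>_def)
  define q where "q m = real (m + 1) powr (p + 1)" for m :: nat
  have q: "q m \<ge> 0" for m by (simp add: q_def)
  have sq: "summable (\<lambda>m. q m * \<sigma> ^ m)"
    unfolding q_def by (rule summable_powr_geometric) (use \<sigma> in auto)
  define S where "S = K * K' * (\<Sum>m. q m * \<sigma> ^ m)\<^sup>2"
  have S: "S \<ge> 0" using K(1) K'(1) by (simp add: S_def)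
  define v where "v m cs = ennreal ((displacement bp (concat (take m cs)) + (C + R)) powr p)"
    for m and cs :: "('x \<Rightarrow> 'x) list list"
  define v' where "v' m cs = ennreal ((displacement bp (concat (take m cs)) + (C' + R)) powr p)"
    for m and cs :: "('x \<Rightarrow> 'x) list list"
  define i where "i m cs x = (indicator {ds. fwd.unblocked ds x (comp_list (concat (drop m cs)) bp)} (take m cs) :: ennreal)"
    for m cs x
  define i' where "i' m cs x = (indicator {ds. bwd.unblocked ds x (comp_list (concat (drop m cs)) bp)} (take m cs) :: ennreal)"
    for m cs x
  have i_le: "i m cs x \<le> 1" "i' m cs x \<le> 1" for m cs x by (auto simp: i_def i'_def indicator_def)
  have "(\<integral>\<^sup>+l. \<integral>\<^sup>+l'. ennreal ((gromov bp (comp_list l' bp) (comp_list l bp) + R) powr (2 * p))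
      \<partial>replicate_pmf (Q * L') (map_pmf inv \<mu>) \<partial>replicate_pmf (Q * L) \<mu>) \<le> ennreal S" for Q
  proof -
    let ?R = "replicate_pmf Q fwd.block_pmf" and ?R' = "replicate_pmf Q bwd.block_pmf"
    let ?x = "\<lambda>cs. comp_list (concat cs) bp"
    let ?t = "\<lambda>m m' cs cs'. (v m cs * i m cs (?x cs')) * (v' m' cs' * i' m' cs' (?x cs))"
    have J: "(\<integral>\<^sup>+cs. \<integral>\<^sup>+cs'. ?t m m' cs cs' \<partial>?R' \<partial>?R) \<le> ennreal (K * K' * (q m * \<sigma> ^ m) * (q m' * \<sigma> ^ m'))"
      if m: "m \<le> Q" "m' \<le> Q" for m m'
    proof -
      have v: "(\<integral>\<^sup>+cs. v m cs \<partial>?R) \<le> ennreal (K * q m)"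
        using K(3)[of m] nn_integral_take_drop[OF m(1), where f = "\<lambda>cs ds. ennreal ((displacement bp (concat cs) + (C + R)) powr p)" and \<nu> = fwd.block_pmf]
        by (simp add: v_def q_def measure_pmf.emeasure_space_1)
      have v': "(\<integral>\<^sup>+cs. v' m' cs \<partial>?R') \<le> ennreal (K' * q m')"
        using K'(3)[of m'] nn_integral_take_drop[OF m(2), where f = "\<lambda>cs ds. ennreal ((displacement bp (concat cs) + (C' + R)) powr p)" and \<nu> = bwd.block_pmf]
        by (simp add: v'_def q_def measure_pmf.emeasure_space_1)
      have u: "(\<integral>\<^sup>+cs. v m cs * i m cs x \<partial>?R) \<le> ennreal (K * q m * fwd.\<rho> ^ m)" for x
        unfolding v_def i_def q_def
        by (rule fwd.nn_integral_unblocked_take_le[where f = "\<lambda>cs. ennreal ((displacement bp (concat cs) + (C + R)) powr p)", OF K(2) m(1)])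
      have u': "(\<integral>\<^sup>+cs. v' m' cs * i' m' cs x \<partial>?R') \<le> ennreal (K' * q m' * bwd.\<rho> ^ m')" for x
        unfolding v'_def i'_def q_def
        by (rule bwd.nn_integral_unblocked_take_le[where f = "\<lambda>cs. ennreal ((displacement bp (concat cs) + (C' + R)) powr p)", OF K'(2) m(2)])
      \<comment> \<open>Each event involves the endpoint of the other walk, so the two factors are
        not independent. Dropping one event leaves a function of one walk alone, whose moment grows
        polynomially, and uniformity in the endpoint yields the decay from the other.\<close>
      have "(\<integral>\<^sup>+cs. \<integral>\<^sup>+cs'. ?t m m' cs cs' \<partial>?R' \<partial>?R) \<le>
          (\<integral>\<^sup>+cs. \<integral>\<^sup>+cs'. v m cs * (v' m' cs' * i' m' cs' (?x cs)) \<partial>?R' \<partial>?R)"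
        using i_le(1) by (intro nn_integral_mono mult_right_mono) (auto intro: mult_left_le)
      also have "\<dots> = (\<integral>\<^sup>+cs. v m cs * (\<integral>\<^sup>+cs'. v' m' cs' * i' m' cs' (?x cs) \<partial>?R') \<partial>?R)"
        by (simp add: nn_integral_cmult)
      also have "\<dots> \<le> (\<integral>\<^sup>+cs. v m cs * ennreal (K' * q m' * bwd.\<rho> ^ m') \<partial>?R)"
        by (intro nn_integral_mono mult_left_mono u') auto
      also have "\<dots> \<le> ennreal (K * q m) * ennreal (K' * q m' * bwd.\<rho> ^ m')"
        by (subst nn_integral_multc) (auto intro!: mult_right_mono v)
      also have "\<dots> = ennreal (K * K' * q m * q m' * bwd.\<rho> ^ m')"
        using K(1) K'(1) q bwd.\<rho> by (simp add: ennreal_mult[symmetric] mult_ac)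
      also have "\<dots> \<le> ennreal (K * K' * q m * q m' * r ^ m')"
        using K(1) K'(1) q bwd.\<rho> r by (intro ennreal_leI mult_left_mono power_mono) auto
      finally have 1: "(\<integral>\<^sup>+cs. \<integral>\<^sup>+cs'. ?t m m' cs cs' \<partial>?R' \<partial>?R) \<le> ennreal (K * K' * q m * q m' * r ^ m')" .
      have "(\<integral>\<^sup>+cs. \<integral>\<^sup>+cs'. ?t m m' cs cs' \<partial>?R' \<partial>?R) = (\<integral>\<^sup>+cs'. \<integral>\<^sup>+cs. ?t m m' cs cs' \<partial>?R \<partial>?R')"
        by (rule nn_integral_pmf_swap)
      also have "\<dots> \<le> (\<integral>\<^sup>+cs'. \<integral>\<^sup>+cs. (v m cs * i m cs (?x cs')) * v' m' cs' \<partial>?R \<partial>?R')"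
        using i_le(2) by (intro nn_integral_mono mult_left_mono) (auto intro: mult_left_le)
      also have "\<dots> = (\<integral>\<^sup>+cs'. (\<integral>\<^sup>+cs. v m cs * i m cs (?x cs') \<partial>?R) * v' m' cs' \<partial>?R')"
        by (simp add: nn_integral_multc)
      also have "\<dots> \<le> (\<integral>\<^sup>+cs'. ennreal (K * q m * fwd.\<rho> ^ m) * v' m' cs' \<partial>?R')"
        by (intro nn_integral_mono mult_right_mono u) auto
      also have "\<dots> \<le> ennreal (K * q m * fwd.\<rho> ^ m) * ennreal (K' * q m')"
        by (subst nn_integral_cmult) (auto intro!: mult_left_mono v')
      also have "\<dots> = ennreal (K * K' * q m * q m' * fwd.\<rho> ^ m)"
        using K(1) K'(1) q fwd.\<rho> by (simp add: ennreal_mult[symmetric] mult_ac)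
      also have "\<dots> \<le> ennreal (K * K' * q m * q m' * r ^ m)"
        using K(1) K'(1) q fwd.\<rho> r by (intro ennreal_leI mult_left_mono power_mono) auto
      finally have 2: "(\<integral>\<^sup>+cs. \<integral>\<^sup>+cs'. ?t m m' cs cs' \<partial>?R' \<partial>?R) \<le> ennreal (K * K' * q m * q m' * r ^ m)" .
      have "(\<integral>\<^sup>+cs. \<integral>\<^sup>+cs'. ?t m m' cs cs' \<partial>?R' \<partial>?R) \<le> ennreal (K * K' * q m * q m' * r ^ max m m')"
        using 1 2 by (cases "m \<le> m'") (auto simp: max_def)
      also have "\<dots> \<le> ennreal (K * K' * q m * q m' * \<sigma> ^ (m + m'))"
      proof (intro ennreal_leI mult_left_mono)
        have "r ^ max m m' = \<sigma> ^ (2 * max m m')" by (simp add: \<sigma>(3) power_mult)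
        also have "\<dots> \<le> \<sigma> ^ (m + m')" using \<sigma> by (intro power_decreasing) auto
        finally show "r ^ max m m' \<le> \<sigma> ^ (m + m')" .
      qed (use K(1) K'(1) q in auto)
      finally show ?thesis by (simp add: power_add mult_ac)
    qed
    have "(\<integral>\<^sup>+l. \<integral>\<^sup>+l'. ennreal ((gromov bp (comp_list l' bp) (comp_list l bp) + R) powr (2 * p))
      \<partial>replicate_pmf (Q * L') (map_pmf inv \<mu>) \<partial>replicate_pmf (Q * L) \<mu>) =
      (\<integral>\<^sup>+cs. \<integral>\<^sup>+cs'. ennreal ((gromov bp (?x cs') (?x cs) + R) powr (2 * p)) \<partial>?R' \<partial>?R)"
      by (simp add: fwd.block_pmf_def bwd.block_pmf_def flip: replicate_pmf_concat)
    also have "\<dots> \<le> (\<integral>\<^sup>+cs. \<integral>\<^sup>+cs'. (\<Sum>m\<le>Q. \<Sum>m'\<le>Q. ?t m m' cs cs') \<partial>?R' \<partial>?R)"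
    proof (intro nn_integral_replicate_pmf_mono)
      fix cs cs' :: "('x \<Rightarrow> 'x) list list"
      assume cs: "length cs = Q" "set cs \<subseteq> set_pmf fwd.block_pmf"
        and cs': "length cs' = Q" "set cs' \<subseteq> set_pmf bwd.block_pmf"
      define X where "X = gromov bp (?x cs') (?x cs) + R"
      have X: "X \<ge> 0" using gromov_nonneg[of bp "?x cs'" "?x cs"] R by (simp add: X_def)
      obtain m where m: "m \<le> Q" "fwd.unblocked (take m cs) (?x cs') (comp_list (concat (drop m cs)) bp)"
        "gromov bp (?x cs') (?x cs) \<le> displacement bp (concat (take m cs)) + C"
        using fwd.first_block[OF cs(2), of "?x cs'"] cs(1) by auto
      obtain m' where m': "m' \<le> Q" "bwd.unblocked (take m' cs') (?x cs) (comp_list (concat (drop m' cs')) bp)"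
        "gromov bp (?x cs) (?x cs') \<le> displacement bp (concat (take m' cs')) + C'"
        using bwd.first_block[OF cs'(2), of "?x cs"] cs'(1) by auto
      have "ennreal (X powr (2 * p)) = ennreal (X powr p) * ennreal (X powr p)"
        using powr_add[of X p p] by (simp add: ennreal_mult')
      also have "\<dots> \<le> v m cs * v' m' cs'"
        unfolding v_def v'_def
        by (intro mult_mono ennreal_powr_mono p X)
          (use m(3) m'(3) in \<open>auto simp: X_def gromov_commute[of bp "?x cs"]\<close>)
      also have "\<dots> = ?t m m' cs cs'" using m(2) m'(2) by (simp add: i_def i'_def)
      also have "\<dots> \<le> (\<Sum>m'\<le>Q. ?t m m' cs cs')"
        by (rule member_le_sum) (use m' in auto)
      also have "\<dots> \<le> (\<Sum>m\<le>Q. \<Sum>m'\<le>Q. ?t m m' cs cs')"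
        by (rule member_le_sum) (use m in auto)
      finally show "ennreal ((gromov bp (?x cs') (?x cs) + R) powr (2 * p)) \<le> (\<Sum>m\<le>Q. \<Sum>m'\<le>Q. ?t m m' cs cs')"
        by (simp add: X_def)
    qed
    also have "\<dots> = (\<Sum>m\<le>Q. \<Sum>m'\<le>Q. \<integral>\<^sup>+cs. \<integral>\<^sup>+cs'. ?t m m' cs cs' \<partial>?R' \<partial>?R)"
      by (simp add: nn_integral_sum)
    also have "\<dots> \<le> (\<Sum>m\<le>Q. \<Sum>m'\<le>Q. ennreal (K * K' * (q m * \<sigma> ^ m) * (q m' * \<sigma> ^ m')))"
      by (intro sum_mono J) auto
    also have "\<dots> = ennreal (\<Sum>m\<le>Q. \<Sum>m'\<le>Q. K * K' * (q m * \<sigma> ^ m) * (q m' * \<sigma> ^ m'))"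
      using K(1) K'(1) q \<sigma> by (simp add: sum_ennreal sum_nonneg)
    also have "(\<Sum>m\<le>Q. \<Sum>m'\<le>Q. K * K' * (q m * \<sigma> ^ m) * (q m' * \<sigma> ^ m')) = K * K' * (\<Sum>m\<le>Q. q m * \<sigma> ^ m)\<^sup>2"
      unfolding power2_eq_square sum_product by (simp add: sum_distrib_left mult.assoc)
    also have "ennreal \<dots> \<le> ennreal S"
      unfolding S_def using K(1) K'(1) q \<sigma> sq
      by (intro ennreal_leI mult_left_mono power_mono sum_le_suminf sum_nonneg) auto
    finally show ?thesis .
  qed
  with S show ?thesis by blast
qed

lemma moment_estimate:
  assumes p: "p > 0"
    and fin: "(\<integral>\<^sup>+g. ennreal (dist bp (g bp) powr p) \<partial>\<mu>) < \<infinity>"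
      "(\<integral>\<^sup>+g. ennreal (dist bp (g bp) powr p) \<partial>map_pmf inv \<mu>) < \<infinity>"
  shows "\<exists>K1 K2.
    (\<forall>x. (\<integral>\<^sup>+s. (SUP n. ennreal (gromov bp x (fwd_walk s n bp) powr p)) \<partial>iid_stream \<mu>) \<le> ennreal K1) \<and>
    (\<integral>\<^sup>+st. (SUP n. SUP n'. ennreal (gromov bp (bwd_walk (snd st) n' bp) (fwd_walk (fst st) n bp) powr (2 * p)))
      \<partial>(iid_stream \<mu> \<Otimes>\<^sub>M iid_stream \<mu>)) \<le> ennreal K2"
proof -
  have "2 * C \<ge> 0" using fwd.C_nonneg by simp
  then obtain K where K: "K \<ge> 0"
    "\<And>m x z. (\<integral>\<^sup>+cs. ennreal ((displacement bp (concat cs) + 2 * C) powr p) * indicator {cs. fwd.unblocked cs x z} cs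
      \<partial>replicate_pmf m fwd.block_pmf) \<le> ennreal (K * real (m + 1) powr (p + 1) * fwd.\<rho> ^ m)"
    using fwd.moment_bounds[OF p _ fin(1)] by blast
  have sB: "summable (\<lambda>m. K * real (m + 1) powr (p + 1) * fwd.\<rho> ^ m)"
    using summable_mult[OF summable_powr_geometric[of "fwd.\<rho>" "p + 1"], of K] fwd.\<rho>
    by (simp add: mult.assoc)
  have 1: "(\<integral>\<^sup>+s. (SUP n. ennreal (gromov bp x (fwd_walk s n bp) powr p)) \<partial>iid_stream \<mu>) \<le>
      ennreal ((\<Sum>m. K * real (m + 1) powr (p + 1) * fwd.\<rho> ^ m) / \<alpha>)" for x
    by (rule fwd.forward_stream_bound[where h = "\<lambda>t. ennreal (t powr p)", OF ennreal_powr_mono[OF p] _ K(2) _ sB])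
      (use K(1) fwd.\<rho> in auto)
  have R: "C + C' \<ge> 0" using fwd.C_nonneg bwd.C_nonneg by simp
  obtain S where S: "S \<ge> 0"
    "\<And>Q. (\<integral>\<^sup>+l. \<integral>\<^sup>+l'. ennreal ((gromov bp (comp_list l' bp) (comp_list l bp) + (C + C')) powr (2 * p))
      \<partial>replicate_pmf (Q * L') (map_pmf inv \<mu>) \<partial>replicate_pmf (Q * L) \<mu>) \<le> ennreal S"
    using two_sided_moment[OF p R fin] by blast
  have "(\<integral>\<^sup>+st. (SUP n. SUP n'. ennreal (gromov bp (bwd_walk (snd st) n' bp) (fwd_walk (fst st) n bp) powr (2 * p)))
      \<partial>(iid_stream \<mu> \<Otimes>\<^sub>M iid_stream \<mu>)) \<le> ennreal (S / (\<alpha> * \<alpha>'))"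
    by (rule two_sided_stream_bound[where h = "\<lambda>t. ennreal (t powr (2 * p))", OF ennreal_powr_mono _ S(2,1)])
      (use p in auto)
  with 1 show ?thesis by blast
qed

lemma exponential_estimate:
  assumes c: "c > 0" and fin: "(\<integral>\<^sup>+g. ennreal (exp (c * dist bp (g bp))) \<partial>\<mu>) < \<infinity>"
  shows "\<exists>\<kappa>>0. \<exists>K1 K2.
    (\<forall>x. (\<integral>\<^sup>+s. (SUP n. ennreal (exp (\<kappa> * gromov bp x (fwd_walk s n bp)))) \<partial>iid_stream \<mu>) \<le> ennreal K1) \<and>
    (\<integral>\<^sup>+st. (SUP n. SUP n'. ennreal (exp (\<kappa> * gromov bp (bwd_walk (snd st) n' bp) (fwd_walk (fst st) n bp))))
      \<partial>(iid_stream \<mu> \<Otimes>\<^sub>M iid_stream \<mu>)) \<le> ennreal K2"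
proof -
  obtain \<kappa> r where \<kappa>: "\<kappa> > 0" and r: "0 \<le> r" "r < 1" and B:
    "\<And>m D x z. (\<integral>\<^sup>+cs. ennreal (exp (\<kappa> * (displacement bp (concat cs) + D))) * indicator {cs. fwd.unblocked cs x z} cs
      \<partial>replicate_pmf m fwd.block_pmf) \<le> ennreal (exp (\<kappa> * D) * 2 * r ^ m)"
    using fwd.exponential_bound[OF c fin] by blast
  have mono: "ennreal (exp (\<kappa> * s)) \<le> ennreal (exp (\<kappa> * t))" if "s \<le> t" for s t
    using that \<kappa> by (intro ennreal_leI) simp
  have sB: "summable (\<lambda>m. exp (\<kappa> * D) * 2 * r ^ m)" for D
    using r by (intro summable_mult summable_geometric) simp
  have B0: "exp (\<kappa> * D) * 2 * r ^ m \<ge> 0" for D m using r by simp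
  have 1: "(\<integral>\<^sup>+s. (SUP n. ennreal (exp (\<kappa> * gromov bp x (fwd_walk s n bp)))) \<partial>iid_stream \<mu>) \<le>
      ennreal ((\<Sum>m. exp (\<kappa> * (2 * C)) * 2 * r ^ m) / \<alpha>)" for x
    by (rule fwd.forward_stream_bound[where h = "\<lambda>t. ennreal (exp (\<kappa> * t))", OF mono _ B B0 sB]) auto
  define R where "R = C + C'"
  have R: "R \<ge> 0" using fwd.C_nonneg bwd.C_nonneg by (simp add: R_def)
  define S where "S = (\<Sum>m. exp (\<kappa> * (C + R)) * 2 * r ^ m)"
  have S: "S \<ge> 0" unfolding S_def by (rule suminf_nonneg[OF sB B0])
  have "(\<integral>\<^sup>+l. \<integral>\<^sup>+l'. ennreal (exp (\<kappa> * (gromov bp (comp_list l' bp) (comp_list l bp) + R)))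
      \<partial>replicate_pmf (Q * L') (map_pmf inv \<mu>) \<partial>replicate_pmf (Q * L) \<mu>) \<le> ennreal S" for Q
  proof -
    \<comment> \<open>The exponential bound for a pair needs no decoupling: the forward bound is
      uniform in \<open>x\<close>, which is then set to the backward endpoint.\<close>
    have "(\<integral>\<^sup>+l. ennreal (exp (\<kappa> * (gromov bp x (comp_list l bp) + R))) \<partial>replicate_pmf (Q * L) \<mu>) \<le> ennreal S" for x
    proof -
      have "(\<integral>\<^sup>+l. ennreal (exp (\<kappa> * (gromov bp x (comp_list l bp) + R))) \<partial>replicate_pmf (Q * L) \<mu>) \<le>
          (\<Sum>m\<le>Q. ennreal (exp (\<kappa> * (C + R)) * 2 * r ^ m))"
        by (rule fwd.nn_integral_gromov_le[where h = "\<lambda>t. ennreal (exp (\<kappa> * (t + R)))"])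
          (use mono B[of _ "C + R"] in \<open>simp_all add: add.assoc\<close>)
      also have "\<dots> \<le> ennreal S"
        unfolding S_def by (rule sum_ennreal_le_suminf[OF B0 sB])
      finally show ?thesis .
    qed
    then have "(\<integral>\<^sup>+l'. \<integral>\<^sup>+l. ennreal (exp (\<kappa> * (gromov bp (comp_list l' bp) (comp_list l bp) + R)))
        \<partial>replicate_pmf (Q * L) \<mu> \<partial>replicate_pmf (Q * L') (map_pmf inv \<mu>)) \<le>
        (\<integral>\<^sup>+l'. ennreal S \<partial>replicate_pmf (Q * L') (map_pmf inv \<mu>))"
      by (intro nn_integral_mono)
    then show ?thesis
      by (subst nn_integral_pmf_swap) (simp add: measure_pmf.emeasure_space_1)
  qed
  then have "(\<integral>\<^sup>+st. (SUP n. SUP n'. ennreal (exp (\<kappa> * gromov bp (bwd_walk (snd st) n' bp) (fwd_walk (fst st) n bp))))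
      \<partial>(iid_stream \<mu> \<Otimes>\<^sub>M iid_stream \<mu>)) \<le> ennreal (S / (\<alpha> * \<alpha>'))"
    unfolding R_def
    by (intro two_sided_stream_bound[where h = "\<lambda>t. ennreal (exp (\<kappa> * t))", OF mono _ _ S]) auto
  with \<kappa> 1 show ?thesis by blast
qed

end

theorem theorem1p2:
  fixes G :: "('x::metric_space \<Rightarrow> 'x) set" and bp :: 'x and \<mu> :: "('x \<Rightarrow> 'x) pmf"
  assumes "geodesic_space TYPE('x)"
    and "isometry_group G" and "countable G"
    and "has_two_independent_contracting bp G"
    and "set_pmf \<mu> \<subseteq> G"
    and "non_elementary bp \<mu>"
  shows
    "(\<forall>p>0. finite_pth_moment bp p \<mu> \<longrightarrow>
       (\<exists>K>0. \<forall>x.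
          (\<integral>\<^sup>+ s. (SUP n. ennreal (gromov bp (fwd_walk s n bp) x powr p))
              \<partial>stream_space (measure_pmf \<mu>)) < ennreal K \<and>
          (\<integral>\<^sup>+ st. (SUP n. SUP n'. ennreal
                 (gromov bp (bwd_walk (snd st) n' bp) (fwd_walk (fst st) n bp) powr (2 * p)))
              \<partial>(stream_space (measure_pmf \<mu>) \<Otimes>\<^sub>M stream_space (measure_pmf \<mu>))) < ennreal K))
     \<and>
     (finite_exp_moment bp \<mu> \<longrightarrow>
       (\<exists>\<kappa>>0. \<exists>K>0. \<forall>x.
          (\<integral>\<^sup>+ s. (SUP n. ennreal (exp (\<kappa> * gromov bp x (fwd_walk s n bp))))
              \<partial>stream_space (measure_pmf \<mu>)) < ennreal K \<and>
          (\<integral>\<^sup>+ st. (SUP n. SUP n'. ennreal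
                 (exp (\<kappa> * gromov bp (bwd_walk (snd st) n' bp) (fwd_walk (fst st) n bp))))
              \<partial>(stream_space (measure_pmf \<mu>) \<Otimes>\<^sub>M stream_space (measure_pmf \<mu>))) < ennreal K))"
proof -
  have iso: "isometry g" if "g \<in> set_pmf \<mu>" for g
    using assms(2,5) that unfolding isometry_group_def by blast
  have iso': "isometry g" if "g \<in> set_pmf (map_pmf inv \<mu>)" for g
    using that iso isometry_inv by auto
  have ne': "non_elementary bp (map_pmf inv \<mu>)"
    by (rule non_elementary_inv[OF _ assms(6)]) (use iso isometry_bij in blast)
  obtain L W \<alpha> C F E where "schottky bp \<mu> L W \<alpha> C F E"
    using schottky_exists[OF assms(1) iso assms(6)] by blast
  moreover obtain L' W' \<alpha>' C' F' E' where "schottky bp (map_pmf inv \<mu>) L' W' \<alpha>' C' F' E'"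
    using schottky_exists[OF assms(1) iso' ne'] by blast
  ultimately interpret two_sided_walk bp \<mu> L W \<alpha> C F E L' W' \<alpha>' C' F' E'
    by unfold_locales
  \<comment> \<open>Adding 1 makes the bounds strict; the maximum with 0 is there because
    \<open>K1\<close> and \<open>K2\<close> come without a sign.\<close>
  have less: "a < ennreal (max 0 (max K1 K2) + 1)"
    if "a \<le> ennreal K1 \<or> a \<le> ennreal K2" for a K1 K2
  proof -
    have "ennreal K1 \<le> ennreal (max 0 (max K1 K2))" "ennreal K2 \<le> ennreal (max 0 (max K1 K2))"
      by (intro ennreal_leI; simp)+
    with that have "a \<le> ennreal (max 0 (max K1 K2))" by (meson order_trans)
    also have "\<dots> < ennreal (max 0 (max K1 K2) + 1)" by (intro ennreal_lessI) auto
    finally show ?thesis .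
  qed
  show ?thesis
  proof (intro conjI allI impI)
    fix p :: real assume p: "p > 0" and m: "finite_pth_moment bp p \<mu>"
    have fin: "(\<integral>\<^sup>+g. ennreal (dist bp (g bp) powr p) \<partial>\<mu>) < \<infinity>"
      using m by (simp add: finite_pth_moment_def)
    have "(\<integral>\<^sup>+g. ennreal (dist bp (g bp) powr p) \<partial>map_pmf inv \<mu>) = (\<integral>\<^sup>+g. ennreal (dist bp (g bp) powr p) \<partial>\<mu>)"
    proof -
      have "dist bp (inv g bp) = dist bp (g bp)" if "g \<in> set_pmf \<mu>" for g
        using iso[OF that] by (metis dist_commute dist_inv_left)
      then show ?thesis
        unfolding nn_integral_map_pmf by (intro nn_integral_cong_AE AE_pmfI) simp
    qed
    with fin have fin': "(\<integral>\<^sup>+g. ennreal (dist bp (g bp) powr p) \<partial>map_pmf inv \<mu>) < \<infinity>" by simp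
    obtain K1 K2 where K:
      "\<And>x. (\<integral>\<^sup>+s. (SUP n. ennreal (gromov bp x (fwd_walk s n bp) powr p)) \<partial>iid_stream \<mu>) \<le> ennreal K1"
      "(\<integral>\<^sup>+st. (SUP n. SUP n'. ennreal (gromov bp (bwd_walk (snd st) n' bp) (fwd_walk (fst st) n bp) powr (2 * p)))
        \<partial>(iid_stream \<mu> \<Otimes>\<^sub>M iid_stream \<mu>)) \<le> ennreal K2"
      using moment_estimate[OF p fin fin'] by blast
    have comm: "gromov bp (fwd_walk s n bp) x = gromov bp x (fwd_walk s n bp)" for s n x
      by (rule gromov_commute)
    show "\<exists>K>0. \<forall>x.
          (\<integral>\<^sup>+ s. (SUP n. ennreal (gromov bp (fwd_walk s n bp) x powr p))
              \<partial>stream_space (measure_pmf \<mu>)) < ennreal K \<and>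
          (\<integral>\<^sup>+ st. (SUP n. SUP n'. ennreal
                 (gromov bp (bwd_walk (snd st) n' bp) (fwd_walk (fst st) n bp) powr (2 * p)))
              \<partial>(stream_space (measure_pmf \<mu>) \<Otimes>\<^sub>M stream_space (measure_pmf \<mu>))) < ennreal K"
    proof (intro exI[of _ "max 0 (max K1 K2) + 1"] conjI allI)
      show "(\<integral>\<^sup>+ s. (SUP n. ennreal (gromov bp (fwd_walk s n bp) x powr p))
          \<partial>stream_space (measure_pmf \<mu>)) < ennreal (max 0 (max K1 K2) + 1)" for x
        unfolding comm by (rule less, rule disjI1, rule K(1))
    qed (simp, rule less, rule disjI2, rule K(2))
  next
    assume "finite_exp_moment bp \<mu>"
    then obtain c where c: "c > 0" "(\<integral>\<^sup>+g. ennreal (exp (c * dist bp (g bp))) \<partial>\<mu>) < \<infinity>"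
      unfolding finite_exp_moment_def by blast
    obtain \<kappa> K1 K2 where \<kappa>: "\<kappa> > 0" and K:
      "\<And>x. (\<integral>\<^sup>+s. (SUP n. ennreal (exp (\<kappa> * gromov bp x (fwd_walk s n bp)))) \<partial>iid_stream \<mu>) \<le> ennreal K1"
      "(\<integral>\<^sup>+st. (SUP n. SUP n'. ennreal (exp (\<kappa> * gromov bp (bwd_walk (snd st) n' bp) (fwd_walk (fst st) n bp))))
        \<partial>(iid_stream \<mu> \<Otimes>\<^sub>M iid_stream \<mu>)) \<le> ennreal K2"
      using exponential_estimate[OF c] by blast
    show "\<exists>\<kappa>>0. \<exists>K>0. \<forall>x.
          (\<integral>\<^sup>+ s. (SUP n. ennreal (exp (\<kappa> * gromov bp x (fwd_walk s n bp))))
              \<partial>stream_space (measure_pmf \<mu>)) < ennreal K \<and>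
          (\<integral>\<^sup>+ st. (SUP n. SUP n'. ennreal
                 (exp (\<kappa> * gromov bp (bwd_walk (snd st) n' bp) (fwd_walk (fst st) n bp))))
              \<partial>(stream_space (measure_pmf \<mu>) \<Otimes>\<^sub>M stream_space (measure_pmf \<mu>))) < ennreal K"
    proof (rule exI[of _ \<kappa>], rule conjI[OF \<kappa>], intro exI[of _ "max 0 (max K1 K2) + 1"] conjI allI)
      show "(\<integral>\<^sup>+ s. (SUP n. ennreal (exp (\<kappa> * gromov bp x (fwd_walk s n bp))))
          \<partial>stream_space (measure_pmf \<mu>)) < ennreal (max 0 (max K1 K2) + 1)" for x
        by (rule less, rule disjI1, rule K(1))
    qed (simp, rule less, rule disjI2, rule K(2))
  qed
qed

end
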